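(* Let $m\ge1$, $1\le r\le\infty$ with conjugate exponent $r'$, $1\le q<\infty$, $0<p<\infty$, and let $X$ be an $\mathcal L_q^g$-space. Suppose that one of the following holds: $r=2$ and $p,q<2$; or $r=2$ and $q\le p$; or $p<r'<2$ and $q\le2$. Then there is a constant $K$ (depending on $r$, $q$ and $p$) such that for any finite matrix $(x_{i_1,\dots,i_m})_{i_1,\dots,i_m}\subset X$ and any choice of scalars $\alpha_{i_1,\dots,i_m}$ we have $$\pi_p\Big(\sum_{i_1,\dots,i_m}\alpha_{i_1,\dots,i_m}\,e_{i_1}'\otimes\cdots\otimes e_{i_m}'\,x_{i_1,\dots,i_m}\Big)\le K\,\|(\alpha_{i_1,\dots,i_m})\|_\infty\,\pi_p\Big(\sum_{i_1,\dots,i_m}e_{i_1}'\otimes\cdots\otimes e_{i_m}'\,x_{i_1,\dots,i_m}\Big),$$ where the $\pi_p$ norms are taken in $\Pi_p(^m\ell_r;X)$.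
   Context: $\mathbb K=\mathbb R$ or $\mathbb C$; $1/r+1/r'=1$. $m$ and $X$ are fixed before the constant $K$. $e_i'$ denotes the $i$-th coordinate functional on $\ell_r$, and $e_{i_1}'\otimes\cdots\otimes e_{i_m}'\,x$ is the $m$-linear map $(y^1,\dots,y^m)\mapsto e_{i_1}'(y^1)\cdots e_{i_m}'(y^m)\,x$. $\|(\alpha_{i_1,\dots,i_m})\|_\infty=\max|\alpha_{i_1,\dots,i_m}|$. Multiple summing norm: for a continuous $m$-linear $T:E_1\times\dots\times E_m\to F$ between Banach spaces, $\pi_p(T)$ is the infimum of all $C>0$ such that for all finite sequences $(x^k_{j_k})_{j_k=1}^{J_k}\subset E_k$, $k=1,\dots,m$, $$\Big(\sum_{j_1,\dots,j_m}\|T(x^1_{j_1},\dots,x^m_{j_m})\|_F^p\Big)^{1/p}\le C\,w_p((x^1_{j})_{j})\cdots w_p((x^m_{j})_{j}),\qquad w_p((y_j)_j)=\sup_{\gamma\in B_{E'}}\Big(\sum_j|\gamma(y_j)|^p\Big)^{1/p}.$$ $\Pi_p(^mE;F)$ is the space of $m$-linear $T:E\times\dots\times E\to F$ with $\pi_p(T)<\infty$. $\mathcal L_q^g$-spaces: a normed space $X$ is an $\mathcal L_{q,\lambda}^g$-space ($1\le\lambda<\infty$) if for each finite dimensional subspace $M\subset X$ and each $\varepsilon>0$ there are $k\in\mathbb N$ and linear operators $R:M\to\ell_q^k$, $S:\ell_q^k\to X$ with $S\circ R$ equal to the inclusion $M\hookrightarrow X$ and $\|S\|\,\|R\|\le\lambda+\varepsilon$.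 $X$ is an $\mathcal L_q^g$-space if it is an $\mathcal L_{q,\lambda}^g$-space for some $\lambda\ge1$. *)

theory Defs
  imports "HOL-Analysis.Analysis" "HOL-Library.Function_Algebras"
begin

class real_or_complex = real_normed_field +
  assumes isometric_real_or_complex:
    "(\<exists>f :: 'a \<Rightarrow> real. bij f \<and> (\<forall>x y. f (x + y) = f x + f y) \<and>
        (\<forall>x y. f (x * y) = f x * f y) \<and> (\<forall>x. norm (f x) = norm x)) \<or>
     (\<exists>f :: 'a \<Rightarrow> complex. bij f \<and> (\<forall>x y. f (x + y) = f x + f y) \<and>
        (\<forall>x y. f (x * y) = f x * f y) \<and> (\<forall>x. norm (f x) = norm x))"

instance real :: real_or_complex
  by standard (rule disjI1, rule exI[of _ id], simp)

instance complex :: real_or_complex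
  by standard (rule disjI2, rule exI[of _ id], simp)

(* The library has normed spaces over the reals only; this adds a compatible scalar
   multiplication by 'k. For 'k = real it can only be scaleR. *)
locale normed_space_over = vector_space sc
  for sc :: "'k::real_or_complex \<Rightarrow> 'x::real_normed_vector \<Rightarrow> 'x" +
  assumes scale_of_real: "sc (of_real t) x = t *\<^sub>R x"
    and norm_scale: "norm (sc a x) = norm a * norm x"

(* Spaces depending on a numerical parameter, such as l_r, cannot be types. Below, such a normed space
   is given by a scalar multiplication s on an ambient type, a linear subspace V of that type
   and a norm N on V. *)

definition linear_on ::
  "('k \<Rightarrow> 'v::ab_group_add \<Rightarrow> 'v) \<Rightarrow> 'v set \<Rightarrow> ('k \<Rightarrow> 'w::ab_group_add \<Rightarrow> 'w) \<Rightarrow> ('v \<Rightarrow> 'w) \<Rightarrow> bool"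
  where "linear_on s V s' f \<longleftrightarrow>
    (\<forall>u\<in>V. \<forall>v\<in>V. f (u + v) = f u + f v) \<and> (\<forall>a. \<forall>v\<in>V. f (s a v) = s' a (f v))"

definition operator_norm :: "'v set \<Rightarrow> ('v \<Rightarrow> real) \<Rightarrow> ('w \<Rightarrow> real) \<Rightarrow> ('v \<Rightarrow> 'w) \<Rightarrow> ennreal"
  where "operator_norm V N N' f = (SUP v\<in>{v \<in> V. N v \<le> 1}. ennreal (N' (f v)))"

definition dual_ball ::
  "('k::real_or_complex \<Rightarrow> 'v::ab_group_add \<Rightarrow> 'v) \<Rightarrow> 'v set \<Rightarrow> ('v \<Rightarrow> real) \<Rightarrow> ('v \<Rightarrow> 'k) set"
  where "dual_ball s V N = {\<gamma>. linear_on s V (*) \<gamma> \<and> (\<forall>v\<in>V. norm (\<gamma> v) \<le> N v)}"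

definition weak_norm ::
  "real \<Rightarrow> ('k::real_or_complex \<Rightarrow> 'v::ab_group_add \<Rightarrow> 'v) \<Rightarrow> 'v set \<Rightarrow> ('v \<Rightarrow> real)
    \<Rightarrow> nat \<Rightarrow> (nat \<Rightarrow> 'v) \<Rightarrow> ennreal"
  where "weak_norm p s V N J y =
    (SUP \<gamma>\<in>dual_ball s V N. ennreal ((\<Sum>j<J. norm (\<gamma> (y j)) powr p) powr (1 / p)))"

(* pi_p(T) for T : V x ... x V (m factors) \<rightarrow> 'x; the arguments of T are tuples
   in PiE {..<m} (\<lambda>_. V). The value is top iff no such C exists. *)
definition multiple_summing_norm ::
  "real \<Rightarrow> nat \<Rightarrow> ('k::real_or_complex \<Rightarrow> 'v::ab_group_add \<Rightarrow> 'v) \<Rightarrow> 'v set \<Rightarrow> ('v \<Rightarrow> real)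
    \<Rightarrow> ((nat \<Rightarrow> 'v) \<Rightarrow> 'x::real_normed_vector) \<Rightarrow> ennreal"
  where "multiple_summing_norm p m s V N T =
    (INF C\<in>{C :: real. 0 < C \<and>
        (\<forall>(J :: nat \<Rightarrow> nat) (x :: nat \<Rightarrow> nat \<Rightarrow> 'v). (\<forall>k<m. \<forall>j<J k. x k j \<in> V) \<longrightarrow>
          ennreal ((\<Sum>j\<in>PiE {..<m} (\<lambda>k. {..<J k}).
              norm (T (\<lambda>k\<in>{..<m}. x k (j k))) powr p) powr (1 / p))
          \<le> ennreal C * (\<Prod>k<m. weak_norm p s V N (J k) (x k)))}. ennreal C)"

definition seq_scale :: "'k::real_or_complex \<Rightarrow> (nat \<Rightarrow> 'k) \<Rightarrow> nat \<Rightarrow> 'k"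
  where "seq_scale a x = (\<lambda>i. a * x i)"

definition lspace :: "ennreal \<Rightarrow> (nat \<Rightarrow> 'k::real_or_complex) set"
  where "lspace r = {x. if r = \<infinity> then bounded (range x)
                        else summable (\<lambda>i. norm (x i) powr enn2real r)}"

definition lnorm :: "ennreal \<Rightarrow> (nat \<Rightarrow> 'k::real_or_complex) \<Rightarrow> real"
  where "lnorm r x = (if r = \<infinity> then (SUP i. norm (x i))
                      else (\<Sum>i. norm (x i) powr enn2real r) powr (1 / enn2real r))"

(* l_q^k is the set fin_seqs k with the norm lnorm q. *)
definition fin_seqs :: "nat \<Rightarrow> (nat \<Rightarrow> 'k::real_or_complex) set"
  where "fin_seqs k = {x. \<forall>i\<ge>k. x i = 0}"

definition Lg_space_const ::
  "ennreal \<Rightarrow> real \<Rightarrow> ('k::real_or_complex \<Rightarrow> 'x::real_normed_vector \<Rightarrow> 'x) \<Rightarrow> bool"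
  where "Lg_space_const q lam sc \<longleftrightarrow>
    (\<forall>M. module.subspace sc M \<and> (\<exists>B. finite B \<and> M = module.span sc B) \<longrightarrow>
      (\<forall>\<epsilon>>0. \<exists>(k :: nat) (R :: 'x \<Rightarrow> nat \<Rightarrow> 'k) (S :: (nat \<Rightarrow> 'k) \<Rightarrow> 'x).
         linear_on sc M seq_scale R \<and> R ` M \<subseteq> fin_seqs k \<and>
         linear_on seq_scale (fin_seqs k) sc S \<and>
         (\<forall>x\<in>M. S (R x) = x) \<and>
         operator_norm (fin_seqs k) (lnorm q) norm S * operator_norm M norm (lnorm q) R
           \<le> ennreal (lam + \<epsilon>)))"

definition Lg_space ::
  "ennreal \<Rightarrow> ('k::real_or_complex \<Rightarrow> 'x::real_normed_vector \<Rightarrow> 'x) \<Rightarrow> bool"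
  where "Lg_space q sc \<longleftrightarrow> (\<exists>lam\<ge>1. Lg_space_const q lam sc)"

(* The map (y^1, ..., y^m) \<mapsto> e'_{i_1}(y^1) \<cdots> e'_{i_m}(y^m) x. *)
definition elementary_map ::
  "('k::real_or_complex \<Rightarrow> 'x \<Rightarrow> 'x) \<Rightarrow> nat \<Rightarrow> (nat \<Rightarrow> nat) \<Rightarrow> 'x \<Rightarrow> (nat \<Rightarrow> nat \<Rightarrow> 'k) \<Rightarrow> 'x"
  where "elementary_map sc m i x = (\<lambda>y. sc (\<Prod>k<m. y k (i k)) x)"

end

theory Submission
  imports Defs
begin

text \<open>
  Let \<open>s\<close> be the conjugate exponent of \<open>r\<close>. The idea is to express the multiple summing constant of
  \<open>T = \<Sum>\<^sub>i e'\<^sub>i\<^sub>1 \<otimes> \<dots> \<otimes> e'\<^sub>i\<^sub>m x\<^sub>i\<close>, up to constants, as an average of \<open>norm (T \<theta>)\<close> over independent symmetric random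
  vectors \<open>\<theta>\<^sup>1, \<dots>, \<theta>\<^sup>m\<close>. In such an average each coordinate of \<open>\<theta>\<^sup>k\<close> may be multiplied by a random sign, and
  Khintchine's inequality for products of signs then shows that only the moduli of the coefficients matter.

  The vectors \<open>\<theta>\<^sup>k\<close> have independent coordinates that imitate \<open>s\<close>-stable variables: linear forms in them have
  \<open>p\<close>-th moments equivalent to the \<open>\<ell>\<^sub>s\<close> norm of their coefficients (\<open>stable_vectors_norm\<close>). For \<open>s = 2\<close> random
  signs suffice and every \<open>p\<close> is allowed; for \<open>s < 2\<close> \<open>p < s\<close> is the condition under which \<open>s\<close>-stable variables have a \<open>p\<close>-th moment. All
  distributions are uniform on finite sets, so every expectation is a finite sum. The upper moment bound says that
  the values of \<open>\<theta>\<^sup>k\<close> form a sequence in \<open>\<ell>\<^sub>r\<close> with bounded weak norm, so the average is bounded by the summing constant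
  (\<open>lmean_stable_le_summing\<close>). The lower bound allows the test sequences to be replaced by the random vectors, one
  variable at a time (\<open>tensor_ineq\<close>, \<open>summing_le_lmean_stable\<close>).

  Both comparisons are first made for values in \<open>\<ell>\<^sub>q\<close> of finite dimension and \<open>q \<le> p\<close>, where Minkowski's
  inequality and the monotonicity of means reduce them to the single coordinates, that is, to scalar forms. For
  \<open>p < q \<le> 2\<close> the same random vectors, now with \<open>q\<close> in the role of \<open>s\<close>, embed \<open>\<ell>\<^sub>q\<close> into \<open>\<ell>\<^sub>p\<close> of a larger
  dimension, which brings back the case of equal exponents (\<open>lq_unconditional\<close>).
  Each of the three alternatives of the hypothesis falls under one of these two cases.

  Finally, the span of the finitely many vectors \<open>x\<^sub>i\<close> factors through some \<open>\<ell>\<^sub>q\<close> of finite dimension with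
  constant \<open>lam + 1\<close>. Applying the two factors coordinatewise transfers the inequality to \<open>X\<close>
  (\<open>Lg_space_factorization\<close>).
\<close>

section \<open>Power sums and averages\<close>

text \<open>The \<open>\<ell>\<^sub>p\<close> norm of \<open>f\<close> on \<open>A\<close>; for \<open>p < 1\<close> only a quasi-norm, and the summing exponent may be that small.\<close>

definition lpn :: "real \<Rightarrow> 'a set \<Rightarrow> ('a \<Rightarrow> 'b::real_normed_vector) \<Rightarrow> real"
  where "lpn p A f = (\<Sum>x\<in>A. norm (f x) powr p) powr (1 / p)"

lemma lpn_nonneg [simp]: "0 \<le> lpn p A f"
  by (simp add: lpn_def)

lemma lpn_cong: "A = B \<Longrightarrow> (\<And>x. x \<in> B \<Longrightarrow> norm (f x) = norm (g x)) \<Longrightarrow> lpn p A f = lpn p B g"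
  by (simp add: lpn_def cong: sum.cong)

lemma lpn_powr: "p \<noteq> 0 \<Longrightarrow> lpn p A f powr p = (\<Sum>x\<in>A. norm (f x) powr p)"
  by (simp add: lpn_def powr_powr sum_nonneg)

lemma lpn_mono:
  assumes "0 < p" "\<And>x. x \<in> A \<Longrightarrow> norm (f x) \<le> norm (g x)"
  shows "lpn p A f \<le> lpn p A g"
  unfolding lpn_def using assms by (intro powr_mono2 sum_mono sum_nonneg) auto

lemma lpn_scale:
  assumes "0 < p" "0 \<le> c" "\<And>x. x \<in> A \<Longrightarrow> norm (f x) = c * norm (g x)"
  shows "lpn p A f = c * lpn p A g"
proof -
  have "lpn p A f = (\<Sum>x\<in>A. c powr p * norm (g x) powr p) powr (1 / p)"
    unfolding lpn_def using assms by (simp add: powr_mult cong: sum.cong)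
  also have "\<dots> = c * lpn p A g"
    using assms by (simp add: sum_distrib_left[symmetric] powr_mult powr_powr lpn_def)
  finally show ?thesis .
qed

lemma lpn_scale_le:
  assumes "0 < p" "0 \<le> c" "\<And>x. x \<in> A \<Longrightarrow> norm (f x) \<le> c * norm (g x)"
  shows "lpn p A f \<le> c * lpn p A g"
proof -
  have "lpn p A f \<le> lpn p A (\<lambda>x. c * norm (g x))"
    using assms by (intro lpn_mono) auto
  also have "\<dots> = c * lpn p A g"
    using assms by (intro lpn_scale) (auto simp: abs_mult)
  finally show ?thesis .
qed

lemma lpn_le_iff:
  assumes "0 < p" "0 \<le> M"
  shows "lpn p A f \<le> M \<longleftrightarrow> (\<Sum>x\<in>A. norm (f x) powr p) \<le> M powr p"
proof
  assume "lpn p A f \<le> M"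
  then have "lpn p A f powr p \<le> M powr p" using assms by (intro powr_mono2) auto
  then show "(\<Sum>x\<in>A. norm (f x) powr p) \<le> M powr p" using assms by (simp add: lpn_powr)
next
  assume "(\<Sum>x\<in>A. norm (f x) powr p) \<le> M powr p"
  then have "(\<Sum>x\<in>A. norm (f x) powr p) powr (1/p) \<le> (M powr p) powr (1/p)"
    using assms by (intro powr_mono2 sum_nonneg) auto
  then show "lpn p A f \<le> M" using assms by (simp add: lpn_def powr_powr)
qed

lemma le_of_powr_le:
  assumes "0 < p" "0 \<le> (y::real)" "x powr p \<le> y powr p"
  shows "x \<le> y"
  using assms powr_less_mono2[of p y x] by force

lemma le_lpn:
  assumes "0 < p" "finite A" "x \<in> A"
  shows "norm (f x) \<le> lpn p A f"
proof -
  have "norm (f x) powr p \<le> lpn p A f powr p"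
    using assms member_le_sum[of x A "\<lambda>x. norm (f x) powr p"] by (simp add: lpn_powr)
  then show ?thesis
    using powr_less_mono2[of p "lpn p A f" "norm (f x)"] assms by force
qed

lemma lpn_eq_0D:
  assumes "0 < p" "finite A" "lpn p A f = 0" "x \<in> A"
  shows "f x = 0"
  using le_lpn[OF assms(1,2,4), of f] assms(3) by simp

lemma lpn_reindex:
  assumes "bij_betw h A B"
  shows "lpn p B f = lpn p A (\<lambda>x. f (h x))"
  unfolding lpn_def using sum.reindex_bij_betw[OF assms, of "\<lambda>x. norm (f x) powr p"] by simp

lemma lpn_swap:
  assumes "0 < p"
  shows "lpn p A (\<lambda>x. lpn p B (\<lambda>y. f x y)) = lpn p B (\<lambda>y. lpn p A (\<lambda>x. f x y))"
  unfolding lpn_def[of _ A "\<lambda>x. lpn p B (f x)"] lpn_def[of _ B "\<lambda>y. lpn p A (\<lambda>x. f x y)"]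
  using assms by (simp add: lpn_powr sum.swap[of _ A])

lemma convex_on_powr:
  assumes "1 \<le> (p::real)"
  shows "convex_on {0..} (\<lambda>x. x powr p)"
proof (intro convex_onI)
  fix t x y :: real
  assume t: "0 < t" "t < 1" and xy: "x \<in> {0..}" "y \<in> {0..}"
  have shrink: "(u * z) powr p \<le> u * z powr p" if "0 < u" "u < 1" for u z :: real
    using that assms powr_mono'[of 1 p u] by (simp add: powr_mult mult_right_mono)
  consider "x = 0" | "y = 0" | "0 < x" "0 < y" using xy by force
  then show "((1 - t) *\<^sub>R x + t *\<^sub>R y) powr p \<le> (1 - t) * x powr p + t * y powr p"
  proof cases
    case 1
    then show ?thesis using shrink[of t y] t assms by simp
  next
    case 2
    then show ?thesis using shrink[of "1 - t" x] t assms by simp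
  next
    case 3
    then show ?thesis using convex_onD[OF powr_convex[OF assms], of t x y] t by simp
  qed
qed simp

lemma lpn_triangle:
  fixes f g :: "'a \<Rightarrow> real"
  assumes "1 \<le> p" "finite A" "\<And>x. x \<in> A \<Longrightarrow> 0 \<le> f x" "\<And>x. x \<in> A \<Longrightarrow> 0 \<le> g x"
  shows "lpn p A (\<lambda>x. f x + g x) \<le> lpn p A f + lpn p A g"
proof (cases "lpn p A f = 0 \<or> lpn p A g = 0")
  case True
  then have "(\<forall>x\<in>A. f x = 0) \<or> (\<forall>x\<in>A. g x = 0)"
    using lpn_eq_0D[of p A] assms by force
  then have "lpn p A (\<lambda>x. f x + g x) = lpn p A g \<or> lpn p A (\<lambda>x. f x + g x) = lpn p A f"
  proof
    assume "\<forall>x\<in>A. f x = 0"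
    then show ?thesis by (intro disjI1 lpn_cong) auto
  next
    assume "\<forall>x\<in>A. g x = 0"
    then show ?thesis by (intro disjI2 lpn_cong) auto
  qed
  then show ?thesis using lpn_nonneg[of p A f] lpn_nonneg[of p A g] by linarith
next
  case False
  define a b where "a = lpn p A f" and "b = lpn p A g"
  have ab: "0 < a" "0 < b" using False by (simp_all add: a_def b_def less_le)
  define t where "t = b / (a + b)"
  have t: "0 < t" "t < 1" and t1: "1 - t = a / (a + b)"
    using ab by (auto simp: t_def field_simps)
  have p0: "0 < p" using assms by simp
  have fa: "(\<Sum>x\<in>A. (f x / a) powr p) = 1"
  proof -
    have "(\<Sum>x\<in>A. f x powr p) = a powr p"
      using lpn_powr[of p A f] p0 assms(3) by (simp add: a_def cong: sum.cong)
    then show ?thesis using ab by (simp add: powr_divide flip: sum_divide_distrib)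
  qed
  have gb: "(\<Sum>x\<in>A. (g x / b) powr p) = 1"
  proof -
    have "(\<Sum>x\<in>A. g x powr p) = b powr p"
      using lpn_powr[of p A g] p0 assms(4) by (simp add: b_def cong: sum.cong)
    then show ?thesis using ab by (simp add: powr_divide flip: sum_divide_distrib)
  qed
  have "(\<Sum>x\<in>A. ((f x + g x) / (a + b)) powr p)
      \<le> (\<Sum>x\<in>A. (1 - t) * (f x / a) powr p + t * (g x / b) powr p)"
  proof (rule sum_mono)
    fix x assume x: "x \<in> A"
    have "(f x + g x) / (a + b) = (1 - t) *\<^sub>R (f x / a) + t *\<^sub>R (g x / b)"
      using ab unfolding t1 by (simp add: t_def add_divide_distrib)
    then show "((f x + g x) / (a + b)) powr p \<le> (1 - t) * (f x / a) powr p + t * (g x / b) powr p"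
      using convex_onD[OF convex_on_powr[OF assms(1)], of t "f x / a" "g x / b"] t ab assms(3,4)[OF x]
      by simp
  qed
  also have "\<dots> = 1"
    by (simp add: sum.distrib fa gb flip: sum_distrib_left)
  finally have "(\<Sum>x\<in>A. (f x + g x) powr p) / (a + b) powr p \<le> 1"
    by (simp add: powr_divide sum_divide_distrib)
  then have "(\<Sum>x\<in>A. (f x + g x) powr p) \<le> (a + b) powr p"
    using ab by (simp add: field_simps)
  then have "(\<Sum>x\<in>A. norm (f x + g x) powr p) \<le> (a + b) powr p"
    using assms(3,4) by (simp cong: sum.cong)
  then show ?thesis
    using ab p0 by (subst lpn_le_iff) (auto simp: a_def b_def)
qed

lemma lpn_sum_le:
  fixes f :: "'b \<Rightarrow> 'a \<Rightarrow> real"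
  assumes "1 \<le> p" "finite A" "finite B" "\<And>x y. 0 \<le> f y x"
  shows "lpn p A (\<lambda>x. \<Sum>y\<in>B. f y x) \<le> (\<Sum>y\<in>B. lpn p A (f y))"
  using assms(3)
proof (induction B rule: finite_induct)
  case empty
  then show ?case using assms by (simp add: lpn_def)
next
  case (insert y B)
  have "lpn p A (\<lambda>x. f y x + (\<Sum>y\<in>B. f y x)) \<le> lpn p A (f y) + lpn p A (\<lambda>x. \<Sum>y\<in>B. f y x)"
    using assms by (intro lpn_triangle) (auto intro: sum_nonneg)
  then show ?case using insert by simp
qed

text \<open>The triangle inequality with exponent \<open>p / q\<close> for the functions \<open>\<lambda>x. norm (f x y) powr q\<close>. That exponent is at
  least 1 because \<open>q \<le> p\<close>, which is also why the exponents are ordered in \<open>tensor_ineq\<close>.\<close>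

lemma lpn_Minkowski:
  assumes "0 < q" "q \<le> p" "finite A" "finite B"
  shows "lpn p A (\<lambda>x. lpn q B (\<lambda>y. f x y)) \<le> lpn q B (\<lambda>y. lpn p A (\<lambda>x. f x y))"
proof -
  define g where "g y x = norm (f x y) powr q" for y x
  have "lpn p A (\<lambda>x. lpn q B (f x)) = lpn (p/q) A (\<lambda>x. \<Sum>y\<in>B. g y x) powr (1/q)"
    using assms unfolding lpn_def g_def by (simp add: powr_powr sum_nonneg)
  also have "\<dots> \<le> (\<Sum>y\<in>B. lpn (p/q) A (g y)) powr (1/q)"
    using assms by (intro powr_mono2 lpn_sum_le) (auto simp: g_def)
  also have "\<dots> = lpn q B (\<lambda>y. lpn p A (\<lambda>x. f x y))"
    using assms unfolding lpn_def g_def by (simp add: powr_powr sum_nonneg)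
  finally show ?thesis .
qed

lemma lpn_power_mean:
  assumes "0 < q" "q \<le> p" "finite A" "A \<noteq> {}"
  shows "lpn q A f * real (card A) powr (-1/q) \<le> lpn p A f * real (card A) powr (-1/p)"
proof -
  define N where "N = real (card A)"
  have N: "0 < N" using assms by (simp add: N_def card_gt_0_iff)
  define g where "g x = norm (f x) powr q" for x
  have 1: "(\<Sum>x\<in>A. (1/N) *\<^sub>R g x) powr (p/q) \<le> (\<Sum>x\<in>A. (1/N) * g x powr (p/q))"
    using assms N by (intro convex_on_sum[OF _ _ convex_on_powr]) (auto simp: g_def N_def)
  have "lpn q A f * N powr (-1/q) = ((\<Sum>x\<in>A. (1/N) *\<^sub>R g x) powr (p/q)) powr (1/p)"
    using assms N by (simp add: lpn_def g_def powr_powr sum_nonneg powr_minus_divide powr_divide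
        flip: sum_divide_distrib)
  also have "\<dots> \<le> (\<Sum>x\<in>A. (1/N) * g x powr (p/q)) powr (1/p)"
    using 1 assms by (intro powr_mono2) auto
  also have "\<dots> = lpn p A f * N powr (-1/p)"
    using assms N by (simp add: lpn_def g_def powr_powr sum_nonneg powr_minus_divide powr_divide
        flip: sum_divide_distrib)
  finally show ?thesis by (simp add: N_def)
qed

text \<open>The \<open>L\<^sub>p\<close> norm for the uniform probability measure on \<open>A\<close>.\<close>

definition lmean :: "real \<Rightarrow> 'a set \<Rightarrow> ('a \<Rightarrow> 'b::real_normed_vector) \<Rightarrow> real"
  where "lmean p A f = lpn p A f * real (card A) powr (-1 / p)"

lemma lmean_nonneg [simp]: "0 \<le> lmean p A f"
  by (simp add: lmean_def)

lemma lpn_eq_lmean: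
  assumes "finite A" "A \<noteq> {}"
  shows "lpn p A f = lmean p A f * real (card A) powr (1 / p)"
proof -
  have "0 < card A" using assms by (simp add: card_gt_0_iff)
  then show ?thesis by (simp add: lmean_def mult.assoc flip: powr_add)
qed

lemma lmean_powr:
  assumes "0 < p"
  shows "lmean p A f powr p = (\<Sum>x\<in>A. norm (f x) powr p) / card A"
  using assms by (simp add: lmean_def powr_mult lpn_powr powr_powr powr_minus_divide powr_divide)

lemma lmean_le_iff:
  assumes "0 < p" "0 \<le> M" "finite A" "A \<noteq> {}"
  shows "lmean p A f \<le> M \<longleftrightarrow> (\<Sum>x\<in>A. norm (f x) powr p) \<le> M powr p * card A"
proof -
  have N: "0 < real (card A)" using assms by (simp add: card_gt_0_iff)
  have "lmean p A f \<le> M \<longleftrightarrow> lpn p A f \<le> M * card A powr (1/p)"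
    using N by (simp add: lmean_def powr_minus_divide divide_simps)
  also have "\<dots> \<longleftrightarrow> (\<Sum>x\<in>A. norm (f x) powr p) \<le> M powr p * card A"
    using assms N by (subst lpn_le_iff) (auto simp: powr_mult powr_powr)
  finally show ?thesis .
qed

lemma lmean_power_mean:
  assumes "0 < q" "q \<le> p" "finite A" "A \<noteq> {}"
  shows "lmean q A f \<le> lmean p A f"
  unfolding lmean_def by (rule lpn_power_mean[OF assms])

lemma lmean_scale:
  assumes "0 < p" "0 \<le> c" "\<And>x. x \<in> A \<Longrightarrow> norm (f x) = c * norm (g x)"
  shows "lmean p A f = c * lmean p A g"
  using lpn_scale[OF assms, of A] by (simp add: lmean_def)

lemma lmean_mono:
  assumes "0 < p" "\<And>x. x \<in> A \<Longrightarrow> norm (f x) \<le> norm (g x)"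
  shows "lmean p A f \<le> lmean p A g"
  unfolding lmean_def using assms by (intro mult_right_mono lpn_mono) auto

lemma lmean_scale_le:
  assumes "0 < p" "0 \<le> c" "\<And>x. x \<in> A \<Longrightarrow> norm (f x) \<le> c * norm (g x)"
  shows "lmean p A f \<le> c * lmean p A g"
  using mult_right_mono[OF lpn_scale_le[OF assms, of A "\<lambda>x. x"], of "real (card A) powr (-1/p)"]
  unfolding lmean_def by (simp add: mult.assoc)

text \<open>If a variable is uniform on \<open>A\<close>, then so is its image under a random bijection of \<open>A\<close>. For sign changes
  this is symmetrization.\<close>

lemma lmean_average:
  assumes q: "0 < q" and S: "finite S" "S \<noteq> {}" and h: "\<And>\<sigma>. \<sigma> \<in> S \<Longrightarrow> bij_betw (h \<sigma>) A A"
  shows "lmean q A f = lmean q A (\<lambda>\<theta>. lmean q S (\<lambda>\<sigma>. f (h \<sigma> \<theta>)))"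
proof -
  have cS: "0 < real (card S)" using S by (simp add: card_gt_0_iff)
  have "lmean q A (\<lambda>\<theta>. lmean q S (\<lambda>\<sigma>. f (h \<sigma> \<theta>))) powr q
     = (\<Sum>\<sigma>\<in>S. \<Sum>\<theta>\<in>A. norm (f (h \<sigma> \<theta>)) powr q) / (card S * card A)"
    using q by (subst sum.swap) (simp add: lmean_powr flip: sum_divide_distrib)
  also have "(\<Sum>\<sigma>\<in>S. \<Sum>\<theta>\<in>A. norm (f (h \<sigma> \<theta>)) powr q) = (\<Sum>\<sigma>\<in>S. \<Sum>\<theta>\<in>A. norm (f \<theta>) powr q)"
    using h by (intro sum.cong refl sum.reindex_bij_betw)
  also have "\<dots> / (card S * card A) = lmean q A f powr q"
    using q cS by (simp add: lmean_powr)
  finally show ?thesis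
    using le_of_powr_le[OF q] by (intro antisym) (metis lmean_nonneg order_refl)+
qed

text \<open>Control of one moment above the second also bounds the lower moments from below: by
  \<open>x powr 2 \<le> l powr (2 - q) * x powr q + l powr (2 - t) * x powr t\<close> the second moment cannot come from the large
  values alone.\<close>

lemma lmean_2_le_of_moment:
  assumes "0 < q" "q < 2" "2 < t" "1 \<le> C"
  obtains K where "0 < K"
    "\<And>(A :: 'a set) (f :: 'a \<Rightarrow> 'b::real_normed_vector).
        finite A \<Longrightarrow> A \<noteq> {} \<Longrightarrow> lmean t A f \<le> C * lmean 2 A f \<Longrightarrow> lmean 2 A f \<le> K * lmean q A f"
proof -
  (* The threshold is chosen so that the values above it contribute at most half of the second moment. *)
  define l where "l = (2 * C powr t) powr (1 / (t - 2))"
  have C: "0 < C" using assms by simp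
  then have l: "0 < l" by (simp add: l_def)
  have lt: "l powr (2 - t) * C powr t = 1 / 2"
  proof -
    have "l powr (t - 2) = 2 * C powr t" using assms C by (simp add: l_def powr_powr)
    moreover have "l powr (2 - t) = 1 / l powr (t - 2)"
      using l by (simp flip: powr_minus_divide)
    ultimately show ?thesis using C by simp
  qed
  define K where "K = (2 * l powr (2 - q)) powr (1 / q)"
  have K: "0 < K" using l by (simp add: K_def)
  have Kq: "K powr q = 2 * l powr (2 - q)" using assms l by (simp add: K_def powr_powr)
  have pw: "x powr 2 \<le> l powr (2 - q) * x powr q + l powr (2 - t) * x powr t" if "0 \<le> x" for x :: real
  proof (cases "x = 0")
    case False
    then have x: "0 < x" using that by simp
    show ?thesis
    proof (cases "x \<le> l")
      case True
      have "x powr 2 = x powr (2 - q) * x powr q" using x by (simp flip: powr_add)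
      also have "\<dots> \<le> l powr (2 - q) * x powr q"
        using True x assms by (intro mult_right_mono powr_mono2) auto
      finally show ?thesis by (simp add: add_increasing2)
    next
      case False
      have "x powr 2 = x powr (2 - t) * x powr t" using x by (simp flip: powr_add)
      also have "\<dots> \<le> l powr (2 - t) * x powr t"
        using False x l assms by (intro mult_right_mono powr_mono2') auto
      finally show ?thesis by (simp add: add_increasing)
    qed
  qed (use assms in simp)
  show thesis
  proof (rule that[OF K])
    fix A :: "'a set" and f :: "'a \<Rightarrow> 'b"
    assume A: "finite A" "A \<noteq> {}" and mom: "lmean t A f \<le> C * lmean 2 A f"
    have N: "0 < real (card A)" using A by (simp add: card_gt_0_iff)
    define B where "B = lmean 2 A f"
    show "lmean 2 A f \<le> K * lmean q A f"
    proof (cases "B = 0")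
      case True
      then show ?thesis using K by (simp add: B_def)
    next
      case False
      then have B: "0 < B" by (simp add: B_def less_le)
      have norml: "(\<Sum>x\<in>A. (norm (f x) / B) powr s) / card A = (lmean s A f / B) powr s" if "0 < s" for s
        using that B by (simp add: powr_divide lmean_powr flip: sum_divide_distrib)
      have "1 = (\<Sum>x\<in>A. (norm (f x) / B) powr 2) / card A"
        using B by (subst norml) (auto simp: B_def)
      also have "\<dots> \<le> (\<Sum>x\<in>A. l powr (2 - q) * (norm (f x) / B) powr q
                            + l powr (2 - t) * (norm (f x) / B) powr t) / card A"
        using B by (intro divide_right_mono sum_mono pw) auto
      also have "\<dots> = l powr (2 - q) * ((\<Sum>x\<in>A. (norm (f x) / B) powr q) / card A)
                   + l powr (2 - t) * ((\<Sum>x\<in>A. (norm (f x) / B) powr t) / card A)"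
        by (simp add: sum.distrib add_divide_distrib flip: sum_distrib_left)
      also have "\<dots> = l powr (2 - q) * (lmean q A f / B) powr q + l powr (2 - t) * (lmean t A f / B) powr t"
        using assms by (simp add: norml)
      also have "\<dots> \<le> l powr (2 - q) * (lmean q A f / B) powr q + l powr (2 - t) * C powr t"
        using mom B assms
        by (intro add_left_mono mult_left_mono powr_mono2) (auto simp: B_def divide_simps mult.commute)
      finally have "1 \<le> K powr q * (lmean q A f / B) powr q"
        unfolding lt Kq by simp
      then have "1 powr q \<le> (K * (lmean q A f / B)) powr q"
        by (simp only: powr_mult powr_one_eq_one)
      then have "1 \<le> K * (lmean q A f / B)"
        by (rule le_of_powr_le[rotated 2]) (use assms K B in auto)
      then show ?thesis using B by (simp add: B_def field_simps)
    qed
  qed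
qed

text \<open>The index stands for the dimension and the coefficients of a random form, on which the constants must not
  depend.\<close>

lemma lmean_equiv_lmean_2:
  fixes A :: "'i \<Rightarrow> 'a set" and f :: "'i \<Rightarrow> 'a \<Rightarrow> 'b::real_normed_vector"
  assumes A: "\<And>i. finite (A i)" "\<And>i. A i \<noteq> {}"
    and moments: "\<And>t. 2 < t \<Longrightarrow> \<exists>C. \<forall>i. lmean t (A i) (f i) \<le> C * lmean 2 (A i) (f i)"
    and q: "0 < q"
  obtains c C where "0 < c" "0 < C"
    "\<And>i. c * lmean 2 (A i) (f i) \<le> lmean q (A i) (f i)" "\<And>i. lmean q (A i) (f i) \<le> C * lmean 2 (A i) (f i)"
proof -
  have mom: "\<exists>C\<ge>1. \<forall>i. lmean t (A i) (f i) \<le> C * lmean 2 (A i) (f i)" if t: "2 < t" for t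
  proof -
    from moments[OF t] obtain C where C: "\<And>i. lmean t (A i) (f i) \<le> C * lmean 2 (A i) (f i)" by blast
    have "lmean t (A i) (f i) \<le> max 1 C * lmean 2 (A i) (f i)" for i
      using C[of i] by (rule order_trans) (intro mult_right_mono, auto)
    then show ?thesis by (intro exI[of _ "max 1 C"]) auto
  qed
  consider "q < 2" | "q = 2" | "2 < q" by linarith
  then show thesis
  proof cases
    case 1
    obtain C where C: "1 \<le> C" "\<And>i. lmean 3 (A i) (f i) \<le> C * lmean 2 (A i) (f i)"
      using mom[of 3] by auto
    obtain K where K: "0 < K"
      "\<And>(A :: 'a set) (f :: 'a \<Rightarrow> 'b). finite A \<Longrightarrow> A \<noteq> {} \<Longrightarrow>
          lmean 3 A f \<le> C * lmean 2 A f \<Longrightarrow> lmean 2 A f \<le> K * lmean q A f"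
      using lmean_2_le_of_moment[OF q 1, of 3 C] C(1) by auto
    have "1 / K * lmean 2 (A i) (f i) \<le> lmean q (A i) (f i)" for i
      using K(2)[OF A C(2), of i] K(1) by (simp add: field_simps)
    then show thesis
      using K(1) lmean_power_mean[OF q, of 2, OF _ A] 1 by (intro that[of "1 / K" 1]) auto
  next
    case 2
    then show thesis by (intro that[of 1 1]) auto
  next
    case 3
    obtain C where C: "1 \<le> C" "\<And>i. lmean q (A i) (f i) \<le> C * lmean 2 (A i) (f i)"
      using mom[OF 3] by auto
    then show thesis using 3 lmean_power_mean[of 2 q, OF _ _ A] by (intro that[of 1 C]) auto
  qed
qed

section \<open>Multilinear forms and tensor products of inequalities\<close>

lemma bij_betw_PiE_Suc:
  "bij_betw (\<lambda>(a, j). j(m := a)) (A m \<times> PiE {..<m} A) (PiE {..<Suc m} A)"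
  unfolding lessThan_Suc PiE_insert_eq
  by (auto simp: bij_betw_def intro: inj_combinator)

lemma sum_PiE_Suc:
  "(\<Sum>j\<in>PiE {..<Suc m} A. f j) = (\<Sum>a\<in>A m. \<Sum>j\<in>PiE {..<m} A. f (j(m := a)))"
  by (simp add: sum.reindex_bij_betw[OF bij_betw_PiE_Suc, symmetric] sum.cartesian_product split_beta)

lemma finite_PiE_lessThan: "(\<And>k. k < m \<Longrightarrow> finite (A k)) \<Longrightarrow> finite (PiE {..<m} A)" for m :: nat
  by (auto intro: finite_PiE)

lemma lpn_PiE_Suc:
  assumes "0 < p"
  shows "lpn p (PiE {..<Suc m} A) f = lpn p (A m) (\<lambda>a. lpn p (PiE {..<m} A) (\<lambda>j. f (j(m := a))))"
  using assms unfolding lpn_def[of p "A m"] lpn_def[of p "PiE {..<Suc m} A"]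
  by (simp add: lpn_powr sum_PiE_Suc)

lemma bij_betw_PiE:
  assumes "\<And>k. k \<in> S \<Longrightarrow> bij_betw (h k) (A k) (B k)"
  shows "bij_betw (\<lambda>j. \<lambda>k\<in>S. h k (j k)) (PiE S A) (PiE S B)"
proof (rule bij_betw_byWitness[where f' = "\<lambda>j. \<lambda>k\<in>S. inv_into (A k) (h k) (j k)"])
  show "\<forall>j\<in>PiE S A. (\<lambda>k\<in>S. inv_into (A k) (h k) ((\<lambda>k\<in>S. h k (j k)) k)) = j"
    using assms by (fastforce simp: fun_eq_iff bij_betw_def PiE_def extensional_def)
  show "\<forall>j\<in>PiE S B. (\<lambda>k\<in>S. h k ((\<lambda>k\<in>S. inv_into (A k) (h k) (j k)) k)) = j"
    using assms by (fastforce simp: fun_eq_iff bij_betw_def PiE_def extensional_def f_inv_into_f)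
  show "(\<lambda>j. \<lambda>k\<in>S. h k (j k)) ` PiE S A \<subseteq> PiE S B"
    using assms by (auto simp: PiE_iff intro!: bij_betw_apply[OF assms])
  show "(\<lambda>j. \<lambda>k\<in>S. inv_into (A k) (h k) (j k)) ` PiE S B \<subseteq> PiE S A"
    using assms by (auto simp: PiE_iff bij_betw_def intro!: inv_into_into)
qed

text \<open>Only the entries \<open>y k i\<close> with \<open>k < m\<close> and \<open>i < n k\<close> enter, so the arguments may be restricted or cut off
  without changing the value.\<close>

definition mform ::
  "nat \<Rightarrow> (nat \<Rightarrow> nat) \<Rightarrow> ((nat \<Rightarrow> nat) \<Rightarrow> 'k::real_normed_field) \<Rightarrow> (nat \<Rightarrow> nat \<Rightarrow> 'k) \<Rightarrow> 'k"
  where "mform m n b y = (\<Sum>i\<in>PiE {..<m} (\<lambda>k. {..<n k}). (\<Prod>k<m. y k (i k)) * b i)"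

lemma mform_cong:
  assumes "\<And>k i. k < m \<Longrightarrow> i < n k \<Longrightarrow> y k i = z k i"
  shows "mform m n b y = mform m n b z"
  unfolding mform_def using assms by (intro sum.cong refl arg_cong2[of _ _ _ _ "(*)"] prod.cong) auto

lemma mform_Suc:
  "mform (Suc m) n b y = (\<Sum>a<n m. y m a * mform m n (\<lambda>i. b (i(m := a))) y)"
proof -
  have "(\<Prod>k<Suc m. y k ((i(m := a)) k)) = y m a * (\<Prod>k<m. y k (i k))" for i a
  proof -
    have "(\<Prod>k<m. y k ((i(m := a)) k)) = (\<Prod>k<m. y k (i k))" by (intro prod.cong) auto
    then show ?thesis by (simp add: mult.commute)
  qed
  then show ?thesis
    unfolding mform_def sum_PiE_Suc by (simp add: sum_distrib_left mult_ac)
qed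

lemma mform_sum:
  "(\<Sum>a\<in>A. c a * mform m n (b a) y) = mform m n (\<lambda>i. \<Sum>a\<in>A. c a * b a i) y"
  unfolding mform_def
  by (simp add: sum_distrib_left sum.swap[of _ A] algebra_simps)

text \<open>Inequalities between power sums of linear forms tensorize. One variable is exchanged at a time: for fixed
  values of the others the form is linear in it, and Minkowski's inequality moves the exchanged variable past
  the sums over the others. This is the only induction on the number of variables; with different
  choices of \<open>u\<close> and \<open>v\<close> it yields the upper and lower second moments and the higher moments of random
  multilinear forms, and it passes from weakly summable sequences to random vectors.\<close>

lemma tensor_ineq:
  fixes u :: "nat \<Rightarrow> 'a \<Rightarrow> nat \<Rightarrow> 'k::real_normed_field" and v :: "nat \<Rightarrow> 'b \<Rightarrow> nat \<Rightarrow> 'k"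
  assumes "0 < q" "q \<le> p"
    and "\<And>k. k < m \<Longrightarrow> finite (A k)" "\<And>k. k < m \<Longrightarrow> finite (B k)" "\<And>k. k < m \<Longrightarrow> 0 \<le> D k"
    and "\<And>k a. k < m \<Longrightarrow> lpn p (A k) (\<lambda>x. \<Sum>i<n k. u k x i * a i)
                      \<le> D k * lpn q (B k) (\<lambda>x. \<Sum>i<n k. v k x i * a i)"
  shows "lpn p (PiE {..<m} A) (\<lambda>j. mform m n b (\<lambda>k. u k (j k)))
         \<le> (\<Prod>k<m. D k) * lpn q (PiE {..<m} B) (\<lambda>j. mform m n b (\<lambda>k. v k (j k)))"
  using assms(3-)
proof (induction m arbitrary: b)
  case 0
  have "0 < p" using assms by simp
  then show ?case using assms by (simp add: mform_def lpn_def powr_powr)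
next
  case (Suc m)
  have p: "0 < p" using assms by simp
  let ?A = "PiE {..<m} A" and ?B = "PiE {..<m} B"
  have fin: "finite (A m)" "finite ?B"
    using Suc.prems by (auto intro: finite_PiE_lessThan)
  define D' where "D' = (\<Prod>k<m. D k)"
  have D': "0 \<le> D'" using Suc.prems by (auto simp: D'_def intro!: prod_nonneg)
  define bb where "bb x i = (\<Sum>a<n m. u m x a * b (i(m := a)))" for x i
  define c where "c j a = mform m n (\<lambda>i. b (i(m := a))) (\<lambda>k. v k (j k))" for j a
  have upd: "mform m n d (\<lambda>k. w k ((j(m := x)) k)) = mform m n d (\<lambda>k. w k (j k))"
    for d j and x :: 'c and w :: "nat \<Rightarrow> 'c \<Rightarrow> nat \<Rightarrow> 'k"
    by (rule mform_cong) simp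
  have "lpn p (PiE {..<Suc m} A) (\<lambda>j. mform (Suc m) n b (\<lambda>k. u k (j k)))
      = lpn p (A m) (\<lambda>x. lpn p ?A (\<lambda>j. mform m n (bb x) (\<lambda>k. u k (j k))))"
    unfolding lpn_PiE_Suc[OF p] mform_Suc upd mform_sum bb_def by (simp add: upd)
  also have "\<dots> \<le> lpn p (A m) (\<lambda>x. D' * lpn q ?B (\<lambda>j. mform m n (bb x) (\<lambda>k. v k (j k))))"
    using Suc.IH Suc.prems p D' by (intro lpn_mono) (auto simp: D'_def)
  also have "\<dots> = D' * lpn p (A m) (\<lambda>x. lpn q ?B (\<lambda>j. \<Sum>a<n m. u m x a * c j a))"
    unfolding bb_def c_def mform_sum using D' p by (intro lpn_scale) (auto simp: abs_mult)
  also have "\<dots> \<le> D' * lpn q ?B (\<lambda>j. lpn p (A m) (\<lambda>x. \<Sum>a<n m. u m x a * c j a))"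
    using fin assms D' by (intro mult_left_mono lpn_Minkowski) auto
  also have "\<dots> \<le> D' * lpn q ?B (\<lambda>j. D m * lpn q (B m) (\<lambda>x. \<Sum>a<n m. v m x a * c j a))"
    using Suc.prems assms D' by (intro mult_left_mono lpn_mono) auto
  also have "\<dots> = D' * (D m * lpn q ?B (\<lambda>j. lpn q (B m) (\<lambda>x. \<Sum>a<n m. v m x a * c j a)))"
    using Suc.prems assms by (intro arg_cong[of _ _ "(*) D'"] lpn_scale) (auto simp: abs_mult)
  also have "lpn q ?B (\<lambda>j. lpn q (B m) (\<lambda>x. \<Sum>a<n m. v m x a * c j a))
      = lpn q (PiE {..<Suc m} B) (\<lambda>j. mform (Suc m) n b (\<lambda>k. v k (j k)))"
    unfolding lpn_PiE_Suc[OF assms(1)] mform_Suc upd c_def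
    by (subst lpn_swap[OF assms(1)]) simp
  finally show ?case by (simp add: D'_def mult_ac)
qed

section \<open>Khintchine's inequality for products of sign vectors\<close>

text \<open>The scalars are a subfield of the complex numbers up to isometry. The only consequence needed is that the
  modulus is Euclidean in two additive real coordinates; this reduces inequalities for sign sums to real ones.\<close>

lemma real_coordinates:
  obtains \<rho>1 \<rho>2 :: "'k::real_or_complex \<Rightarrow> real"
  where "\<And>x y. \<rho>1 (x + y) = \<rho>1 x + \<rho>1 y" "\<And>x y. \<rho>2 (x + y) = \<rho>2 x + \<rho>2 y"
    "\<And>x. (norm x)\<^sup>2 = (\<rho>1 x)\<^sup>2 + (\<rho>2 x)\<^sup>2"
proof -
  consider (r) f :: "'k \<Rightarrow> real" where "\<And>x y. f (x + y) = f x + f y" "\<And>x. norm (f x) = norm x"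
    | (c) f :: "'k \<Rightarrow> complex" where "\<And>x y. f (x + y) = f x + f y" "\<And>x. norm (f x) = norm x"
    using isometric_real_or_complex[where 'a = 'k] by blast
  then show thesis
  proof cases
    case r
    show thesis
      by (rule that[of f "\<lambda>_. 0"]) (simp_all add: r(1) flip: r(2))
  next
    case c
    show thesis
      by (rule that[of "Re \<circ> f" "Im \<circ> f"]) (simp_all add: c(1) cmod_power2 flip: c(2))
  qed
qed

lemma additive_zero: "(\<And>x y. \<rho> (x + y) = \<rho> x + \<rho> y) \<Longrightarrow> \<rho> 0 = 0"
  for \<rho> :: "'a::ab_group_add \<Rightarrow> real"
  by (metis add_cancel_right_left add_0)

lemma additive_minus: "(\<And>x y. \<rho> (x + y) = \<rho> x + \<rho> y) \<Longrightarrow> \<rho> (- x) = - \<rho> x"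
  for \<rho> :: "'a::ab_group_add \<Rightarrow> real"
  using additive_zero[of \<rho>] by (metis add.right_inverse add_eq_0_iff)

lemma additive_sum: "(\<And>x y. \<rho> (x + y) = \<rho> x + \<rho> y) \<Longrightarrow> \<rho> (sum f A) = (\<Sum>x\<in>A. \<rho> (f x))"
  for \<rho> :: "'a::ab_group_add \<Rightarrow> real"
  by (induction A rule: infinite_finite_induct) (auto simp: additive_zero)

lemma parallelogram:
  fixes x y :: "'k::real_or_complex"
  shows "(norm (x + y))\<^sup>2 + (norm (y - x))\<^sup>2 = 2 * (norm x)\<^sup>2 + 2 * (norm y)\<^sup>2"
proof -
  obtain \<rho>1 \<rho>2 :: "'k \<Rightarrow> real" where \<rho>: "\<And>x y. \<rho>1 (x + y) = \<rho>1 x + \<rho>1 y"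
    "\<And>x y. \<rho>2 (x + y) = \<rho>2 x + \<rho>2 y" "\<And>x. (norm x)\<^sup>2 = (\<rho>1 x)\<^sup>2 + (\<rho>2 x)\<^sup>2"
    by (rule real_coordinates) blast
  show ?thesis
    unfolding \<rho>(3) diff_conv_add_uminus[of y x] \<rho>(1,2) additive_minus[of \<rho>1, OF \<rho>(1)] additive_minus[of \<rho>2, OF \<rho>(2)]
    by (simp add: power2_eq_square algebra_simps)
qed

text \<open>Independent random signs, as the uniform distribution on sign vectors. They live in the scalar field, so that
  they can be inserted into forms over it.\<close>

definition signs :: "nat \<Rightarrow> (nat \<Rightarrow> 'k::real_normed_field) set"
  where "signs n = PiE {..<n} (\<lambda>_. {1, -1})"

lemma one_neq_minus_one: "(1::'k::real_normed_field) \<noteq> - 1"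
proof
  assume "(1::'k) = - 1"
  then have "(1::'k) + 1 = 0" by (metis add.right_inverse)
  then show False by simp
qed

lemma finite_signs [simp]: "finite (signs n)"
  by (simp add: signs_def finite_PiE)

lemma card_signs: "card (signs n :: (nat \<Rightarrow> 'k::real_normed_field) set) = 2 ^ n"
  using one_neq_minus_one[where 'k = 'k] by (simp add: signs_def card_PiE flip: numeral_2_eq_2)

lemma signs_nonempty [simp]: "signs n \<noteq> {}"
  by (simp add: signs_def PiE_eq_empty_iff)

text \<open>By the parallelogram law, averaging over one more sign adds the square of its coefficient.\<close>

lemma signs_second_moment:
  fixes a :: "nat \<Rightarrow> 'k::real_or_complex"
  shows "(\<Sum>\<epsilon>\<in>signs n. (norm (\<Sum>i<n. \<epsilon> i * a i))\<^sup>2) = 2 ^ n * (\<Sum>i<n. (norm (a i))\<^sup>2)"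
proof (induction n)
  case 0
  then show ?case by (simp add: signs_def)
next
  case (Suc n)
  have upd: "(\<Sum>i<n. (\<epsilon>(n := \<sigma>)) i * a i) = (\<Sum>i<n. \<epsilon> i * a i)" for \<epsilon> \<sigma>
    by (rule sum.cong) auto
  have "(\<Sum>\<epsilon>\<in>signs (Suc n). (norm (\<Sum>i<Suc n. \<epsilon> i * a i))\<^sup>2)
      = (\<Sum>\<sigma>\<in>{1, -1}. \<Sum>\<epsilon>\<in>signs n. (norm (\<sigma> * a n + (\<Sum>i<n. \<epsilon> i * a i)))\<^sup>2)"
    unfolding signs_def sum_PiE_Suc
    by (intro sum.cong refl) (simp add: upd[simplified] add.commute)
  also have "\<dots> = (\<Sum>\<epsilon>\<in>signs n. 2 * (norm (a n))\<^sup>2 + 2 * (norm (\<Sum>i<n. \<epsilon> i * a i))\<^sup>2)"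
    using one_neq_minus_one[where 'k = 'k] by (simp add: sum.distrib[symmetric] parallelogram)
  also have "\<dots> = 2 ^ Suc n * (\<Sum>i<Suc n. (norm (a i))\<^sup>2)"
    using Suc by (simp add: sum.distrib card_signs algebra_simps flip: sum_distrib_left)
  finally show ?case .
qed

text \<open>Integrating \<open>tanh z \<le> z\<close> gives \<open>ln (cosh x) \<le> x\<^sup>2 / 2\<close>.\<close>

lemma cosh_le: "exp x + exp (- x) \<le> 2 * exp (x\<^sup>2 / 2)" for x :: real
proof -
  have *: "exp x + exp (- x) \<le> 2 * exp (x\<^sup>2 / 2)" if "0 \<le> x" for x :: real
  proof -
    define f where "f z = z\<^sup>2 / 2 - ln (cosh z)" for z :: real
    have "f 0 \<le> f x"
    proof (rule DERIV_nonneg_imp_nondecreasing[OF that])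
      fix z :: real
      assume z: "0 \<le> z" "z \<le> x"
      have "(f has_real_derivative (z - tanh z)) (at z)"
        unfolding f_def
        by (auto intro!: derivative_eq_intros simp: tanh_def)
      moreover have "tanh z \<le> z"
      proof -
        have "(0::real) - tanh 0 \<le> z - tanh z"
        proof (rule DERIV_nonneg_imp_nondecreasing[OF z(1)])
          fix w :: real
          have "((\<lambda>w. w - tanh w) has_real_derivative (tanh w)\<^sup>2) (at w)"
            by (auto intro!: derivative_eq_intros)
          then show "\<exists>d. ((\<lambda>w. w - tanh w) has_real_derivative d) (at w) \<and> 0 \<le> d"
            by (intro exI[of _ "(tanh w)\<^sup>2"]) auto
        qed
        then show ?thesis by simp
      qed
      ultimately show "\<exists>d. (f has_real_derivative d) (at z) \<and> 0 \<le> d"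
        by (intro exI[of _ "z - tanh z"]) auto
    qed
    then have "ln (cosh x) \<le> x\<^sup>2 / 2" by (simp add: f_def)
    then have "cosh x \<le> exp (x\<^sup>2 / 2)"
      by (metis cosh_real_pos exp_le_cancel_iff exp_ln)
    then show ?thesis by (simp add: cosh_def)
  qed
  show ?thesis using *[of x] *[of "- x"] by (cases "0 \<le> x") (auto simp: add.commute)
qed

lemma signs_exp_moment:
  fixes a :: "nat \<Rightarrow> 'k::real_or_complex" and \<rho> :: "'k \<Rightarrow> real"
  assumes \<rho>: "\<And>x y. \<rho> (x + y) = \<rho> x + \<rho> y"
  shows "(\<Sum>\<epsilon>\<in>signs n. exp (\<rho> (\<Sum>i<n. \<epsilon> i * a i))) \<le> 2 ^ n * exp ((\<Sum>i<n. (\<rho> (a i))\<^sup>2) / 2)"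
proof -
  have "(\<Sum>\<epsilon>\<in>signs n. exp (\<rho> (\<Sum>i<n. \<epsilon> i * a i))) = (\<Sum>\<epsilon>\<in>signs n. \<Prod>i<n. exp (\<rho> (\<epsilon> i * a i)))"
    by (simp add: additive_sum[of \<rho>, OF \<rho>] exp_sum)
  also have "\<dots> = (\<Prod>i<n. \<Sum>\<sigma>\<in>{1, -1}. exp (\<rho> (\<sigma> * a i)))"
    unfolding signs_def by (subst prod_sum_PiE) auto
  also have "\<dots> = (\<Prod>i<n. exp (\<rho> (a i)) + exp (- \<rho> (a i)))"
    using one_neq_minus_one[where 'k = 'k] by (simp add: additive_minus[of \<rho>, OF \<rho>])
  also have "\<dots> \<le> (\<Prod>i<n. 2 * exp ((\<rho> (a i))\<^sup>2 / 2))"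
    by (intro prod_mono conjI cosh_le) (auto intro: add_nonneg_nonneg)
  also have "\<dots> = 2 ^ n * exp ((\<Sum>i<n. (\<rho> (a i))\<^sup>2) / 2)"
    by (simp add: prod.distrib exp_sum sum_divide_distrib)
  finally show ?thesis .
qed

lemma powr_le_exp:
  assumes "0 < (t::real)"
  shows "x powr t \<le> t powr t * (exp x + exp (- x))"
proof -
  have *: "x powr t \<le> t powr t * exp x" if "0 \<le> x" for x :: real
  proof -
    have "x / t \<le> exp (x / t)" using exp_ge_add_one_self[of "x / t"] by linarith
    then have "x powr t \<le> (t * exp (x / t)) powr t"
      using that assms by (intro powr_mono2) (auto simp: field_simps)
    also have "\<dots> = t powr t * exp x" using assms by (simp add: powr_mult exp_powr_real)
    finally show ?thesis .
  qed
  show ?thesis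
  proof (cases "0 \<le> x")
    case True
    then show ?thesis using *[OF True] by (simp add: distrib_left add_increasing2)
  next
    case False
    have "x powr t = (- x) powr t" by (simp add: uminus_powr_eq)
    also have "\<dots> \<le> t powr t * exp (- x)" using False by (intro *) auto
    finally show ?thesis by (simp add: distrib_left add_increasing)
  qed
qed

text \<open>Powers are dominated by exponentials, and the exponential moment of a sign sum factorizes over the
  independent signs.\<close>

lemma signs_moment_le:
  fixes a :: "nat \<Rightarrow> 'k::real_or_complex"
  assumes t: "0 < t" and a: "(\<Sum>i<n. (norm (a i))\<^sup>2) \<le> 1"
  shows "(\<Sum>\<epsilon>\<in>signs n. norm (\<Sum>i<n. \<epsilon> i * a i) powr t) \<le> 2 powr t * t powr t * 4 * exp (1/2) * 2 ^ n"
proof -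
  obtain \<rho>1 \<rho>2 :: "'k \<Rightarrow> real" where \<rho>: "\<And>x y. \<rho>1 (x + y) = \<rho>1 x + \<rho>1 y"
    "\<And>x y. \<rho>2 (x + y) = \<rho>2 x + \<rho>2 y" "\<And>x. (norm x)\<^sup>2 = (\<rho>1 x)\<^sup>2 + (\<rho>2 x)\<^sup>2"
    by (rule real_coordinates) blast
  define S where "S \<epsilon> = (\<Sum>i<n. \<epsilon> i * a i)" for \<epsilon>
  have one: "(\<Sum>\<epsilon>\<in>signs n. \<rho> (S \<epsilon>) powr t) \<le> t powr t * (2 * (2 ^ n * exp (1/2)))"
    if add: "\<And>x y. \<rho> (x + y) = \<rho> x + \<rho> y" and le: "\<And>x. (\<rho> x)\<^sup>2 \<le> (norm x)\<^sup>2" for \<rho> :: "'k \<Rightarrow> real"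
  proof -
    have b: "(\<Sum>\<epsilon>\<in>signs n. exp (\<rho>' (S \<epsilon>))) \<le> 2 ^ n * exp (1/2)"
      if \<rho>': "\<And>x y. \<rho>' (x + y) = \<rho>' x + \<rho>' y" "\<And>x. (\<rho>' x)\<^sup>2 \<le> (norm x)\<^sup>2" for \<rho>' :: "'k \<Rightarrow> real"
    proof -
      have "(\<Sum>i<n. (\<rho>' (a i))\<^sup>2) \<le> 1"
        using a by (rule order_trans[rotated]) (intro sum_mono \<rho>'(2))
      then show ?thesis
        using signs_exp_moment[where \<rho> = \<rho>' and a = a and n = n, OF \<rho>'(1)] unfolding S_def
        by (elim order_trans) (auto intro!: mult_left_mono)
    qed
    have "(\<Sum>\<epsilon>\<in>signs n. \<rho> (S \<epsilon>) powr t)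
        \<le> (\<Sum>\<epsilon>\<in>signs n. t powr t * (exp (\<rho> (S \<epsilon>)) + exp (- \<rho> (S \<epsilon>))))"
      by (intro sum_mono powr_le_exp t)
    also have "\<dots> = t powr t * ((\<Sum>\<epsilon>\<in>signs n. exp (\<rho> (S \<epsilon>))) + (\<Sum>\<epsilon>\<in>signs n. exp (- \<rho> (S \<epsilon>))))"
      by (simp add: sum.distrib flip: sum_distrib_left)
    also have "\<dots> \<le> t powr t * (2 ^ n * exp (1/2) + 2 ^ n * exp (1/2))"
      using b[of \<rho>] b[of "\<lambda>x. - \<rho> x"] add le by (intro mult_left_mono add_mono) auto
    finally show ?thesis by simp
  qed
  have le1: "(\<rho>1 x)\<^sup>2 \<le> (norm x)\<^sup>2" and le2: "(\<rho>2 x)\<^sup>2 \<le> (norm x)\<^sup>2" for x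
    by (simp_all add: \<rho>(3))
  have pw: "norm x powr t \<le> 2 powr t * (\<rho>1 x powr t + \<rho>2 x powr t)" for x
  proof -
    have "norm x = sqrt ((\<rho>1 x)\<^sup>2 + (\<rho>2 x)\<^sup>2)" using \<rho>(3)[of x] by (simp add: real_sqrt_unique)
    also have "\<dots> \<le> \<bar>\<rho>1 x\<bar> + \<bar>\<rho>2 x\<bar>" by (rule sqrt_sum_squares_le_sum_abs)
    also have "\<dots> \<le> 2 * max \<bar>\<rho>1 x\<bar> \<bar>\<rho>2 x\<bar>" by auto
    finally have "norm x powr t \<le> (2 * max \<bar>\<rho>1 x\<bar> \<bar>\<rho>2 x\<bar>) powr t"
      using t by (intro powr_mono2) auto
    also have "\<dots> = 2 powr t * (max \<bar>\<rho>1 x\<bar> \<bar>\<rho>2 x\<bar>) powr t" by (simp add: powr_mult)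
    also have "(max \<bar>\<rho>1 x\<bar> \<bar>\<rho>2 x\<bar>) powr t \<le> \<rho>1 x powr t + \<rho>2 x powr t"
      by (auto simp: max_def abs_if uminus_powr_eq)
    finally show ?thesis by simp
  qed
  have "(\<Sum>\<epsilon>\<in>signs n. norm (S \<epsilon>) powr t)
      \<le> (\<Sum>\<epsilon>\<in>signs n. 2 powr t * (\<rho>1 (S \<epsilon>) powr t + \<rho>2 (S \<epsilon>) powr t))"
    by (intro sum_mono pw)
  also have "\<dots> = 2 powr t * ((\<Sum>\<epsilon>\<in>signs n. \<rho>1 (S \<epsilon>) powr t) + (\<Sum>\<epsilon>\<in>signs n. \<rho>2 (S \<epsilon>) powr t))"
    by (simp add: sum.distrib flip: sum_distrib_left)
  also have "\<dots> \<le> 2 powr t * (t powr t * (2 * (2 ^ n * exp (1/2))) + t powr t * (2 * (2 ^ n * exp (1/2))))"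
    using one[of \<rho>1] one[of \<rho>2] \<rho>(1,2) le1 le2 by (intro mult_left_mono add_mono) auto
  finally show ?thesis by (simp add: S_def mult_ac)
qed

lemma signs_lmean_2:
  fixes a :: "nat \<Rightarrow> 'k::real_or_complex"
  shows "lmean 2 (signs n) (\<lambda>\<epsilon>. \<Sum>i<n. \<epsilon> i * a i) = lpn 2 {..<n} a"
proof -
  have "lmean 2 (signs n) (\<lambda>\<epsilon>. \<Sum>i<n. \<epsilon> i * a i)
      = ((\<Sum>\<epsilon>\<in>signs n. (norm (\<Sum>i<n. \<epsilon> i * a i))\<^sup>2) / 2 ^ n) powr (1/2)"
    by (simp add: lmean_def lpn_def card_signs powr_divide powr_minus_divide)
  then show ?thesis by (simp add: signs_second_moment lpn_def)
qed

lemma signs_lmean_le: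
  fixes a :: "nat \<Rightarrow> 'k::real_or_complex"
  assumes t: "0 < t"
  shows "lmean t (signs n) (\<lambda>\<epsilon>. \<Sum>i<n. \<epsilon> i * a i)
    \<le> (2 powr t * t powr t * 4 * exp (1/2)) powr (1/t) * lpn 2 {..<n} a"
proof (cases "lpn 2 {..<n} a = 0")
  case True
  then have "a i = 0" if "i < n" for i using lpn_eq_0D[of 2 "{..<n}" a i] that by simp
  then show ?thesis using t True by (simp add: lmean_def lpn_def)
next
  case False
  define B where "B = lpn 2 {..<n} a"
  have B: "0 < B" using False by (simp add: B_def less_le)
  define a' where "a' i = a i / of_real B" for i
  have "(\<Sum>i<n. (norm (a i))\<^sup>2) = B\<^sup>2"
    using lpn_powr[of 2 "{..<n}" a] by (simp add: B_def)
  then have "(\<Sum>i<n. (norm (a' i))\<^sup>2) \<le> 1"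
    using B by (simp add: a'_def norm_divide power_divide flip: sum_divide_distrib)
  then have "lmean t (signs n) (\<lambda>\<epsilon>. \<Sum>i<n. \<epsilon> i * a' i) \<le> (2 powr t * t powr t * 4 * exp (1/2)) powr (1/t)"
    using signs_moment_le[OF t, where a = a'] t by (subst lmean_le_iff) (auto simp: powr_powr card_signs)
  moreover have "lmean t (signs n) (\<lambda>\<epsilon>. \<Sum>i<n. \<epsilon> i * a i) = B * lmean t (signs n) (\<lambda>\<epsilon>. \<Sum>i<n. \<epsilon> i * a' i)"
    using B t
    by (intro lmean_scale) (auto simp: a'_def norm_divide simp flip: sum_divide_distrib)
  ultimately show ?thesis using B by (simp add: B_def mult.commute)
qed

text \<open>The higher moments come from \<open>signs_lmean_le\<close>, the lower ones from \<open>lmean_equiv_lmean_2\<close>.\<close>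

theorem khintchine:
  assumes "0 < q"
  obtains c C where "0 < c" "0 < C"
    "\<And>n (a :: nat \<Rightarrow> 'k::real_or_complex).
        c * lpn 2 {..<n} a \<le> lmean q (signs n) (\<lambda>\<epsilon>. \<Sum>i<n. \<epsilon> i * a i)"
    "\<And>n (a :: nat \<Rightarrow> 'k). lmean q (signs n) (\<lambda>\<epsilon>. \<Sum>i<n. \<epsilon> i * a i) \<le> C * lpn 2 {..<n} a"
proof -
  define A where "A p = (signs (fst p) :: (nat \<Rightarrow> 'k) set)" for p :: "nat \<times> (nat \<Rightarrow> 'k)"
  define f where "f p = (\<lambda>\<epsilon>. \<Sum>i<fst p. \<epsilon> i * snd p i)" for p :: "nat \<times> (nat \<Rightarrow> 'k)"
  obtain c C where *: "0 < c" "0 < C"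
    "\<And>p. c * lmean 2 (A p) (f p) \<le> lmean q (A p) (f p)" "\<And>p. lmean q (A p) (f p) \<le> C * lmean 2 (A p) (f p)"
  proof (rule lmean_equiv_lmean_2[OF _ _ _ assms, of A f])
    fix t :: real
    assume "2 < t"
    then show "\<exists>C. \<forall>p. lmean t (A p) (f p) \<le> C * lmean 2 (A p) (f p)"
      using signs_lmean_le[of t]
      by (intro exI[of _ "(2 powr t * t powr t * 4 * exp (1/2)) powr (1/t)"]) (auto simp: A_def f_def signs_lmean_2)
  qed (auto simp: A_def)
  show thesis
    using *(3)[of "(n, a)" for n a] *(4)[of "(n, a)" for n a]
    by (intro that[OF *(1,2)]) (simp_all add: A_def f_def signs_lmean_2)
qed

text \<open>On unit vectors a form takes its coefficients as values. So \<open>tensor_ineq\<close>, with unit vectors on one side,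
  compares a random form with the \<open>\<ell>\<^sub>2\<close> norm of its coefficients.\<close>

lemma mform_unit_vectors:
  assumes "j \<in> PiE {..<m} (\<lambda>k. {..<n k})"
  shows "mform m n b (\<lambda>k i. if i = j k then 1 else 0) = b j"
proof -
  have "(\<Prod>k<m. if i k = j k then 1 else 0) = (if i = j then 1 else (0::'a))"
    if i: "i \<in> PiE {..<m} (\<lambda>k. {..<n k})" for i
  proof (cases "i = j")
    case False
    then obtain k where "k < m" "i k \<noteq> j k" using PiE_ext[OF i assms] by (metis lessThan_iff)
    then show ?thesis using False by (auto intro!: prod_zero)
  qed simp
  then have "mform m n b (\<lambda>k i. if i = j k then 1 else 0)
    = (\<Sum>i\<in>PiE {..<m} (\<lambda>k. {..<n k}). if i = j then b i else 0)"
    unfolding mform_def by (intro sum.cong) auto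
  also have "\<dots> = b j" using assms by (simp add: finite_PiE)
  finally show ?thesis .
qed

lemma lmean_PiE:
  fixes m :: nat
  assumes "\<And>k. k < m \<Longrightarrow> finite (A k)"
  shows "lmean p (PiE {..<m} A) f = lpn p (PiE {..<m} A) f * (\<Prod>k<m. real (card (A k)) powr (-1/p))"
  by (simp add: lmean_def card_PiE prod_powr_distrib del: powr_minus_divide flip: minus_divide_left)

text \<open>\<open>tensor_ineq\<close> from sign vectors (exponent \<open>t\<close>) to unit vectors (exponent 2); this direction requires \<open>2 \<le> t\<close>.\<close>

lemma tensor_lpn_2:
  fixes b :: "(nat \<Rightarrow> nat) \<Rightarrow> 'k::real_or_complex"
  assumes "2 \<le> t"
    and "\<And>k (a :: nat \<Rightarrow> 'k). k < m \<Longrightarrow> lmean t (signs (n k)) (\<lambda>\<epsilon>. \<Sum>i<n k. \<epsilon> i * a i) \<le> C * lpn 2 {..<n k} a"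
    and "0 \<le> C"
  shows "lmean t (PiE {..<m} (\<lambda>k. signs (n k))) (mform m n b) \<le> C ^ m * lpn 2 (PiE {..<m} (\<lambda>k. {..<n k})) b"
proof -
  let ?c = "\<lambda>k. real (card (signs (n k) :: (nat \<Rightarrow> 'k) set))"
  have c: "0 < ?c k" for k by (simp add: card_signs)
  have "lpn t (PiE {..<m} (\<lambda>k. signs (n k))) (\<lambda>\<epsilon>. mform m n b (\<lambda>k. \<epsilon> k))
      \<le> (\<Prod>k<m. C * ?c k powr (1/t))
         * lpn 2 (PiE {..<m} (\<lambda>k. {..<n k})) (\<lambda>j. mform m n b (\<lambda>k i. if i = j k then 1 else 0))"
  proof (rule tensor_ineq)
    fix k and a :: "nat \<Rightarrow> 'k"
    assume "k < m"
    from assms(2)[OF this, of a]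
    have "lpn t (signs (n k)) (\<lambda>\<epsilon>. \<Sum>i<n k. \<epsilon> i * a i) \<le> C * ?c k powr (1/t) * lpn 2 {..<n k} a"
      using c[of k] by (simp add: lpn_eq_lmean mult_left_mono mult.left_commute mult.commute[of _ "_ powr _"])
    also have "lpn 2 {..<n k} a = lpn 2 {..<n k} (\<lambda>x. \<Sum>i<n k. (if i = x then 1 else 0) * a i)"
      by (intro lpn_cong) (auto simp: if_distrib[of "\<lambda>x. x * _"] cong: if_cong)
    finally show "lpn t (signs (n k)) (\<lambda>\<epsilon>. \<Sum>i<n k. \<epsilon> i * a i)
      \<le> C * ?c k powr (1/t) * lpn 2 {..<n k} (\<lambda>x. \<Sum>i<n k. (if i = x then 1 else 0) * a i)" .
  qed (use assms in auto)
  also have "lpn 2 (PiE {..<m} (\<lambda>k. {..<n k})) (\<lambda>j. mform m n b (\<lambda>k i. if i = j k then 1 else 0))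
      = lpn 2 (PiE {..<m} (\<lambda>k. {..<n k})) b"
    by (intro lpn_cong) (auto simp: mform_unit_vectors)
  finally have "lpn t (PiE {..<m} (\<lambda>k. signs (n k))) (mform m n b)
      \<le> C ^ m * (\<Prod>k<m. ?c k powr (1/t)) * lpn 2 (PiE {..<m} (\<lambda>k. {..<n k})) b"
    by (simp add: prod.distrib)
  then have "lmean t (PiE {..<m} (\<lambda>k. signs (n k))) (mform m n b)
     \<le> C ^ m * (\<Prod>k<m. ?c k powr (1/t)) * lpn 2 (PiE {..<m} (\<lambda>k. {..<n k})) b * (\<Prod>k<m. ?c k powr (-1/t))"
    by (subst lmean_PiE) (auto intro!: mult_right_mono prod_nonneg)
  also have "\<dots> = C ^ m * lpn 2 (PiE {..<m} (\<lambda>k. {..<n k})) b * (\<Prod>k<m. ?c k powr (1/t) * ?c k powr (-1/t))"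
    by (simp add: prod.distrib mult_ac)
  also have "(\<Prod>k<m. ?c k powr (1/t) * ?c k powr (-1/t)) = 1"
    using c by (intro prod.neutral) (simp flip: powr_add)
  finally show ?thesis by simp
qed

text \<open>\<open>tensor_ineq\<close> in the opposite direction, which is possible because both exponents are 2.\<close>

lemma lpn_2_tensor:
  fixes b :: "(nat \<Rightarrow> nat) \<Rightarrow> 'k::real_or_complex"
  shows "lpn 2 (PiE {..<m} (\<lambda>k. {..<n k})) b \<le> lmean 2 (PiE {..<m} (\<lambda>k. signs (n k))) (mform m n b)"
proof -
  let ?c = "\<lambda>k. real (card (signs (n k) :: (nat \<Rightarrow> 'k) set))"
  have c: "0 < ?c k" for k by (simp add: card_signs)
  have "lpn 2 (PiE {..<m} (\<lambda>k. {..<n k})) b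
     = lpn 2 (PiE {..<m} (\<lambda>k. {..<n k})) (\<lambda>j. mform m n b (\<lambda>k i. if i = j k then 1 else 0))"
    by (intro lpn_cong) (auto simp: mform_unit_vectors)
  also have "\<dots> \<le> (\<Prod>k<m. ?c k powr (-1/2))
         * lpn 2 (PiE {..<m} (\<lambda>k. signs (n k))) (\<lambda>\<epsilon>. mform m n b (\<lambda>k. \<epsilon> k))"
  proof (rule tensor_ineq)
    fix k and a :: "nat \<Rightarrow> 'k"
    have "lpn 2 {..<n k} (\<lambda>x. \<Sum>i<n k. (if i = x then 1 else 0) * a i) = lpn 2 {..<n k} a"
      by (intro lpn_cong) (auto simp: if_distrib[of "\<lambda>x. x * _"] cong: if_cong)
    also have "\<dots> = lmean 2 (signs (n k)) (\<lambda>\<epsilon>. \<Sum>i<n k. \<epsilon> i * a i)"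
      by (simp add: signs_lmean_2)
    finally show "lpn 2 {..<n k} (\<lambda>x. \<Sum>i<n k. (if i = x then 1 else 0) * a i)
        \<le> ?c k powr (-1/2) * lpn 2 (signs (n k)) (\<lambda>\<epsilon>. \<Sum>i<n k. \<epsilon> i * a i)"
      by (simp add: lmean_def mult.commute)
  qed auto
  finally show ?thesis by (simp add: lmean_PiE mult.commute)
qed

text \<open>Khintchine's inequality for decoupled chaoses. The bounds depend only on the moduli of the
  coefficients, which is the source of unconditionality.\<close>

theorem khintchine_tensor:
  assumes "0 < q"
  obtains c C where "0 < c" "0 < C"
    "\<And>n (b :: (nat \<Rightarrow> nat) \<Rightarrow> 'k::real_or_complex).
        c * lpn 2 (PiE {..<m} (\<lambda>k. {..<n k})) b \<le> lmean q (PiE {..<m} (\<lambda>k. signs (n k))) (mform m n b)"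
    "\<And>n (b :: (nat \<Rightarrow> nat) \<Rightarrow> 'k).
        lmean q (PiE {..<m} (\<lambda>k. signs (n k))) (mform m n b) \<le> C * lpn 2 (PiE {..<m} (\<lambda>k. {..<n k})) b"
proof -
  have lmean_2: "lmean 2 (PiE {..<m} (\<lambda>k. signs (n k))) (mform m n b) = lpn 2 (PiE {..<m} (\<lambda>k. {..<n k})) b"
    for n and b :: "(nat \<Rightarrow> nat) \<Rightarrow> 'k"
    using tensor_lpn_2[of 2 m n 1 b] lpn_2_tensor[of m n b] by (simp add: signs_lmean_2)
  define A where "A p = PiE {..<m} (\<lambda>k. signs (fst p k) :: (nat \<Rightarrow> 'k) set)"
    for p :: "(nat \<Rightarrow> nat) \<times> ((nat \<Rightarrow> nat) \<Rightarrow> 'k)"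
  define f where "f p = mform m (fst p) (snd p)" for p :: "(nat \<Rightarrow> nat) \<times> ((nat \<Rightarrow> nat) \<Rightarrow> 'k)"
  obtain c C where *: "0 < c" "0 < C"
    "\<And>p. c * lmean 2 (A p) (f p) \<le> lmean q (A p) (f p)" "\<And>p. lmean q (A p) (f p) \<le> C * lmean 2 (A p) (f p)"
  proof (rule lmean_equiv_lmean_2[OF _ _ _ assms, of A f])
    fix t :: real
    assume "2 < t"
    then show "\<exists>C. \<forall>p. lmean t (A p) (f p) \<le> C * lmean 2 (A p) (f p)"
      using tensor_lpn_2[of t m _ "(2 powr t * t powr t * 4 * exp (1/2)) powr (1/t)", OF _ signs_lmean_le]
      by (intro exI[of _ "((2 powr t * t powr t * 4 * exp (1/2)) powr (1/t)) ^ m"]) (auto simp: A_def f_def lmean_2)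
  qed (auto simp: A_def PiE_eq_empty_iff intro: finite_PiE)
  show thesis
    using *(3)[of "(n, b)" for n b] *(4)[of "(n, b)" for n b]
    by (intro that[OF *(1,2)]) (simp_all add: A_def f_def lmean_2)
qed

section \<open>A discrete heavy-tailed variable\<close>

text \<open>With \<open>h = 1 / w\<close>, this and the next inequality bound \<open>w powr (- l)\<close>, up to a factor, by the difference of
  consecutive values of \<open>w powr (1 - l)\<close>, so that sums of powers telescope.\<close>

lemma bernoulli_le: "(1 - h) powr a \<le> 1 - a * h" if "0 < a" "a < 1" "0 \<le> h" "h < 1" for a h :: real
  using Youngs_inequality_0[of a "1 - a" "1 - h" 1] that by (simp add: algebra_simps)

lemma bernoulli_ge: "1 + a * h \<le> (1 - h) powr (- a)" if "0 < a" "0 \<le> h" "h < 1" for a h :: real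
proof -
  have "ln (1 - h) \<le> - h" using that ln_le_minus_one[of "1 - h"] by simp
  then have "a * ln (1 - h) \<le> a * (- h)" using that by (intro mult_left_mono) auto
  then have "1 + a * h \<le> 1 - a * ln (1 - h)" by simp
  also have "\<dots> \<le> exp (- a * ln (1 - h))" using exp_ge_add_one_self[of "- a * ln (1 - h)"] by simp
  also have "\<dots> = (1 - h) powr (- a)" using that by (simp add: powr_def)
  finally show ?thesis .
qed

lemma powr_minus_eq_divide: "w powr (- e) = w powr (1 - e) / w" if "0 < w" for w e :: real
proof -
  have "w powr (- e) = w powr (1 - e - 1)" by simp
  also have "\<dots> = w powr (1 - e) / w" using that by (subst powr_diff) simp
  finally show ?thesis .
qed

lemma sum_powr_le_head:
  assumes "0 < l" "l < 1"
  shows "(\<Sum>w=1..M. real w powr (- l)) \<le> real M powr (1 - l) / (1 - l)"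
proof (induction M)
  case 0
  then show ?case by simp
next
  case (Suc M)
  define w where "w = real (Suc M)"
  have w: "0 < w" "real M = w - 1" by (simp_all add: w_def)
  have "(w - 1) powr (1 - l) \<le> w powr (1 - l) - (1 - l) * w powr (- l)"
  proof (cases "M = 0")
    case True
    then show ?thesis using assms by (simp add: w_def)
  next
    case False
    have "(w - 1) powr (1 - l) = w powr (1 - l) * (1 - 1 / w) powr (1 - l)"
    proof -
      have "w * (1 - 1 / w) = w - 1" using w(1) by (simp add: field_simps)
      then show ?thesis by (simp only: minus_diff_eq flip: powr_mult)
    qed
    also have "\<dots> \<le> w powr (1 - l) * (1 - (1 - l) * (1 / w))"
      using w(1) False assms by (intro mult_left_mono bernoulli_le) (simp_all add: w_def)
    also have "\<dots> = w powr (1 - l) - (1 - l) * (w powr (1 - l) / w)"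
      by (simp add: algebra_simps)
    also have "\<dots> = w powr (1 - l) - (1 - l) * w powr (- l)"
      unfolding powr_minus_eq_divide[OF w(1)] ..
    finally show ?thesis .
  qed
  then have "(w - 1) powr (1 - l) / (1 - l) + w powr (- l) \<le> w powr (1 - l) / (1 - l)"
  proof -
    assume "(w - 1) powr (1 - l) \<le> w powr (1 - l) - (1 - l) * w powr (- l)"
    then have "((w - 1) powr (1 - l) + (1 - l) * w powr (- l)) / (1 - l) \<le> w powr (1 - l) / (1 - l)"
      using assms by (intro divide_right_mono) auto
    then show ?thesis using assms by (simp add: add_divide_distrib)
  qed
  moreover have "(\<Sum>v=1..Suc M. real v powr (- l)) = (\<Sum>v=1..M. real v powr (- l)) + w powr (- l)"
    by (simp add: w_def)
  ultimately show ?case using Suc unfolding w(2) w_def[symmetric] by linarith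
qed

lemma sum_powr_le_tail:
  assumes "1 < k" "0 < M"
  shows "(\<Sum>w=M..N. real w powr (- k)) \<le> real M powr (- k) + real M powr (1 - k) / (k - 1)"
proof -
  have "(\<Sum>w=M..N. real w powr (- k)) \<le> real M powr (- k) + (real M powr (1 - k) - real N powr (1 - k)) / (k - 1)"
    if "M \<le> N" using that
  proof (induction N rule: dec_induct)
    case base
    then show ?case by simp
  next
    case (step N)
    define w where "w = real (Suc N)"
    have w: "1 < w" "real N = w - 1" using step assms by (simp_all add: w_def)
    have "w powr (1 - k) + (k - 1) * w powr (- k) = w powr (1 - k) + (k - 1) * (w powr (1 - k) / w)"
      using w powr_minus_eq_divide[of w k] by simp
    also have "\<dots> = w powr (1 - k) * (1 + (k - 1) * (1 / w))"
      by (simp add: algebra_simps)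
    also have "\<dots> \<le> w powr (1 - k) * (1 - 1 / w) powr (- (k - 1))"
      using w assms by (intro mult_left_mono bernoulli_ge) auto
    also have "\<dots> = (w - 1) powr (1 - k)"
    proof -
      have "w * (1 - 1 / w) = w - 1" using w(1) by (simp add: field_simps)
      then show ?thesis by (simp only: minus_diff_eq flip: powr_mult)
    qed
    finally have "w powr (- k) \<le> ((w - 1) powr (1 - k) - w powr (1 - k)) / (k - 1)"
      using assms by (simp add: field_simps)
    moreover have "(\<Sum>v=M..Suc N. real v powr (- k)) = (\<Sum>v=M..N. real v powr (- k)) + w powr (- k)"
      using step by (simp add: w_def)
    ultimately show ?case
      using step unfolding w(2) w_def[symmetric] diff_divide_distrib by linarith
  qed
  moreover have "(real M powr (1 - k) - real N powr (1 - k)) / (k - 1) \<le> real M powr (1 - k) / (k - 1)"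
    using assms by (intro divide_right_mono) auto
  ultimately show ?thesis
    using assms by (cases "M \<le> N") (fastforce intro: add_nonneg_nonneg)+
qed

text \<open>The terms with \<open>w \<le> x\<close> are bounded through the small exponent \<open>l\<close>, the others through the large exponent \<open>k\<close>;
  both sums are of order \<open>x\<close>. Linearity in \<open>x\<close> is what makes the contributions of several
  coordinates add up in \<open>pareto_upper\<close>.\<close>

lemma sum_min_powr_le:
  assumes l: "0 < l" "l < 1" and k: "1 < k" and x: "0 \<le> x"
  shows "(\<Sum>w=1..N. min ((x / real w) powr k) ((x / real w) powr l)) \<le> x * (1 / (1 - l) + (1 + 1 / (k - 1)))"
proof (cases "x = 0")
  case False
  then have x0: "0 < x" using x by simp
  define M where "M = nat \<lfloor>x\<rfloor>"
  have M: "real M \<le> x" "x < real (Suc M)" using x by (auto simp: M_def) linarith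
  let ?g = "\<lambda>w. min ((x / real w) powr k) ((x / real w) powr l)"
  have split_pow: "(x / real w) powr e = x powr e * real w powr (- e)" for w e
    unfolding powr_divide powr_minus by (simp only: divide_inverse)
  have "(\<Sum>w=1..N. ?g w) \<le> (\<Sum>w\<in>{1..M} \<union> {Suc M..N}. ?g w)"
    by (intro sum_mono2) auto
  also have "\<dots> = (\<Sum>w=1..M. ?g w) + (\<Sum>w=Suc M..N. ?g w)"
    by (intro sum.union_disjoint) auto
  also have "(\<Sum>w=1..M. ?g w) \<le> x * (1 / (1 - l))"
  proof -
    have "(\<Sum>w=1..M. ?g w) \<le> (\<Sum>w=1..M. x powr l * real w powr (- l))"
      by (intro sum_mono) (simp only: split_pow min.cobounded2)
    also have "\<dots> \<le> x powr l * (real M powr (1 - l) / (1 - l))"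
      unfolding sum_distrib_left[symmetric] by (intro mult_left_mono sum_powr_le_head[OF l]) auto
    also have "\<dots> \<le> x powr l * (x powr (1 - l) / (1 - l))"
      using l M by (intro mult_left_mono divide_right_mono powr_mono2) auto
    also have "\<dots> = x * (1 / (1 - l))" using x0 powr_add[of x l "1 - l"] by simp
    finally show ?thesis .
  qed
  also have "(\<Sum>w=Suc M..N. ?g w) \<le> x * (1 + 1 / (k - 1))"
  proof -
    define y where "y = real (Suc M)"
    have y: "1 \<le> y" "x < y" using M by (auto simp: y_def)
    have "(\<Sum>w=Suc M..N. ?g w) \<le> (\<Sum>w=Suc M..N. x powr k * real w powr (- k))"
      by (intro sum_mono) (simp only: split_pow min.cobounded1)
    also have "\<dots> \<le> x powr k * (y powr (- k) + y powr (1 - k) / (k - 1))"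
      unfolding sum_distrib_left[symmetric] y_def by (intro mult_left_mono sum_powr_le_tail[OF k]) auto
    also have "\<dots> = (x / y) powr k + x * ((x / y) powr (k - 1) / (k - 1))"
    proof -
      have "x powr k = x * x powr (k - 1)" using x0 powr_mult_base[of x "k - 1"] by simp
      moreover have "y powr (1 - k) = inverse (y powr (k - 1))" by (metis powr_minus minus_diff_eq)
      ultimately show ?thesis
        unfolding powr_divide powr_minus by (simp add: field_simps)
    qed
    also have "\<dots> \<le> x + x * (1 / (k - 1))"
    proof (intro add_mono mult_left_mono divide_right_mono)
      have "(x / y) powr k \<le> (x / y) powr 1" using k x0 y by (intro powr_mono') auto
      also have "\<dots> \<le> x / 1" using x0 y by (simp add: field_simps)
      finally show "(x / y) powr k \<le> x" by simp
      show "(x / y) powr (k - 1) \<le> 1" using x0 y k by (intro powr_le1) auto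
    qed (use x k in auto)
    finally show ?thesis by (simp add: distrib_left)
  qed
  finally show ?thesis by (simp add: distrib_left)
qed simp

lemma sum_powr_subadditive:
  fixes f :: "'a \<Rightarrow> real"
  assumes "0 < u" "u \<le> 1" "\<And>x. x \<in> A \<Longrightarrow> 0 \<le> f x"
  shows "(\<Sum>x\<in>A. f x) powr u \<le> (\<Sum>x\<in>A. f x powr u)"
proof (cases "finite A")
  case True
  have "lpn 1 A f \<le> lpn u A f"
  proof (cases "lpn u A f = 0")
    case True
    then have "f x = 0" if "x \<in> A" for x using lpn_eq_0D[OF assms(1) \<open>finite A\<close> _ that] by blast
    then show ?thesis by (simp add: lpn_def)
  next
    case False
    define B where "B = lpn u A f"
    have B: "0 < B" using False by (simp add: B_def less_le)
    have le1: "f x / B \<le> 1" if "x \<in> A" for x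
      using le_lpn[OF assms(1) \<open>finite A\<close> that, of f] B by (simp add: B_def)
    have "(\<Sum>x\<in>A. f x / B) \<le> (\<Sum>x\<in>A. (f x / B) powr u)"
    proof (rule sum_mono)
      fix x assume "x \<in> A"
      then show "f x / B \<le> (f x / B) powr u"
        using powr_mono'[of u 1 "f x / B"] le1 assms B by auto
    qed
    also have "\<dots> = (\<Sum>x\<in>A. norm (f x) powr u) / B powr u"
      using assms by (simp add: powr_divide sum_divide_distrib)
    also have "\<dots> = 1"
      using B assms(1) by (subst lpn_powr[symmetric]) (simp_all add: B_def)
    finally have "(\<Sum>x\<in>A. f x) \<le> B" using B by (simp flip: sum_divide_distrib)
    then show ?thesis using assms by (simp add: lpn_def B_def sum_nonneg cong: sum.cong)
  qed
  then have "(\<Sum>x\<in>A. f x) \<le> lpn u A f"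
    using assms by (simp add: lpn_def[of 1] sum_nonneg cong: sum.cong)
  then have "(\<Sum>x\<in>A. f x) powr u \<le> lpn u A f powr u"
    using assms by (intro powr_mono2) (auto intro: sum_nonneg)
  then show ?thesis using assms by (simp add: lpn_powr cong: sum.cong)
qed simp

text \<open>Truncation at 1: the small terms are summed before the concave power is taken, the large ones after it.\<close>

lemma sum_powr_le_min:
  fixes f :: "'a \<Rightarrow> real"
  assumes u: "0 < u" "u < 1" and A: "finite A" and f: "\<And>x. x \<in> A \<Longrightarrow> 0 \<le> f x"
  shows "(\<Sum>x\<in>A. f x) powr u \<le> 1 + (\<Sum>x\<in>A. min (f x) (f x powr u))"
proof -
  let ?S = "{x \<in> A. f x \<le> 1}" and ?B = "{x \<in> A. \<not> f x \<le> 1}"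
  have split: "sum g A = sum g ?S + sum g ?B" for g :: "'a \<Rightarrow> real"
    using A by (subst sum.union_disjoint[symmetric]) (auto intro: sum.cong)
  have small: "f x \<le> f x powr u" if "x \<in> ?S" for x
    using powr_mono'[of u 1 "f x"] u f that by auto
  have big: "f x powr u \<le> f x" if "x \<in> ?B" for x
    using powr_mono[of u 1 "f x"] u that by auto
  have nonneg: "0 \<le> sum f ?S" "0 \<le> sum f ?B" using f by (auto intro: sum_nonneg)
  have "(\<Sum>x\<in>A. f x) powr u \<le> (\<Sum>x\<in>?S. f x) powr u + (\<Sum>x\<in>?B. f x) powr u"
    using sum_powr_subadditive[of u "{True, False}" "\<lambda>b. if b then (\<Sum>x\<in>?S. f x) else (\<Sum>x\<in>?B. f x)"]
      u nonneg by (simp add: split[of f])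
  also have "(\<Sum>x\<in>?S. f x) powr u \<le> 1 + (\<Sum>x\<in>?S. f x)"
  proof (cases "(\<Sum>x\<in>?S. f x) \<le> 1")
    case True
    then have "(\<Sum>x\<in>?S. f x) powr u \<le> 1"
      using u nonneg by (intro powr_le1) auto
    then show ?thesis using f by (intro add_increasing2 sum_nonneg) auto
  next
    case False
    then show ?thesis using powr_mono[of u 1 "\<Sum>x\<in>?S. f x"] u by auto
  qed
  also have "(\<Sum>x\<in>?S. f x) = (\<Sum>x\<in>?S. min (f x) (f x powr u))"
    using small by (intro sum.cong refl) (simp add: min_absorb1)
  also have "(\<Sum>x\<in>?B. f x) powr u \<le> (\<Sum>x\<in>?B. f x powr u)"
    using u f by (intro sum_powr_subadditive) auto
  also have "(\<Sum>x\<in>?B. f x powr u) = (\<Sum>x\<in>?B. min (f x) (f x powr u))"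
    using big by (intro sum.cong refl) (simp add: min_absorb2)
  finally show ?thesis by (simp add: split[of "\<lambda>x. min (f x) (f x powr u)"])
qed

lemma sum_PiE_marginal:
  fixes g :: "'a \<Rightarrow> real"
  assumes "finite D" "i < n"
  shows "(\<Sum>\<theta>\<in>PiE {..<n} (\<lambda>_. D). g (\<theta> i)) * card D = real (card D) ^ n * (\<Sum>x\<in>D. g x)"
proof -
  have "(\<Sum>\<theta>\<in>PiE {..<n} (\<lambda>_. D). g (\<theta> i))
      = (\<Sum>\<theta>\<in>PiE {..<n} (\<lambda>_. D). \<Prod>k<n. if k = i then g (\<theta> k) else 1)"
    using assms by (intro sum.cong refl) simp
  also have "\<dots> = (\<Prod>k<n. \<Sum>x\<in>D. if k = i then g x else 1)"
    using assms by (subst prod_sum_PiE) auto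
  also have "\<dots> = (\<Prod>k<n. if k = i then (\<Sum>x\<in>D. g x) else card D)"
    by (intro prod.cong) auto
  also have "\<dots> = (\<Sum>x\<in>D. g x) * real (card D) ^ (n - 1)"
    using assms by (subst prod.remove[of _ i]) auto
  finally show ?thesis using assms by (cases n) (auto simp: mult_ac)
qed

text \<open>The uniform distribution on this set has \<open>P(\<bar>X\<bar> \<ge> t)\<close> close to \<open>t powr (- s)\<close> for \<open>1 \<le> t \<le> N powr (1 / s)\<close>. Independent copies of it
  replace symmetric \<open>s\<close>-stable variables: up to constants, their linear combinations have the same moments of
  order below \<open>s\<close>, and they take finitely many values, so only finite sums occur.\<close>

definition pareto :: "real \<Rightarrow> nat \<Rightarrow> 'k::real_normed_field set"
  where "pareto s N = (\<lambda>(\<sigma>, w). \<sigma> * of_real ((real N / real w) powr (1 / s))) ` ({1, -1} \<times> {1..N})"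

text \<open>Each modulus is attained exactly twice, once for each sign.\<close>

lemma pareto_sum:
  fixes h :: "real \<Rightarrow> real"
  assumes "0 < s"
  shows "(\<Sum>x\<in>(pareto s N :: 'k::real_normed_field set). h (norm x))
       = 2 * (\<Sum>w=1..N. h ((real N / real w) powr (1 / s)))"
proof -
  let ?f = "\<lambda>(\<sigma> :: 'k, w). \<sigma> * of_real ((real N / real w) powr (1 / s))"
  have "inj_on ?f ({1, -1} \<times> {1..N})"
  proof (rule inj_onI, clarify)
    fix \<sigma> \<tau> :: 'k and v w :: nat
    assume *: "\<sigma> \<in> {1, -1}" "\<tau> \<in> {1, -1}" "v \<in> {1..N}" "w \<in> {1..N}"
      and eq: "\<sigma> * of_real ((real N / real v) powr (1 / s)) = \<tau> * of_real ((real N / real w) powr (1 / s))"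
    then have "norm (\<sigma> * of_real ((real N / real v) powr (1 / s))) = norm (\<tau> * of_real ((real N / real w) powr (1 / s)))"
      by simp
    then have "(real N / real v) powr (1 / s) = (real N / real w) powr (1 / s)"
      using * by (auto simp: norm_mult)
    then have "real N / real v = real N / real w"
      using assms by (metis le_of_powr_le antisym divide_nonneg_nonneg of_nat_0_le_iff order_refl zero_less_divide_1_iff)
    then have "v = w" using * by (simp add: field_simps)
    then show "\<sigma> = \<tau> \<and> v = w" using eq * by simp
  qed
  then have "(\<Sum>x\<in>(pareto s N :: 'k set). h (norm x)) = (\<Sum>z\<in>{1, -1} \<times> {1..N}. h (norm (?f z)))"
    unfolding pareto_def by (simp add: sum.reindex o_def)
  also have "\<dots> = (\<Sum>(\<sigma> :: 'k, w)\<in>{1, -1} \<times> {1..N}. h ((real N / real w) powr (1 / s)))"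
    by (intro sum.cong) (auto simp: norm_mult)
  also have "\<dots> = 2 * (\<Sum>w=1..N. h ((real N / real w) powr (1 / s)))"
    using one_neq_minus_one[where 'k = 'k] by (simp flip: sum.cartesian_product)
  finally show ?thesis .
qed

lemma finite_pareto [simp]: "finite (pareto s N)"
  by (simp add: pareto_def)

lemma card_pareto: "0 < s \<Longrightarrow> card (pareto s N :: 'k::real_normed_field set) = 2 * N"
  using pareto_sum[of s "\<lambda>_. 1" N, where 'k = 'k] by simp

lemma pareto_symmetric: "x \<in> pareto s N \<Longrightarrow> - x \<in> pareto s N"
  by (force simp: pareto_def)

text \<open>After the truncation of \<open>sum_powr_le_min\<close>, the expectation splits into one-dimensional sums; by
  \<open>sum_min_powr_le\<close> the \<open>i\<close>-th of them is at most a constant times \<open>\<bar>a i\<bar>\<^sup>s\<close>.\<close>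

lemma pareto_upper:
  fixes a :: "nat \<Rightarrow> 'k::real_normed_field"
  assumes t: "0 < t" "t < s" and s: "s < 2" and N: "0 < N" and a: "(\<Sum>i<n. norm (a i) powr s) = 1"
  shows "lmean t (PiE {..<n} (\<lambda>_. pareto s N)) (\<lambda>\<theta>. lpn 2 {..<n} (\<lambda>i. \<theta> i * a i)) powr t
    \<le> 2 + 1 / (1 - t / s) + 1 / (2 / s - 1)"
proof -
  let ?D = "pareto s N :: 'k set"
  let ?\<Omega> = "PiE {..<n} (\<lambda>_. ?D)"
  define L where "L = 1 / (1 - t / s) + (1 + 1 / (2 / s - 1))"
  have card\<Omega>: "real (card ?\<Omega>) = real (card ?D) ^ n" by (simp add: card_PiE)
  have cD: "real (card ?D) = 2 * real N" using t by (simp add: card_pareto)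
  have marg: "(\<Sum>\<theta>\<in>?\<Omega>. min (norm (\<theta> i * a i) powr 2) ((norm (\<theta> i * a i) powr 2) powr (t/2)))
      \<le> real (card ?D) ^ n * (L * norm (a i) powr s)" if i: "i < n" for i
  proof -
    define x where "x = real N * norm (a i) powr s"
    have "(\<Sum>y\<in>?D. min ((norm y * norm (a i)) powr 2) (((norm y * norm (a i)) powr 2) powr (t/2)))
        = 2 * (\<Sum>w=1..N. min (((real N / real w) powr (1 / s) * norm (a i)) powr 2)
                              ((((real N / real w) powr (1 / s) * norm (a i)) powr 2) powr (t/2)))"
      using t by (subst pareto_sum[where h = "\<lambda>z. min ((z * norm (a i)) powr 2) (((z * norm (a i)) powr 2) powr (t/2))"]) auto
    also have "\<dots> = 2 * (\<Sum>w=1..N. min ((x / real w) powr (2 / s)) ((x / real w) powr (t / s)))"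
    proof -
      have e: "((real N / real w) powr (1 / s) * norm (a i)) = (x / real w) powr (1 / s)" for w
        using t by (simp add: x_def powr_mult powr_divide powr_powr)
      show ?thesis unfolding e by (simp add: powr_powr)
    qed
    also have "\<dots> \<le> 2 * (x * L)"
      unfolding L_def using t s by (intro mult_left_mono sum_min_powr_le) (auto simp: x_def)
    finally have one: "(\<Sum>y\<in>?D. min ((norm y * norm (a i)) powr 2) (((norm y * norm (a i)) powr 2) powr (t/2))) \<le> 2 * (x * L)" .
    have "(\<Sum>\<theta>\<in>?\<Omega>. min (norm (\<theta> i * a i) powr 2) ((norm (\<theta> i * a i) powr 2) powr (t/2))) * card ?D
        = real (card ?D) ^ n * (\<Sum>y\<in>?D. min ((norm y * norm (a i)) powr 2) (((norm y * norm (a i)) powr 2) powr (t/2)))"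
      using sum_PiE_marginal[of ?D i n "\<lambda>y. min ((norm y * norm (a i)) powr 2) (((norm y * norm (a i)) powr 2) powr (t/2))"] i
      by (simp add: norm_mult)
    also have "\<dots> \<le> real (card ?D) ^ n * (2 * (x * L))"
      using one by (intro mult_left_mono) auto
    finally have "(\<Sum>\<theta>\<in>?\<Omega>. min (norm (\<theta> i * a i) powr 2) ((norm (\<theta> i * a i) powr 2) powr (t/2))) * card ?D
        \<le> (real (card ?D) ^ n * (L * norm (a i) powr s)) * card ?D"
      by (simp add: cD x_def mult_ac)
    then show ?thesis by (rule mult_right_le_imp_le) (use cD N in simp)
  qed
  have "lmean t ?\<Omega> (\<lambda>\<theta>. lpn 2 {..<n} (\<lambda>i. \<theta> i * a i)) powr t
      = (\<Sum>\<theta>\<in>?\<Omega>. (\<Sum>i<n. norm (\<theta> i * a i) powr 2) powr (t/2)) / card ?\<Omega>"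
    using t by (simp add: lmean_powr lpn_def powr_powr sum_nonneg)
  also have "\<dots> \<le> (\<Sum>\<theta>\<in>?\<Omega>. 1 + (\<Sum>i<n. min (norm (\<theta> i * a i) powr 2) ((norm (\<theta> i * a i) powr 2) powr (t/2)))) / card ?\<Omega>"
    using t s by (intro divide_right_mono sum_mono sum_powr_le_min) auto
  also have "\<dots> \<le> (card ?\<Omega> + (\<Sum>i<n. real (card ?D) ^ n * (L * norm (a i) powr s))) / card ?\<Omega>"
    using marg by (intro divide_right_mono)
      (auto simp: sum.distrib sum.swap[of _ _ ?\<Omega>] intro!: sum_mono)
  also have "\<dots> = 1 + L"
    using N a cD by (simp add: card\<Omega> add_divide_distrib flip: sum_distrib_left)
  finally show ?thesis by (simp add: L_def)
qed

text \<open>A single coordinate is already large with positive probability: \<open>\<bar>\<theta> i * a i\<bar> \<ge> 1\<close> has probability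
  about \<open>\<bar>a i\<bar>\<^sup>s\<close>, these events are independent, and the probabilities sum to about 1. The distribution is cut off at
  \<open>N\<close>, so coordinates with \<open>\<bar>a i\<bar>\<^sup>s < 1 / N\<close> are lost; they carry at most half of the total mass when \<open>2 * n \<le> N\<close>.\<close>

lemma pareto_lower:
  fixes a :: "nat \<Rightarrow> 'k::real_normed_field"
  assumes t: "0 < t" and s: "0 < s" and N: "2 * n \<le> N" "0 < N" and a: "(\<Sum>i<n. norm (a i) powr s) = 1"
  shows "1 - exp (-1/4) \<le> lmean t (PiE {..<n} (\<lambda>_. pareto s N)) (\<lambda>\<theta>. lpn 2 {..<n} (\<lambda>i. \<theta> i * a i)) powr t"
proof -
  let ?D = "pareto s N :: 'k set"
  let ?\<Omega> = "PiE {..<n} (\<lambda>_. ?D)"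
  define \<beta> where "\<beta> i = norm (a i) powr s" for i
  define E where "E i = {x \<in> ?D. norm (x * a i) < 1}" for i
  define d where "d = 2 * real N"
  have d: "0 < d" using N by (simp add: d_def)
  have cD: "real (card ?D) = d" using s by (simp add: card_pareto d_def)
  have card\<Omega>: "real (card ?\<Omega>) = d ^ n" by (simp add: card_PiE cD)
  have cardE: "real (card (E i)) \<le> d * exp (- (\<beta> i / 2 - 1 / (4 * n)))" if i: "i < n" for i
  proof -
    have \<beta>: "0 \<le> \<beta> i" "\<beta> i \<le> 1"
      using member_le_sum[of i "{..<n}" "\<lambda>i. norm (a i) powr s"] a i by (auto simp: \<beta>_def)
    have "?D - E i = {x \<in> ?D. norm x * norm (a i) \<ge> 1}"
      by (auto simp: E_def norm_mult)
    then have "real (card (?D - E i)) = (\<Sum>x\<in>?D. if norm x * norm (a i) \<ge> 1 then 1 else 0)"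
      by (simp add: sum.If_cases Int_def)
    also have "\<dots> = 2 * (\<Sum>w=1..N. if (real N / real w) powr (1/s) * norm (a i) \<ge> 1 then 1 else 0)"
      using s by (subst pareto_sum[where h = "\<lambda>z. if z * norm (a i) \<ge> 1 then 1 else 0"]) auto
    also have "\<dots> = 2 * real (card {w \<in> {1..N}. (real N / real w) powr (1/s) * norm (a i) \<ge> 1})"
      by (simp add: sum.If_cases Int_def)
    finally have cardD: "real (card (?D - E i)) = 2 * real (card {w \<in> {1..N}. (real N / real w) powr (1/s) * norm (a i) \<ge> 1})" .
    have "real (card {1..nat \<lfloor>\<beta> i * N\<rfloor>}) \<le> real (card {w \<in> {1..N}. (real N / real w) powr (1/s) * norm (a i) \<ge> 1})"
    proof -
      have "{1..nat \<lfloor>\<beta> i * N\<rfloor>} \<subseteq> {w \<in> {1..N}. (real N / real w) powr (1/s) * norm (a i) \<ge> 1}"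
      proof safe
        fix w assume "w \<in> {1..nat \<lfloor>\<beta> i * N\<rfloor>}"
        then have "1 \<le> w" "real w \<le> real (nat \<lfloor>\<beta> i * N\<rfloor>)" by simp_all
        moreover have "real (nat \<lfloor>\<beta> i * N\<rfloor>) \<le> \<beta> i * N" using \<beta> by (intro of_nat_floor) auto
        ultimately have w: "1 \<le> w" "real w \<le> \<beta> i * N" by linarith+
        have "\<beta> i * real N \<le> 1 * real N" using \<beta> by (intro mult_right_mono) auto
        then have "real w \<le> real N" using w by linarith
        then show "w \<in> {1..N}" using w(1) by simp
        have "1 powr (1/s) \<le> (\<beta> i * N / w) powr (1/s)"
          using w s by (intro powr_mono2) auto
        also have "\<dots> = (real N / real w) powr (1/s) * norm (a i)"
          using s by (simp add: \<beta>_def powr_mult powr_divide powr_powr)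
        finally show "1 \<le> (real N / real w) powr (1/s) * norm (a i)" by simp
      qed
      then show ?thesis by (intro of_nat_mono card_mono) auto
    qed
    then have 1: "2 * real (nat \<lfloor>\<beta> i * N\<rfloor>) \<le> real (card (?D - E i))" unfolding cardD by simp
    have 2: "d * (\<beta> i / 2 - 1 / (4 * n)) \<le> 2 * real (nat \<lfloor>\<beta> i * N\<rfloor>)"
    proof -
      (* Rounding down costs at most half of a number that is at least 1; the subtracted 1/2 covers smaller ones. *)
      have "\<beta> i * N / 2 - 1 / 2 \<le> real (nat \<lfloor>\<beta> i * N\<rfloor>)"
      proof (cases "\<beta> i * N < 1")
        case True
        then show ?thesis by simp
      next
        case False
        then have "real (nat \<lfloor>\<beta> i * N\<rfloor>) = of_int \<lfloor>\<beta> i * N\<rfloor>" by (intro of_nat_nat) linarith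
        then show ?thesis using False floor_correct[of "\<beta> i * N"] by linarith
      qed
      moreover have "1 \<le> real N / (2 * n)" using N(1) i by (simp add: divide_simps flip: of_nat_mult)
      moreover have "d * (\<beta> i / 2 - 1 / (4 * n)) = \<beta> i * N - real N / (2 * n)"
        by (simp add: d_def right_diff_distrib)
      ultimately show ?thesis by linarith
    qed
    have "real (card (E i)) = d - real (card (?D - E i))"
    proof -
      have sub: "E i \<subseteq> ?D" by (auto simp: E_def)
      then have "card (?D - E i) = card ?D - card (E i)" "card (E i) \<le> card ?D"
        using finite_subset[OF sub] by (auto intro!: card_Diff_subset card_mono)
      then show ?thesis using cD by linarith
    qed
    also have "\<dots> \<le> d * (1 + (- (\<beta> i / 2 - 1 / (4 * n))))"
      using 1 2 by (simp add: algebra_simps)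
    also have "\<dots> \<le> d * exp (- (\<beta> i / 2 - 1 / (4 * n)))"
      using d by (intro mult_left_mono exp_ge_add_one_self) auto
    finally show ?thesis .
  qed
  have n: "0 < n" using a by (cases n) auto
  have "real (card (PiE {..<n} E)) = (\<Prod>i<n. real (card (E i)))"
    by (simp add: card_PiE)
  also have "\<dots> \<le> (\<Prod>i<n. d * exp (- (\<beta> i / 2 - 1 / (4 * n))))"
    using cardE by (intro prod_mono) auto
  also have "\<dots> = d ^ n * exp (\<Sum>i<n. - (\<beta> i / 2 - 1 / (4 * n)))"
    by (simp add: prod.distrib exp_sum)
  also have "(\<Sum>i<n. - (\<beta> i / 2 - 1 / (4 * n))) = - 1 / 4"
    using a n by (simp add: sum_subtractf \<beta>_def flip: sum_divide_distrib)
  finally have few: "real (card (PiE {..<n} E)) \<le> d ^ n * exp (-1/4)" by simp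
  have sub: "PiE {..<n} E \<subseteq> ?\<Omega>" by (intro PiE_mono) (auto simp: E_def)
  have "(1 - exp (-1/4)) * d ^ n \<le> real (card ?\<Omega>) - real (card (PiE {..<n} E))"
    using few unfolding card\<Omega> mult.commute[of _ "d ^ n"] right_diff_distrib by linarith
  also have "\<dots> = real (card (?\<Omega> - PiE {..<n} E))"
  proof -
    have fin: "finite ?\<Omega>" by (simp add: finite_PiE)
    show ?thesis
      using card_Diff_subset[OF finite_subset[OF sub fin] sub] card_mono[OF fin sub] by linarith
  qed
  also have "\<dots> = (\<Sum>\<theta>\<in>?\<Omega> - PiE {..<n} E. 1)" by simp
  also have "\<dots> \<le> (\<Sum>\<theta>\<in>?\<Omega> - PiE {..<n} E. lpn 2 {..<n} (\<lambda>i. \<theta> i * a i) powr t)"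
  proof (rule sum_mono)
    fix \<theta> assume \<theta>: "\<theta> \<in> ?\<Omega> - PiE {..<n} E"
    then obtain i where i: "i < n" "\<theta> i \<notin> E i" "\<theta> i \<in> ?D" by (auto simp: PiE_iff)
    then have "1 \<le> norm (\<theta> i * a i)" by (simp add: E_def)
    also have "\<dots> \<le> lpn 2 {..<n} (\<lambda>i. \<theta> i * a i)" using i by (intro le_lpn) auto
    finally show "1 \<le> lpn 2 {..<n} (\<lambda>i. \<theta> i * a i) powr t"
      using t by (intro ge_one_powr_ge_zero) auto
  qed
  also have "\<dots> \<le> (\<Sum>\<theta>\<in>?\<Omega>. lpn 2 {..<n} (\<lambda>i. \<theta> i * a i) powr t)"
    by (intro sum_mono2) (auto simp: finite_PiE)
  also have "\<dots> = lmean t ?\<Omega> (\<lambda>\<theta>. lpn 2 {..<n} (\<lambda>i. \<theta> i * a i)) powr t * d ^ n"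
    using t d by (simp add: lmean_powr card\<Omega>)
  finally show ?thesis using d by simp
qed

section \<open>Symmetric product variables\<close>

lemma bij_betw_flip:
  fixes D :: "'k::real_normed_field set"
  assumes "\<sigma> \<in> signs n" "\<And>x. x \<in> D \<Longrightarrow> - x \<in> D"
  shows "bij_betw (\<lambda>\<theta>. \<lambda>i\<in>{..<n}. \<sigma> i * \<theta> i) (PiE {..<n} (\<lambda>_. D)) (PiE {..<n} (\<lambda>_. D))"
proof (rule bij_betw_PiE)
  fix i assume "i \<in> {..<n}"
  then have "\<sigma> i \<in> {1, -1}" using assms(1) by (auto simp: signs_def PiE_iff)
  then show "bij_betw ((*) (\<sigma> i)) D D"
    using assms(2) by (intro bij_betw_byWitness[where f' = "(*) (\<sigma> i)"]) auto
qed

text \<open>Random signs do not change the distribution of a symmetric vector, so Khintchine's inequality can be applied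
  conditionally on the moduli.\<close>

lemma symmetric_khintchine:
  assumes q: "0 < q"
  obtains c C where "0 < c" "0 < C"
    "\<And>n D (a :: nat \<Rightarrow> 'k::real_or_complex). (\<And>x. x \<in> D \<Longrightarrow> - x \<in> D) \<Longrightarrow>
        c * lmean q (PiE {..<n} (\<lambda>_. D)) (\<lambda>\<theta>. lpn 2 {..<n} (\<lambda>i. \<theta> i * a i))
        \<le> lmean q (PiE {..<n} (\<lambda>_. D)) (\<lambda>\<theta>. \<Sum>i<n. \<theta> i * a i)"
    "\<And>n D (a :: nat \<Rightarrow> 'k). (\<And>x. x \<in> D \<Longrightarrow> - x \<in> D) \<Longrightarrow>
        lmean q (PiE {..<n} (\<lambda>_. D)) (\<lambda>\<theta>. \<Sum>i<n. \<theta> i * a i)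
        \<le> C * lmean q (PiE {..<n} (\<lambda>_. D)) (\<lambda>\<theta>. lpn 2 {..<n} (\<lambda>i. \<theta> i * a i))"
proof -
  obtain c C where cC: "0 < c" "0 < C"
    "\<And>n (a :: nat \<Rightarrow> 'k). c * lpn 2 {..<n} a \<le> lmean q (signs n) (\<lambda>\<epsilon>. \<Sum>i<n. \<epsilon> i * a i)"
    "\<And>n (a :: nat \<Rightarrow> 'k). lmean q (signs n) (\<lambda>\<epsilon>. \<Sum>i<n. \<epsilon> i * a i) \<le> C * lpn 2 {..<n} a"
    by (rule khintchine[OF q, where 'k = 'k]) blast
  have avg: "lmean q (PiE {..<n} (\<lambda>_. D)) (\<lambda>\<theta>. \<Sum>i<n. \<theta> i * a i)
      = lmean q (PiE {..<n} (\<lambda>_. D)) (\<lambda>\<theta>. lmean q (signs n) (\<lambda>\<sigma>. \<Sum>i<n. \<sigma> i * (\<theta> i * a i)))"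
    if D: "\<And>x. x \<in> D \<Longrightarrow> - x \<in> D" for n D and a :: "nat \<Rightarrow> 'k"
    by (subst lmean_average[OF q finite_signs signs_nonempty bij_betw_flip[OF _ D]])
       (simp_all add: mult.assoc)
  show thesis
  proof (rule that[OF cC(1,2)])
    fix n and D :: "'k set" and a :: "nat \<Rightarrow> 'k"
    assume D: "\<And>x. x \<in> D \<Longrightarrow> - x \<in> D"
    have "c * lmean q (PiE {..<n} (\<lambda>_. D)) (\<lambda>\<theta>. lpn 2 {..<n} (\<lambda>i. \<theta> i * a i))
        = lmean q (PiE {..<n} (\<lambda>_. D)) (\<lambda>\<theta>. c * lpn 2 {..<n} (\<lambda>i. \<theta> i * a i))"
      using q cC(1) by (intro lmean_scale[symmetric]) (auto simp: abs_mult)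
    also have "\<dots> \<le> lmean q (PiE {..<n} (\<lambda>_. D)) (\<lambda>\<theta>. lmean q (signs n) (\<lambda>\<sigma>. \<Sum>i<n. \<sigma> i * (\<theta> i * a i)))"
      using q cC by (intro lmean_mono) (auto simp: abs_mult)
    finally show "c * lmean q (PiE {..<n} (\<lambda>_. D)) (\<lambda>\<theta>. lpn 2 {..<n} (\<lambda>i. \<theta> i * a i))
        \<le> lmean q (PiE {..<n} (\<lambda>_. D)) (\<lambda>\<theta>. \<Sum>i<n. \<theta> i * a i)"
      by (simp add: avg[OF D])
    show "lmean q (PiE {..<n} (\<lambda>_. D)) (\<lambda>\<theta>. \<Sum>i<n. \<theta> i * a i)
        \<le> C * lmean q (PiE {..<n} (\<lambda>_. D)) (\<lambda>\<theta>. lpn 2 {..<n} (\<lambda>i. \<theta> i * a i))"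
      by (subst avg[OF D]) (use q cC in \<open>auto intro!: lmean_scale_le\<close>)
  qed
qed

text \<open>The size \<open>2 * n + 1\<close> meets both requirements of \<open>pareto_norm\<close>, also for \<open>n = 0\<close>. For \<open>s = 2\<close> signs do what
  Gaussian variables would do, with all moments finite.\<close>

definition stable_set :: "real \<Rightarrow> nat \<Rightarrow> 'k::real_normed_field set"
  where "stable_set s n = (if s = 2 then {1, -1} else pareto s (2 * n + 1))"

lemma stable_set_symmetric: "x \<in> stable_set s n \<Longrightarrow> - x \<in> stable_set s n"
  by (auto simp: stable_set_def pareto_symmetric split: if_splits)

lemma finite_stable_set [simp]: "finite (stable_set s n)"
  by (simp add: stable_set_def)

lemma stable_set_nonempty: "0 < s \<Longrightarrow> (stable_set s n :: 'k::real_normed_field set) \<noteq> {}"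
  using card_pareto[of s "2 * n + 1", where 'k = 'k] by (auto simp: stable_set_def)

definition stable_vectors :: "real \<Rightarrow> nat \<Rightarrow> (nat \<Rightarrow> 'k::real_normed_field) set"
  where "stable_vectors s n = PiE {..<n} (\<lambda>_. stable_set s n)"

lemma finite_stable_vectors [simp]: "finite (stable_vectors s n)"
  by (simp add: stable_vectors_def finite_PiE)

lemma stable_vectors_nonempty: "0 < s \<Longrightarrow> stable_vectors s n \<noteq> {}"
  by (simp add: stable_vectors_def PiE_eq_empty_iff stable_set_nonempty)

lemma pareto_norm:
  assumes t: "0 < t" "t < s" and s: "s < 2"
  obtains c C where "0 < c" "0 < C"
    "\<And>n N (a :: nat \<Rightarrow> 'k::real_normed_field). 2 * n \<le> N \<Longrightarrow> 0 < N \<Longrightarrow>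
        c * lpn s {..<n} a \<le> lmean t (PiE {..<n} (\<lambda>_. pareto s N)) (\<lambda>\<theta>. lpn 2 {..<n} (\<lambda>i. \<theta> i * a i))"
    "\<And>n N (a :: nat \<Rightarrow> 'k). 2 * n \<le> N \<Longrightarrow> 0 < N \<Longrightarrow>
        lmean t (PiE {..<n} (\<lambda>_. pareto s N)) (\<lambda>\<theta>. lpn 2 {..<n} (\<lambda>i. \<theta> i * a i)) \<le> C * lpn s {..<n} a"
proof -
  define L where "L = 2 + 1 / (1 - t / s) + 1 / (2 / s - 1)"
  have L: "0 < L" unfolding L_def using t s by (intro add_pos_pos) (auto simp: field_simps)
  define l where "l = 1 - exp (-1/4 :: real)"
  have l: "0 < l" by (simp add: l_def)
  have "l powr (1/t) * lpn s {..<n} a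
          \<le> lmean t (PiE {..<n} (\<lambda>_. pareto s N)) (\<lambda>\<theta>. lpn 2 {..<n} (\<lambda>i. \<theta> i * a i)) \<and>
        lmean t (PiE {..<n} (\<lambda>_. pareto s N)) (\<lambda>\<theta>. lpn 2 {..<n} (\<lambda>i. \<theta> i * a i))
          \<le> L powr (1/t) * lpn s {..<n} a"
    if N: "2 * n \<le> N" "0 < N" for n N and a :: "nat \<Rightarrow> 'k"
  proof (cases "lpn s {..<n} a = 0")
    case True
    then have "a i = 0" if "i < n" for i using lpn_eq_0D[of s "{..<n}" a i] that t by simp
    then have "lmean t (PiE {..<n} (\<lambda>_. pareto s N)) (\<lambda>\<theta>. lpn 2 {..<n} (\<lambda>i. \<theta> i * a i)) = 0"
      using t by (simp add: lmean_def lpn_def)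
    then show ?thesis using True by simp
  next
    case False
    define B where "B = lpn s {..<n} a"
    have B: "0 < B" using False by (simp add: B_def less_le)
    define a' where "a' i = a i / of_real B" for i
    define X where "X = lmean t (PiE {..<n} (\<lambda>_. pareto s N)) (\<lambda>\<theta>. lpn 2 {..<n} (\<lambda>i. \<theta> i * a' i))"
    have "(\<Sum>i<n. norm (a i) powr s) = B powr s"
      using lpn_powr[of s "{..<n}" a] t by (simp add: B_def)
    then have a': "(\<Sum>i<n. norm (a' i) powr s) = 1"
      using B by (simp add: a'_def norm_divide powr_divide flip: sum_divide_distrib)
    have "lpn 2 {..<n} (\<lambda>i. \<theta> i * a i) = B * lpn 2 {..<n} (\<lambda>i. \<theta> i * a' i)" for \<theta>
      using B by (intro lpn_scale) (auto simp: a'_def norm_mult norm_divide)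
    then have scale: "lmean t (PiE {..<n} (\<lambda>_. pareto s N)) (\<lambda>\<theta>. lpn 2 {..<n} (\<lambda>i. \<theta> i * a i)) = B * X"
      unfolding X_def using B t by (intro lmean_scale) (auto simp: abs_mult)
    have "X powr t \<le> (L powr (1/t)) powr t"
      using pareto_upper[OF t s N(2) a'] L t by (simp add: X_def L_def powr_powr)
    then have "X \<le> L powr (1/t)" by (rule le_of_powr_le[rotated 2]) (use t in auto)
    moreover have "(l powr (1/t)) powr t \<le> X powr t"
      using pareto_lower[OF t(1) _ N a'] l t by (simp add: X_def l_def powr_powr)
    then have "l powr (1/t) \<le> X" by (rule le_of_powr_le[rotated 2]) (use t in \<open>auto simp: X_def\<close>)
    ultimately show ?thesis
      unfolding scale B_def[symmetric] using B by (auto simp: mult.commute)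
  qed
  then show thesis using L l by (intro that[of "l powr (1/t)" "L powr (1/t)"]) auto
qed

text \<open>Linear forms in these random vectors realize the \<open>\<ell>\<^sub>s\<close> norm of the coefficients in \<open>L\<^sub>t\<close>. It is used
  twice: for the random vectors that test whether a map is summing, and to embed \<open>\<ell>\<^sub>q\<close> into
  \<open>\<ell>\<^sub>p\<close> for \<open>p < q \<le> 2\<close>.\<close>

theorem stable_vectors_norm:
  assumes t: "0 < t" and s: "0 < s" "s \<le> 2" "s = 2 \<or> t < s"
  obtains c C where "0 < c" "0 < C"
    "\<And>n (a :: nat \<Rightarrow> 'k::real_or_complex). c * lpn s {..<n} a \<le> lmean t (stable_vectors s n) (\<lambda>\<theta>. \<Sum>i<n. \<theta> i * a i)"
    "\<And>n (a :: nat \<Rightarrow> 'k). lmean t (stable_vectors s n) (\<lambda>\<theta>. \<Sum>i<n. \<theta> i * a i) \<le> C * lpn s {..<n} a"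
proof (cases "s = 2")
  case True
  have sv: "stable_vectors s n = (signs n :: (nat \<Rightarrow> 'k) set)" for n
    by (simp add: True stable_vectors_def stable_set_def signs_def)
  obtain c C where "0 < c" "0 < C"
    "\<And>n (a :: nat \<Rightarrow> 'k). c * lpn 2 {..<n} a \<le> lmean t (signs n) (\<lambda>\<epsilon>. \<Sum>i<n. \<epsilon> i * a i)"
    "\<And>n (a :: nat \<Rightarrow> 'k). lmean t (signs n) (\<lambda>\<epsilon>. \<Sum>i<n. \<epsilon> i * a i) \<le> C * lpn 2 {..<n} a"
    by (rule khintchine[OF t, where 'k = 'k]) blast
  then show thesis unfolding sv[symmetric] True[symmetric] by (rule that)
next
  case False
  then have st: "t < s" "s < 2" using s by auto
  obtain c C where 1: "0 < c" "0 < C"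
    "\<And>n D (a :: nat \<Rightarrow> 'k). (\<And>x. x \<in> D \<Longrightarrow> - x \<in> D) \<Longrightarrow>
        c * lmean t (PiE {..<n} (\<lambda>_. D)) (\<lambda>\<theta>. lpn 2 {..<n} (\<lambda>i. \<theta> i * a i))
        \<le> lmean t (PiE {..<n} (\<lambda>_. D)) (\<lambda>\<theta>. \<Sum>i<n. \<theta> i * a i)"
    "\<And>n D (a :: nat \<Rightarrow> 'k). (\<And>x. x \<in> D \<Longrightarrow> - x \<in> D) \<Longrightarrow>
        lmean t (PiE {..<n} (\<lambda>_. D)) (\<lambda>\<theta>. \<Sum>i<n. \<theta> i * a i)
        \<le> C * lmean t (PiE {..<n} (\<lambda>_. D)) (\<lambda>\<theta>. lpn 2 {..<n} (\<lambda>i. \<theta> i * a i))"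
    by (rule symmetric_khintchine[OF t, where 'k = 'k]) blast
  obtain c' C' where 2: "0 < c'" "0 < C'"
    "\<And>n N (a :: nat \<Rightarrow> 'k). 2 * n \<le> N \<Longrightarrow> 0 < N \<Longrightarrow>
        c' * lpn s {..<n} a \<le> lmean t (PiE {..<n} (\<lambda>_. pareto s N)) (\<lambda>\<theta>. lpn 2 {..<n} (\<lambda>i. \<theta> i * a i))"
    "\<And>n N (a :: nat \<Rightarrow> 'k). 2 * n \<le> N \<Longrightarrow> 0 < N \<Longrightarrow>
        lmean t (PiE {..<n} (\<lambda>_. pareto s N)) (\<lambda>\<theta>. lpn 2 {..<n} (\<lambda>i. \<theta> i * a i)) \<le> C' * lpn s {..<n} a"
    by (rule pareto_norm[OF t st, where 'k = 'k]) blast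
  have sv: "stable_vectors s n = PiE {..<n} (\<lambda>_. pareto s (2 * n + 1) :: 'k set)" for n
    using False by (simp add: stable_vectors_def stable_set_def)
  show thesis
  proof (rule that[of "c * c'" "C * C'"])
    fix n and a :: "nat \<Rightarrow> 'k"
    have "c * (c' * lpn s {..<n} a)
       \<le> c * lmean t (stable_vectors s n) (\<lambda>\<theta>. lpn 2 {..<n} (\<lambda>i. \<theta> i * a i))"
      unfolding sv using 1(1) 2(3)[of n "2 * n + 1" a] by (intro mult_left_mono) auto
    also have "\<dots> \<le> lmean t (stable_vectors s n) (\<lambda>\<theta>. \<Sum>i<n. \<theta> i * a i)"
      unfolding sv using pareto_symmetric by (intro 1(3))
    finally show "c * c' * lpn s {..<n} a \<le> lmean t (stable_vectors s n) (\<lambda>\<theta>. \<Sum>i<n. \<theta> i * a i)"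
      by (simp add: mult.assoc)
    have "lmean t (stable_vectors s n) (\<lambda>\<theta>. \<Sum>i<n. \<theta> i * a i)
       \<le> C * lmean t (stable_vectors s n) (\<lambda>\<theta>. lpn 2 {..<n} (\<lambda>i. \<theta> i * a i))"
      unfolding sv using pareto_symmetric by (intro 1(4))
    also have "\<dots> \<le> C * (C' * lpn s {..<n} a)"
      unfolding sv using 1(2) 2(4)[of n "2 * n + 1" a] by (intro mult_left_mono) auto
    finally show "lmean t (stable_vectors s n) (\<lambda>\<theta>. \<Sum>i<n. \<theta> i * a i) \<le> C * C' * lpn s {..<n} a"
      by (simp add: mult.assoc)
  qed (use 1 2 in auto)
qed

lemma mform_flip:
  "mform m n b (\<lambda>k\<in>{..<m}. \<lambda>i\<in>{..<n k}. \<sigma> k i * \<theta> k i) = mform m n (\<lambda>i. (\<Prod>k<m. \<theta> k (i k)) * b i) \<sigma>"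
proof -
  have "mform m n b (\<lambda>k\<in>{..<m}. \<lambda>i\<in>{..<n k}. \<sigma> k i * \<theta> k i) = mform m n b (\<lambda>k i. \<sigma> k i * \<theta> k i)"
    by (rule mform_cong) simp
  then show ?thesis by (simp add: mform_def prod.distrib mult.assoc)
qed

text \<open>Symmetrization leaves, conditionally on \<open>\<theta>\<close>, a chaos in random signs with coefficients \<open>\<Prod>k<m. \<theta> k (i k)\<close>
  times \<open>b i\<close>. By \<open>khintchine_tensor\<close> its size is the \<open>\<ell>\<^sub>2\<close> norm of these coefficients, which multiplication by
  \<open>\<alpha>\<close> increases at most by the factor \<open>M\<close>.\<close>

theorem mform_unconditional:
  assumes q: "0 < q"
  obtains K where "0 < K"
    "\<And>n D M \<alpha> (b :: (nat \<Rightarrow> nat) \<Rightarrow> 'k::real_or_complex).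
        (\<And>k x. k < m \<Longrightarrow> x \<in> D k \<Longrightarrow> - x \<in> D k) \<Longrightarrow> 0 \<le> M \<Longrightarrow>
        (\<And>i. i \<in> PiE {..<m} (\<lambda>k. {..<n k}) \<Longrightarrow> norm (\<alpha> i) \<le> M) \<Longrightarrow>
        lmean q (PiE {..<m} (\<lambda>k. PiE {..<n k} (\<lambda>_. D k))) (mform m n (\<lambda>i. \<alpha> i * b i))
        \<le> K * M * lmean q (PiE {..<m} (\<lambda>k. PiE {..<n k} (\<lambda>_. D k))) (mform m n b)"
proof -
  obtain c C where cC: "0 < c" "0 < C"
    "\<And>n (b :: (nat \<Rightarrow> nat) \<Rightarrow> 'k). c * lpn 2 (PiE {..<m} (\<lambda>k. {..<n k})) b
        \<le> lmean q (PiE {..<m} (\<lambda>k. signs (n k))) (mform m n b)"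
    "\<And>n (b :: (nat \<Rightarrow> nat) \<Rightarrow> 'k). lmean q (PiE {..<m} (\<lambda>k. signs (n k))) (mform m n b)
        \<le> C * lpn 2 (PiE {..<m} (\<lambda>k. {..<n k})) b"
    by (rule khintchine_tensor[OF q, where 'k = 'k and m = m]) blast
  show thesis
  proof (rule that[of "C / c"])
    show "0 < C / c" using cC by simp
    fix n and D :: "nat \<Rightarrow> 'k set" and M and \<alpha> b :: "(nat \<Rightarrow> nat) \<Rightarrow> 'k"
    assume D: "\<And>k x. k < m \<Longrightarrow> x \<in> D k \<Longrightarrow> - x \<in> D k" and M: "0 \<le> M"
      and \<alpha>: "\<And>i. i \<in> PiE {..<m} (\<lambda>k. {..<n k}) \<Longrightarrow> norm (\<alpha> i) \<le> M"
    let ?S = "PiE {..<m} (\<lambda>k. signs (n k) :: (nat \<Rightarrow> 'k) set)"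
    let ?\<Theta> = "PiE {..<m} (\<lambda>k. PiE {..<n k} (\<lambda>_. D k))"
    let ?I = "PiE {..<m} (\<lambda>k. {..<n k})"
    have avg: "lmean q ?\<Theta> (mform m n b)
        = lmean q ?\<Theta> (\<lambda>\<theta>. lmean q ?S (mform m n (\<lambda>i. (\<Prod>k<m. \<theta> k (i k)) * b i)))"
      for b :: "(nat \<Rightarrow> nat) \<Rightarrow> 'k"
    proof (subst lmean_average[OF q, where S = ?S and h = "\<lambda>\<sigma> \<theta>. \<lambda>k\<in>{..<m}. \<lambda>i\<in>{..<n k}. \<sigma> k i * \<theta> k i"])
      fix \<sigma> assume "\<sigma> \<in> ?S"
      then show "bij_betw (\<lambda>\<theta>. \<lambda>k\<in>{..<m}. \<lambda>i\<in>{..<n k}. \<sigma> k i * \<theta> k i) ?\<Theta> ?\<Theta>"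
        using D by (intro bij_betw_PiE bij_betw_flip) auto
    qed (auto simp: mform_flip PiE_eq_empty_iff intro: finite_PiE)
    have "lmean q ?S (mform m n (\<lambda>i. (\<Prod>k<m. \<theta> k (i k)) * (\<alpha> i * b i)))
        \<le> C / c * M * lmean q ?S (mform m n (\<lambda>i. (\<Prod>k<m. \<theta> k (i k)) * b i))" for \<theta>
    proof -
      have "lmean q ?S (mform m n (\<lambda>i. (\<Prod>k<m. \<theta> k (i k)) * (\<alpha> i * b i)))
          \<le> C * lpn 2 ?I (\<lambda>i. (\<Prod>k<m. \<theta> k (i k)) * (\<alpha> i * b i))" by (rule cC)
      also have "\<dots> \<le> C * (M * lpn 2 ?I (\<lambda>i. (\<Prod>k<m. \<theta> k (i k)) * b i))"
      proof (intro mult_left_mono lpn_scale_le)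
        fix i assume "i \<in> ?I"
        then have "norm (\<alpha> i) * (norm (\<Prod>k<m. \<theta> k (i k)) * norm (b i))
            \<le> M * (norm (\<Prod>k<m. \<theta> k (i k)) * norm (b i))"
          using \<alpha> by (intro mult_right_mono) auto
        then show "norm ((\<Prod>k<m. \<theta> k (i k)) * (\<alpha> i * b i)) \<le> M * norm ((\<Prod>k<m. \<theta> k (i k)) * b i)"
          by (simp only: norm_mult mult_ac)
      qed (use cC M in auto)
      also have "\<dots> \<le> C * (M * (lmean q ?S (mform m n (\<lambda>i. (\<Prod>k<m. \<theta> k (i k)) * b i)) / c))"
        using cC M by (intro mult_left_mono) (auto simp: field_simps)
      finally show ?thesis by simp
    qed
    then show "lmean q ?\<Theta> (mform m n (\<lambda>i. \<alpha> i * b i)) \<le> C / c * M * lmean q ?\<Theta> (mform m n b)"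
      unfolding avg using q cC M by (intro lmean_scale_le) auto
  qed
qed

section \<open>Duality of sequence spaces\<close>

text \<open>The dual pairs \<open>(\<ell>\<^sub>r, \<ell>\<^sub>s)\<close> with \<open>1 \<le> s < \<infinity>\<close>. In the endpoint \<open>r = \<infinity>\<close> functionals need not come from sequences,
  but their values on unit vectors still form an element of the unit ball of \<open>\<ell>\<^sub>1\<close>.\<close>

definition conjugate :: "ennreal \<Rightarrow> real \<Rightarrow> bool"
  where "conjugate r s \<longleftrightarrow> (r = \<infinity> \<and> s = 1) \<or> (\<exists>\<rho>>1. r = ennreal \<rho> \<and> 1 < s \<and> 1 / \<rho> + 1 / s = 1)"

lemma conjugate_exponent:
  fixes r r' :: ennreal
  assumes r: "1 \<le> r" "1 / r + 1 / r' = 1" and r': "r' < 2"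
  obtains s where "r' = ennreal s" "0 < s" "s < 2" "conjugate r s"
proof -
  have "r' \<noteq> 0" using r by (auto simp: ennreal_divide_zero)
  define s where "s = enn2real r'"
  have "r' < top" using r' by (rule less_trans) simp
  then have rs: "r' = ennreal s" by (simp add: s_def)
  have s: "r' = ennreal s" "0 < s" "s < 2"
    using rs r' \<open>r' \<noteq> 0\<close> \<open>r' < top\<close> ennreal_less_iff[of s 2]
    by (auto simp: s_def enn2real_positive_iff zero_less_iff_neq_zero)
  have inv_s: "1 / r' = ennreal (1 / s)"
    using s divide_ennreal[of 1 s] by simp
  show thesis
  proof (cases r)
    case top
    then have "ennreal (1 / s) = ennreal 1" using r(2) inv_s by simp
    then have "1 / s = 1" using s by (subst (asm) ennreal_inj) auto
    then show thesis using s top by (intro that[of s]) (auto simp: conjugate_def)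
  next
    case (real \<rho>)
    then have \<rho>: "1 \<le> \<rho>" using r(1) by (simp flip: ennreal_1)
    have "1 / r = ennreal (1 / \<rho>)" using \<rho> real divide_ennreal[of 1 \<rho>] by simp
    then have "ennreal (1 / \<rho> + 1 / s) = ennreal 1" using r(2) inv_s s \<rho> by (simp add: ennreal_plus)
    then have e: "1 / \<rho> + 1 / s = 1" using s \<rho> by (subst (asm) ennreal_inj) auto
    have "0 < 1 / s" "0 < 1 / \<rho>" using s \<rho> by auto
    then have "1 / \<rho> < 1" "1 / s < 1" using e by linarith+
    then have "1 < \<rho>" "1 < s" using s \<rho> by (simp_all add: field_simps)
    then show thesis using s real e by (intro that[of s]) (auto simp: conjugate_def)
  qed
qed

lemma conjugate_2: "conjugate 2 2"
  unfolding conjugate_def by (intro disjI2 exI[of _ 2]) auto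

lemma lpn_Holder:
  fixes a y :: "'i \<Rightarrow> 'k::real_normed_field"
  assumes \<rho>: "1 < \<rho>" "1 < s" "1 / \<rho> + 1 / s = 1" and A: "finite A"
  shows "(\<Sum>i\<in>A. norm (a i * y i)) \<le> lpn s A a * lpn \<rho> A y"
proof (cases "lpn s A a = 0 \<or> lpn \<rho> A y = 0")
  case True
  then have "a i * y i = 0" if "i \<in> A" for i
    using lpn_eq_0D[of s A a i] lpn_eq_0D[of \<rho> A y i] \<rho> A that by auto
  then have "(\<Sum>i\<in>A. norm (a i * y i)) = 0" by (intro sum.neutral) auto
  then show ?thesis using True by auto
next
  case False
  define P Q where "P = lpn s A a" and "Q = lpn \<rho> A y"
  have PQ: "0 < P" "0 < Q" using False by (simp_all add: P_def Q_def less_le)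
  have P1: "(\<Sum>i\<in>A. (norm (a i) / P) powr s) = 1"
  proof -
    have "(\<Sum>i\<in>A. (norm (a i) / P) powr s) = (\<Sum>i\<in>A. norm (a i) powr s) / P powr s"
      by (simp add: powr_divide sum_divide_distrib)
    also have "\<dots> = 1" using \<rho> PQ by (subst lpn_powr[symmetric]) (auto simp: P_def)
    finally show ?thesis .
  qed
  have Q1: "(\<Sum>i\<in>A. (norm (y i) / Q) powr \<rho>) = 1"
  proof -
    have "(\<Sum>i\<in>A. (norm (y i) / Q) powr \<rho>) = (\<Sum>i\<in>A. norm (y i) powr \<rho>) / Q powr \<rho>"
      by (simp add: powr_divide sum_divide_distrib)
    also have "\<dots> = 1" using \<rho> PQ by (subst lpn_powr[symmetric]) (auto simp: Q_def)
    finally show ?thesis .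
  qed
  have "(\<Sum>i\<in>A. norm (a i * y i)) / (P * Q) = (\<Sum>i\<in>A. (norm (a i) / P) * (norm (y i) / Q))"
    by (simp add: sum_divide_distrib norm_mult)
  also have "\<dots> \<le> (\<Sum>i\<in>A. (norm (a i) / P) powr s / s + (norm (y i) / Q) powr \<rho> / \<rho>)"
    using \<rho> PQ by (intro sum_mono Youngs_inequality) auto
  also have "\<dots> = 1" using \<rho> by (simp add: sum.distrib P1 Q1 flip: sum_divide_distrib)
  finally show ?thesis using PQ by (simp add: P_def Q_def divide_le_eq)
qed

lemma lnorm_bound:
  fixes a :: "nat \<Rightarrow> 'k::real_or_complex"
  assumes c: "conjugate r s" and y: "y \<in> lspace r"
  shows "norm (\<Sum>i<n. y i * a i) \<le> lpn s {..<n} a * lnorm r y"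
proof -
  have "norm (\<Sum>i<n. y i * a i) \<le> (\<Sum>i<n. norm (a i * y i))"
    by (rule order_trans[OF norm_sum]) (simp add: mult.commute)
  also have "\<dots> \<le> lpn s {..<n} a * lnorm r y"
    using c unfolding conjugate_def
  proof (elim disjE exE conjE)
    assume r: "r = \<infinity>" and s: "s = 1"
    have "bdd_above (range (\<lambda>i. norm (y i)))"
      using y r by (simp add: lspace_def bdd_above_norm flip: image_image)
    then have "norm (y i) \<le> lnorm r y" for i
      unfolding lnorm_def r by (auto intro: cSUP_upper)
    then have "(\<Sum>i<n. norm (a i * y i)) \<le> (\<Sum>i<n. norm (a i) * lnorm r y)"
      by (auto intro!: sum_mono mult_left_mono simp: norm_mult)
    also have "\<dots> = lpn s {..<n} a * lnorm r y"
      by (simp add: s lpn_def sum_nonneg flip: sum_distrib_right)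
    finally show ?thesis .
  next
    fix \<rho> assume \<rho>: "1 < \<rho>" "r = ennreal \<rho>" "1 < s" "1 / \<rho> + 1 / s = 1"
    have "lpn \<rho> {..<n} y \<le> lnorm r y"
      using y \<rho> unfolding lpn_def lnorm_def lspace_def
      by (auto intro!: powr_mono2 sum_le_suminf sum_nonneg)
    then have "lpn s {..<n} a * lpn \<rho> {..<n} y \<le> lpn s {..<n} a * lnorm r y"
      by (intro mult_left_mono) auto
    then show ?thesis using lpn_Holder[OF \<rho>(1,3,4), of "{..<n}" a y] by simp
  qed
  finally show ?thesis .
qed

definition pad :: "nat \<Rightarrow> (nat \<Rightarrow> 'k::zero) \<Rightarrow> nat \<Rightarrow> 'k"
  where "pad n \<theta> i = (if i < n then \<theta> i else 0)"

lemma pad_in_lspace: "pad n \<theta> \<in> lspace r"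
proof (cases "r = \<infinity>")
  case True
  have "range (pad n \<theta>) \<subseteq> insert 0 (\<theta> ` {..<n})" by (auto simp: pad_def)
  then have "bounded (range (pad n \<theta>))" by (auto intro: finite_imp_bounded finite_subset)
  then show ?thesis using True by (simp add: lspace_def)
next
  case False
  have "summable (\<lambda>i. norm (pad n \<theta> i) powr enn2real r)"
    by (rule summable_finite[of "{..<n}"]) (auto simp: pad_def)
  then show ?thesis using False by (simp add: lspace_def)
qed

definition unit_seq :: "nat \<Rightarrow> nat \<Rightarrow> 'k::zero_neq_one"
  where "unit_seq j i = (if i = j then 1 else 0)"

lemma linear_pad:
  fixes \<gamma> :: "(nat \<Rightarrow> 'k::real_or_complex) \<Rightarrow> 'k"
  assumes "linear_on seq_scale (lspace r) (*) \<gamma>"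
  shows "\<gamma> (pad n \<theta>) = (\<Sum>i<n. \<theta> i * \<gamma> (unit_seq i))"
proof (induction n)
  case 0
  have "(pad 0 \<theta> :: nat \<Rightarrow> 'k) \<in> lspace r" by (rule pad_in_lspace)
  then have "\<gamma> (seq_scale 0 (pad 0 \<theta>)) = 0 * \<gamma> (pad 0 \<theta>)"
    using assms unfolding linear_on_def by blast
  moreover have "seq_scale 0 (pad 0 \<theta>) = pad 0 \<theta>" by (simp add: fun_eq_iff seq_scale_def pad_def)
  ultimately show ?case by simp
next
  case (Suc n)
  have u: "unit_seq n = (pad (Suc n) (unit_seq n) :: nat \<Rightarrow> 'k)"
    by (auto simp: fun_eq_iff unit_seq_def pad_def)
  have su: "seq_scale (\<theta> n) (unit_seq n) = pad (Suc n) (\<lambda>i. \<theta> n * unit_seq n i)"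
    by (auto simp: fun_eq_iff unit_seq_def pad_def seq_scale_def)
  have "pad (Suc n) \<theta> = pad n \<theta> + seq_scale (\<theta> n) (unit_seq n)"
    by (auto simp: fun_eq_iff unit_seq_def pad_def seq_scale_def less_Suc_eq)
  then have "\<gamma> (pad (Suc n) \<theta>) = \<gamma> (pad n \<theta>) + \<gamma> (seq_scale (\<theta> n) (unit_seq n))"
    using assms pad_in_lspace[of n \<theta> r] pad_in_lspace[of "Suc n" "\<lambda>i. \<theta> n * unit_seq n i" r]
    unfolding linear_on_def su by auto
  moreover have "(unit_seq n :: nat \<Rightarrow> 'k) \<in> lspace r" by (subst u) (rule pad_in_lspace)
  then have "\<gamma> (seq_scale (\<theta> n) (unit_seq n)) = \<theta> n * \<gamma> (unit_seq n)"
    using assms unfolding linear_on_def by blast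
  ultimately show ?case using Suc by simp
qed

lemma lnorm_pad:
  assumes "0 < \<rho>"
  shows "lnorm (ennreal \<rho>) (pad n v) = lpn \<rho> {..<n} v"
proof -
  have "(\<Sum>i. norm (pad n v i) powr \<rho>) = (\<Sum>i<n. norm (pad n v i) powr \<rho>)"
    by (rule suminf_finite) (auto simp: pad_def)
  then show ?thesis using assms by (simp add: lnorm_def lpn_def pad_def)
qed

lemma sum_seq_apply: "(\<Sum>i\<in>I. g i) l = (\<Sum>i\<in>I. g i l)" for g :: "'i \<Rightarrow> 'l \<Rightarrow> 'k::comm_monoid_add"
  by (induction I rule: infinite_finite_induct) auto

lemma lnorm_fin_seqs:
  assumes "0 < q" "z \<in> fin_seqs k"
  shows "lnorm (ennreal q) z = lpn q {..<k} z"
proof -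
  have "pad k z = z" using assms by (auto simp: fin_seqs_def pad_def fun_eq_iff)
  then show ?thesis using lnorm_pad[OF assms(1), of k z] by simp
qed

text \<open>Evaluate \<open>\<gamma>\<close> at the vector for which Hoelder's inequality is an equality.\<close>

lemma dual_ball_coefficients:
  fixes \<gamma> :: "(nat \<Rightarrow> 'k::real_or_complex) \<Rightarrow> 'k"
  assumes c: "conjugate r s" and \<gamma>: "\<gamma> \<in> dual_ball seq_scale (lspace r) (lnorm r)"
  shows "lpn s {..<n} (\<lambda>i. \<gamma> (unit_seq i)) \<le> 1"
proof -
  define a where "a i = \<gamma> (unit_seq i)" for i
  have lin: "linear_on seq_scale (lspace r) (*) \<gamma>" and bd: "\<And>v. v \<in> lspace r \<Longrightarrow> norm (\<gamma> v) \<le> lnorm r v"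
    using \<gamma> by (auto simp: dual_ball_def)
  (* u i is the conjugate phase of a i, written without conjugation. *)
  define u where "u i = (if a i = 0 then 1 else of_real (norm (a i)) / a i)" for i
  have u: "norm (u i) = 1" "u i * a i = of_real (norm (a i))" for i
    by (auto simp: u_def norm_divide)
  have test: "norm (\<Sum>i<n. v i * a i) \<le> lnorm r (pad n v)" for v
    using bd[OF pad_in_lspace[of n v]] unfolding linear_pad[OF lin] a_def .
  show ?thesis
    using c unfolding conjugate_def a_def[symmetric]
  proof (elim disjE exE conjE)
    assume r: "r = \<infinity>" and s: "s = 1"
    have "norm (\<Sum>i<n. u i * a i) = (\<Sum>i<n. norm (a i))"
      unfolding u(2) of_real_sum[symmetric] norm_of_real by (simp add: sum_nonneg)
    moreover have "lnorm r (pad n u) \<le> 1"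
      unfolding r lnorm_def using u(1) by (auto intro!: cSUP_least simp: pad_def)
    ultimately show "lpn s {..<n} a \<le> 1"
      using test[of u] by (simp add: s lpn_def sum_nonneg)
  next
    fix \<rho> assume \<rho>: "1 < \<rho>" "r = ennreal \<rho>" "1 < s" "1 / \<rho> + 1 / s = 1"
    define S where "S = (\<Sum>i<n. norm (a i) powr s)"
    define v where "v i = u i * of_real (norm (a i) powr (s - 1))" for i
    have e: "(s - 1) * \<rho> = s" using \<rho> by (simp add: field_simps)
    have va: "v i * a i = of_real (norm (a i) powr s)" for i
    proof -
      have "v i * a i = (u i * a i) * of_real (norm (a i) powr (s - 1))" by (simp add: v_def mult_ac)
      also have "\<dots> = of_real (norm (a i) * norm (a i) powr (s - 1))" unfolding u by simp
      finally show ?thesis by (simp add: powr_mult_base)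
    qed
    have "lnorm r (pad n v) = S powr (1 / \<rho>)"
      unfolding \<rho>(2) using \<rho>(1)
      by (subst lnorm_pad) (simp_all add: lpn_def S_def v_def norm_mult u powr_powr e)
    moreover have "norm (\<Sum>i<n. v i * a i) = S"
      unfolding va of_real_sum[symmetric] norm_of_real by (simp add: S_def sum_nonneg)
    ultimately have SS: "S \<le> S powr (1 / \<rho>)" using test[of v] by simp
    show "lpn s {..<n} a \<le> 1"
    proof (cases "S = 0")
      case True
      then show ?thesis by (simp add: lpn_def S_def)
    next
      case False
      then have S: "0 < S" by (simp add: S_def less_le sum_nonneg)
      have "S powr (1 / s) * S powr (1 / \<rho>) = S" using S \<rho>(4) by (simp add: add.commute flip: powr_add)
      then have "S powr (1 / s) * S powr (1 / \<rho>) \<le> 1 * S powr (1 / \<rho>)" using SS by simp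
      then have "S powr (1 / s) \<le> 1" by (rule mult_right_le_imp_le) (use S in simp)
      then show ?thesis by (simp add: lpn_def S_def)
    qed
  qed
qed

definition weak_lnorm :: "real \<Rightarrow> ennreal \<Rightarrow> nat \<Rightarrow> (nat \<Rightarrow> nat \<Rightarrow> 'k::real_or_complex) \<Rightarrow> ennreal"
  where "weak_lnorm p r = weak_norm p seq_scale (lspace r) (lnorm r)"

lemma weak_lnorm_eq:
  "weak_lnorm p r J y = (SUP \<gamma>\<in>dual_ball seq_scale (lspace r) (lnorm r). ennreal (lpn p {..<J} (\<lambda>j. \<gamma> (y j))))"
  by (simp add: weak_lnorm_def weak_norm_def lpn_def)

lemma weak_lnorm_finite:
  assumes "0 < p" "\<And>j. j < J \<Longrightarrow> y j \<in> lspace r"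
  shows "weak_lnorm p r J y < top"
proof -
  have "weak_lnorm p r J y \<le> ennreal (lpn p {..<J} (\<lambda>j. lnorm r (y j)))"
    unfolding weak_lnorm_eq using assms
    by (intro SUP_least ennreal_leI lpn_mono) (force simp: dual_ball_def)+
  then show ?thesis by (simp add: order_le_less_trans)
qed

text \<open>The coefficients \<open>a\<close>, normalized in \<open>\<ell>\<^sub>s\<close>, define a functional in the unit ball of the dual of \<open>\<ell>\<^sub>r\<close>.\<close>

lemma weak_lnorm_ge:
  fixes a :: "nat \<Rightarrow> 'k::real_or_complex"
  assumes c: "conjugate r s" and p: "0 < p" and y: "\<And>j. j < J \<Longrightarrow> y j \<in> lspace r"
  shows "lpn p {..<J} (\<lambda>j. \<Sum>i<n. y j i * a i) \<le> enn2real (weak_lnorm p r J y) * lpn s {..<n} a"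
proof -
  have s: "0 < s" using c by (auto simp: conjugate_def)
  define A where "A = lpn s {..<n} a"
  show ?thesis
  proof (cases "A = 0")
    case True
    then have "a i = 0" if "i < n" for i using lpn_eq_0D[OF s, of "{..<n}" a i] that by (simp add: A_def)
    then show ?thesis using p by (simp add: lpn_def)
  next
    case False
    then have A: "0 < A" by (simp add: A_def less_le)
    define \<gamma> where "\<gamma> v = (\<Sum>i<n. v i * (a i / of_real A))" for v :: "nat \<Rightarrow> 'k"
    have "lpn s {..<n} a = A * lpn s {..<n} (\<lambda>i. a i / of_real A)"
      using A s by (intro lpn_scale) (auto simp: norm_divide)
    then have one: "lpn s {..<n} (\<lambda>i. a i / of_real A) = 1" using A by (simp add: A_def)
    have "\<gamma> \<in> dual_ball seq_scale (lspace r) (lnorm r)"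
      using lnorm_bound[OF c, where n = n and a = "\<lambda>i. a i / of_real A"]
      by (auto simp: dual_ball_def linear_on_def \<gamma>_def one seq_scale_def sum.distrib distrib_right
          sum_distrib_left mult.assoc add_divide_distrib)
    then have "ennreal (lpn p {..<J} (\<lambda>j. \<gamma> (y j))) \<le> weak_lnorm p r J y"
      unfolding weak_lnorm_eq by (rule SUP_upper)
    then have "lpn p {..<J} (\<lambda>j. \<gamma> (y j)) \<le> enn2real (weak_lnorm p r J y)"
      using weak_lnorm_finite[OF p y] enn2real_mono[of "ennreal (lpn p {..<J} (\<lambda>j. \<gamma> (y j)))"] by simp
    moreover have "lpn p {..<J} (\<lambda>j. \<Sum>i<n. y j i * a i) = A * lpn p {..<J} (\<lambda>j. \<gamma> (y j))"
    proof (rule lpn_scale)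
      fix j
      have "(\<Sum>i<n. y j i * a i) = of_real A * \<gamma> (y j)"
        using A by (simp add: \<gamma>_def sum_distrib_left)
      then show "norm (\<Sum>i<n. y j i * a i) = A * norm (\<gamma> (y j))" using A by (simp add: norm_mult)
    qed (use A p in auto)
    ultimately show ?thesis using A by (simp add: A_def mult.commute)
  qed
qed

text \<open>The weak norm of the values of a random vector. Functionals act on finitely supported sequences through
  coefficients in the unit ball of \<open>\<ell>\<^sub>s\<close>, so a moment bound for linear forms in the random vector suffices.\<close>

lemma weak_lnorm_le:
  fixes \<Omega> :: "(nat \<Rightarrow> 'k::real_or_complex) set"
  assumes c: "conjugate r s" and W: "0 \<le> W" and e: "bij_betw e {..<J} \<Omega>"
    and le: "\<And>a. lpn p \<Omega> (\<lambda>\<theta>. \<Sum>i<n. \<theta> i * a i) \<le> W * lpn s {..<n} a"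
  shows "weak_lnorm p r J (\<lambda>j. pad n (e j)) \<le> ennreal W"
  unfolding weak_lnorm_eq
proof (intro SUP_least ennreal_leI)
  fix \<gamma> :: "(nat \<Rightarrow> 'k) \<Rightarrow> 'k" assume \<gamma>: "\<gamma> \<in> dual_ball seq_scale (lspace r) (lnorm r)"
  then have lin: "linear_on seq_scale (lspace r) (*) \<gamma>" by (simp add: dual_ball_def)
  have "lpn p {..<J} (\<lambda>j. \<gamma> (pad n (e j))) = lpn p \<Omega> (\<lambda>\<theta>. \<Sum>i<n. \<theta> i * \<gamma> (unit_seq i))"
    unfolding linear_pad[OF lin] lpn_reindex[OF e] ..
  also have "\<dots> \<le> W * lpn s {..<n} (\<lambda>i. \<gamma> (unit_seq i))" by (rule le)
  also have "\<dots> \<le> W * 1" using W by (intro mult_left_mono dual_ball_coefficients[OF c \<gamma>])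
  finally show "lpn p {..<J} (\<lambda>j. \<gamma> (pad n (e j))) \<le> W" by simp
qed

section \<open>Multiple summing maps into finite-dimensional sequence spaces\<close>

text \<open>The defining inequality of multiple summing maps in real numbers, which loses nothing because weak norms of
  finite sequences are finite. It refers to \<open>T\<close> only through \<open>norm \<circ> T\<close>, and so it can be applied to the
  functional \<open>lpn q L\<close> of the coordinates of a map.\<close>

definition multiple_summing ::
  "real \<Rightarrow> nat \<Rightarrow> ennreal \<Rightarrow> real \<Rightarrow> ((nat \<Rightarrow> nat \<Rightarrow> 'k::real_or_complex) \<Rightarrow> 'b::real_normed_vector) \<Rightarrow> bool"
  where "multiple_summing p m r C T \<longleftrightarrow>
    (\<forall>J x. (\<forall>k<m. \<forall>j<J k. x k j \<in> lspace r) \<longrightarrow>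
      lpn p (PiE {..<m} (\<lambda>k. {..<J k})) (\<lambda>j. T (\<lambda>k\<in>{..<m}. x k (j k)))
      \<le> C * (\<Prod>k<m. enn2real (weak_lnorm p r (J k) (x k))))"

lemma multiple_summing_mono:
  assumes "multiple_summing p m r C T" "C \<le> C'"
  shows "multiple_summing p m r C' T"
  using assms unfolding multiple_summing_def
  by (meson mult_right_mono order_trans prod_nonneg enn2real_nonneg)

lemma multiple_summing_zero: "0 \<le> C \<Longrightarrow> multiple_summing p m r C (\<lambda>_. 0)"
  by (simp add: multiple_summing_def lpn_def prod_nonneg)

lemma multiple_summing_dominated:
  assumes "0 < p" "0 \<le> B" "\<And>y. norm (T' y) \<le> B * norm (T y)" "multiple_summing p m r C T"
  shows "multiple_summing p m r (B * C) T'"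
  unfolding multiple_summing_def
proof (intro allI impI)
  fix J :: "nat \<Rightarrow> nat" and x :: "nat \<Rightarrow> nat \<Rightarrow> nat \<Rightarrow> 'a"
  assume x: "\<forall>k<m. \<forall>j<J k. x k j \<in> lspace r"
  have "lpn p (PiE {..<m} (\<lambda>k. {..<J k})) (\<lambda>j. T' (\<lambda>k\<in>{..<m}. x k (j k)))
      \<le> B * lpn p (PiE {..<m} (\<lambda>k. {..<J k})) (\<lambda>j. T (\<lambda>k\<in>{..<m}. x k (j k)))"
    using assms by (intro lpn_scale_le) auto
  also have "\<dots> \<le> B * (C * (\<Prod>k<m. enn2real (weak_lnorm p r (J k) (x k))))"
    using assms x unfolding multiple_summing_def by (intro mult_left_mono) auto
  finally show "lpn p (PiE {..<m} (\<lambda>k. {..<J k})) (\<lambda>j. T' (\<lambda>k\<in>{..<m}. x k (j k)))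
      \<le> B * C * (\<Prod>k<m. enn2real (weak_lnorm p r (J k) (x k)))" by (simp add: mult.assoc)
qed

lemma mform_restrict: "mform m n b (\<lambda>k\<in>{..<m}. y k) = mform m n b y"
  by (rule mform_cong) simp

text \<open>The values of the random vectors are admissible test sequences, with weak norms controlled by \<open>upper\<close>.
  Since \<open>q \<le> p\<close>, the \<open>p\<close>-th moment of the norm dominates its \<open>q\<close>-th moment, in which the
  coordinates separate.\<close>

lemma lmean_stable_le_summing:
  fixes b :: "'l \<Rightarrow> (nat \<Rightarrow> nat) \<Rightarrow> 'k::real_or_complex"
  assumes pqrs: "0 < q" "q \<le> p" "conjugate r s" "0 < s"
    and upper: "\<And>n (a :: nat \<Rightarrow> 'k). lmean p (stable_vectors s n) (\<lambda>\<theta>. \<Sum>i<n. \<theta> i * a i) \<le> U * lpn s {..<n} a"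
    and U: "0 \<le> U" and C: "0 \<le> C"
    and T: "multiple_summing p m r C (\<lambda>y. lpn q L (\<lambda>l. mform m n (b l) y))"
  shows "lpn q L (\<lambda>l. lmean q (PiE {..<m} (\<lambda>k. stable_vectors s (n k))) (mform m n (b l))) \<le> C * U ^ m"
proof -
  have p: "0 < p" using pqrs by simp
  define SV where "SV = (\<lambda>k. stable_vectors s (n k) :: (nat \<Rightarrow> 'k) set)"
  let ?\<Theta> = "PiE {..<m} SV"
  have fin: "finite (SV k)" and ne: "SV k \<noteq> {}" for k
    using pqrs by (simp_all add: SV_def stable_vectors_nonempty)
  have fin\<Theta>: "finite ?\<Theta>" and ne\<Theta>: "?\<Theta> \<noteq> {}"
    using fin ne by (auto intro: finite_PiE simp: PiE_eq_empty_iff)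
  define N where "N k = card (SV k)" for k
  have N: "0 < real (N k)" for k using fin ne by (simp add: N_def card_gt_0_iff)
  obtain e where e: "\<And>k. bij_betw (e k) {..<N k} (SV k)"
    using ex_bij_betw_nat_finite[OF fin] unfolding N_def atLeast0LessThan by metis
  have "weak_lnorm p r (N k) (\<lambda>j. pad (n k) (e k j)) \<le> ennreal (U * real (N k) powr (1/p))" for k
  proof (rule weak_lnorm_le[OF pqrs(3) _ e])
    fix a :: "nat \<Rightarrow> 'k"
    have "lpn p (SV k) (\<lambda>\<theta>. \<Sum>i<n k. \<theta> i * a i) = lmean p (SV k) (\<lambda>\<theta>. \<Sum>i<n k. \<theta> i * a i) * real (N k) powr (1/p)"
      unfolding N_def using fin ne by (rule lpn_eq_lmean)
    also have "\<dots> \<le> (U * lpn s {..<n k} a) * real (N k) powr (1/p)"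
      unfolding SV_def by (intro mult_right_mono upper) auto
    finally show "lpn p (SV k) (\<lambda>\<theta>. \<Sum>i<n k. \<theta> i * a i) \<le> U * real (N k) powr (1/p) * lpn s {..<n k} a"
      by (simp add: mult_ac)
  qed (use U in auto)
  then have weak: "enn2real (weak_lnorm p r (N k) (\<lambda>j. pad (n k) (e k j))) \<le> U * real (N k) powr (1/p)" for k
    using U by (intro enn2real_leI) auto
  have "lpn q L (\<lambda>l. lmean q ?\<Theta> (mform m n (b l)))
      = lpn q L (\<lambda>l. lpn q ?\<Theta> (mform m n (b l))) * real (card ?\<Theta>) powr (-1/q)"
    unfolding lmean_def
    by (subst mult.commute, rule lpn_scale) (use pqrs in \<open>auto simp: abs_mult mult.commute\<close>)
  also have "\<dots> = lmean q ?\<Theta> (\<lambda>\<theta>. lpn q L (\<lambda>l. mform m n (b l) \<theta>))"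
    unfolding lmean_def using pqrs by (subst lpn_swap) auto
  also have "\<dots> \<le> lmean p ?\<Theta> (\<lambda>\<theta>. lpn q L (\<lambda>l. mform m n (b l) \<theta>))"
    using pqrs fin\<Theta> ne\<Theta> by (intro lmean_power_mean)
  also have "\<dots> = lpn p ?\<Theta> (\<lambda>\<theta>. lpn q L (\<lambda>l. mform m n (b l) \<theta>)) * (\<Prod>k<m. real (N k) powr (-1/p))"
    unfolding N_def using fin by (intro lmean_PiE)
  also have "lpn p ?\<Theta> (\<lambda>\<theta>. lpn q L (\<lambda>l. mform m n (b l) \<theta>))
      = lpn p (PiE {..<m} (\<lambda>k. {..<N k})) (\<lambda>j. lpn q L (\<lambda>l. mform m n (b l) (\<lambda>k\<in>{..<m}. pad (n k) (e k (j k)))))"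
  proof -
    have "mform m n (b l) (\<lambda>k\<in>{..<m}. e k (j k)) = mform m n (b l) (\<lambda>k\<in>{..<m}. pad (n k) (e k (j k)))" for l j
      by (rule mform_cong) (simp add: pad_def)
    then show ?thesis
      using lpn_reindex[OF bij_betw_PiE[of "{..<m}" e "\<lambda>k. {..<N k}" SV, OF e],
          of p "\<lambda>\<theta>. lpn q L (\<lambda>l. mform m n (b l) \<theta>)"] by simp
  qed
  also have "\<dots> * (\<Prod>k<m. real (N k) powr (-1/p))
      \<le> (C * (\<Prod>k<m. enn2real (weak_lnorm p r (N k) (\<lambda>j. pad (n k) (e k j))))) * (\<Prod>k<m. real (N k) powr (-1/p))"
    using T[unfolded multiple_summing_def, rule_format, of N "\<lambda>k j. pad (n k) (e k j)"]
    by (intro mult_right_mono prod_nonneg) (auto simp: pad_in_lspace)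
  also have "\<dots> \<le> (C * (\<Prod>k<m. U * real (N k) powr (1/p))) * (\<Prod>k<m. real (N k) powr (-1/p))"
    using weak C by (intro mult_right_mono mult_left_mono prod_mono prod_nonneg) auto
  also have "\<dots> = C * (\<Prod>k<m. U * (real (N k) powr (1/p) * real (N k) powr (-1/p)))"
    by (simp add: prod.distrib mult_ac)
  also have "\<dots> = C * U ^ m"
  proof -
    have "real (N k) powr (1/p) * real (N k) powr (-1/p) = 1" for k
      using N[of k] by (simp flip: powr_add)
    then show ?thesis by simp
  qed
  finally show ?thesis by (simp add: SV_def)
qed

text \<open>Conversely, Minkowski's inequality separates the coordinates. For each of them, \<open>tensor_ineq\<close> replaces the
  test sequences by random vectors: the power sum of a linear form over a test sequence is at most the
  weak norm times the \<open>\<ell>\<^sub>s\<close> norm of the coefficients, and \<open>lower\<close> bounds the latter by a moment of order \<open>q\<close>.\<close>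

lemma summing_le_lmean_stable:
  fixes b :: "'l \<Rightarrow> (nat \<Rightarrow> nat) \<Rightarrow> 'k::real_or_complex"
  assumes pqrs: "0 < q" "q \<le> p" "conjugate r s" "0 < s" and L: "finite L"
    and lower: "\<And>n (a :: nat \<Rightarrow> 'k). c * lpn s {..<n} a \<le> lmean q (stable_vectors s n) (\<lambda>\<theta>. \<Sum>i<n. \<theta> i * a i)"
    and c: "0 < c"
  shows "multiple_summing p m r
      (lpn q L (\<lambda>l. lmean q (PiE {..<m} (\<lambda>k. stable_vectors s (n k))) (mform m n (b l))) / c ^ m)
      (\<lambda>y. lpn q L (\<lambda>l. mform m n (b l) y))"
  unfolding multiple_summing_def
proof (intro allI impI)
  fix J :: "nat \<Rightarrow> nat" and x :: "nat \<Rightarrow> nat \<Rightarrow> nat \<Rightarrow> 'k"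
  assume x: "\<forall>k<m. \<forall>j<J k. x k j \<in> lspace r"
  have p: "0 < p" using pqrs by simp
  define SV where "SV = (\<lambda>k. stable_vectors s (n k) :: (nat \<Rightarrow> 'k) set)"
  have fin: "finite (SV k)" and ne: "SV k \<noteq> {}" for k
    using pqrs by (simp_all add: SV_def stable_vectors_nonempty)
  define w where "w k = enn2real (weak_lnorm p r (J k) (x k))" for k
  have w: "0 \<le> w k" for k by (simp add: w_def)
  define P where "P = (\<Prod>k<m. w k)"
  have P: "0 \<le> P" unfolding P_def using w by (intro prod_nonneg) auto
  let ?J = "PiE {..<m} (\<lambda>k. {..<J k})" and ?\<Theta> = "PiE {..<m} SV"
  have scalar: "lpn p ?J (\<lambda>j. mform m n d (\<lambda>k. x k (j k))) \<le> P / c ^ m * lmean q ?\<Theta> (mform m n d)"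
    for d :: "(nat \<Rightarrow> nat) \<Rightarrow> 'k"
  proof -
    have "lpn p ?J (\<lambda>j. mform m n d (\<lambda>k. x k (j k)))
        \<le> (\<Prod>k<m. w k / c * real (card (SV k)) powr (-1/q)) * lpn q ?\<Theta> (\<lambda>\<theta>. mform m n d (\<lambda>k. \<theta> k))"
    proof (rule tensor_ineq[where v = "\<lambda>_ \<theta>. \<theta>"])
      fix k and a :: "nat \<Rightarrow> 'k" assume k: "k < m"
      have "lpn p {..<J k} (\<lambda>j. \<Sum>i<n k. x k j i * a i) \<le> w k * lpn s {..<n k} a"
        unfolding w_def using x k by (intro weak_lnorm_ge[OF pqrs(3) p]) auto
      also have "\<dots> \<le> w k * (lmean q (SV k) (\<lambda>\<theta>. \<Sum>i<n k. \<theta> i * a i) / c)"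
        using lower[of "n k" a] c w by (intro mult_left_mono) (auto simp: SV_def field_simps)
      finally show "lpn p {..<J k} (\<lambda>j. \<Sum>i<n k. x k j i * a i)
          \<le> w k / c * real (card (SV k)) powr (-1/q) * lpn q (SV k) (\<lambda>\<theta>. \<Sum>i<n k. \<theta> i * a i)"
        by (simp add: lmean_def mult_ac)
    qed (use pqrs fin c w in auto)
    also have "\<dots> = P / c ^ m * lmean q ?\<Theta> (mform m n d)"
      using fin by (simp add: lmean_PiE prod.distrib prod_dividef P_def mult_ac)
    finally show ?thesis .
  qed
  have "lpn p ?J (\<lambda>j. lpn q L (\<lambda>l. mform m n (b l) (\<lambda>k\<in>{..<m}. x k (j k))))
      = lpn p ?J (\<lambda>j. lpn q L (\<lambda>l. mform m n (b l) (\<lambda>k. x k (j k))))"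
    by (simp add: mform_restrict)
  also have "\<dots> \<le> lpn q L (\<lambda>l. lpn p ?J (\<lambda>j. mform m n (b l) (\<lambda>k. x k (j k))))"
    using pqrs L by (intro lpn_Minkowski) (auto intro: finite_PiE)
  also have "\<dots> \<le> P / c ^ m * lpn q L (\<lambda>l. lmean q ?\<Theta> (mform m n (b l)))"
    using scalar pqrs P c by (intro lpn_scale_le) auto
  finally show "lpn p ?J (\<lambda>j. lpn q L (\<lambda>l. mform m n (b l) (\<lambda>k\<in>{..<m}. x k (j k))))
      \<le> lpn q L (\<lambda>l. lmean q (PiE {..<m} (\<lambda>k. stable_vectors s (n k))) (mform m n (b l))) / c ^ m
        * (\<Prod>k<m. enn2real (weak_lnorm p r (J k) (x k)))"
    by (simp add: SV_def P_def w_def mult.commute)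
qed

text \<open>The two preceding estimates identify the summing constant, up to constants, with an average of random forms,
  and that average is unconditional.\<close>

theorem lq_unconditional_le:
  assumes pqrs: "0 < q" "q \<le> p" "conjugate r s" "s \<le> 2" "s = 2 \<or> p < s"
  obtains K where "0 < K"
    "\<And>n L M C \<alpha> (b :: 'l \<Rightarrow> (nat \<Rightarrow> nat) \<Rightarrow> 'k::real_or_complex).
        finite L \<Longrightarrow> 0 \<le> M \<Longrightarrow> 0 \<le> C \<Longrightarrow>
        (\<And>i. i \<in> PiE {..<m} (\<lambda>k. {..<n k}) \<Longrightarrow> norm (\<alpha> i) \<le> M) \<Longrightarrow>
        multiple_summing p m r C (\<lambda>y. lpn q L (\<lambda>l. mform m n (b l) y)) \<Longrightarrow>
        multiple_summing p m r (K * M * C) (\<lambda>y. lpn q L (\<lambda>l. mform m n (\<lambda>i. \<alpha> i * b l i) y))"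
proof -
  have s: "0 < s" using pqrs by (auto simp: conjugate_def)
  have p: "0 < p" using pqrs by simp
  have sq: "s = 2 \<or> q < s" using pqrs by auto
  obtain U where U: "0 < U"
    "\<And>n (a :: nat \<Rightarrow> 'k). lmean p (stable_vectors s n) (\<lambda>\<theta>. \<Sum>i<n. \<theta> i * a i) \<le> U * lpn s {..<n} a"
    by (rule stable_vectors_norm[OF p s pqrs(4,5), where 'k = 'k]) blast
  obtain c where c: "0 < c"
    "\<And>n (a :: nat \<Rightarrow> 'k). c * lpn s {..<n} a \<le> lmean q (stable_vectors s n) (\<lambda>\<theta>. \<Sum>i<n. \<theta> i * a i)"
    by (rule stable_vectors_norm[OF pqrs(1) s pqrs(4) sq, where 'k = 'k]) blast
  obtain V where V: "0 < V"
    "\<And>n D M \<alpha> (b :: (nat \<Rightarrow> nat) \<Rightarrow> 'k).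
        (\<And>k x. k < m \<Longrightarrow> x \<in> D k \<Longrightarrow> - x \<in> D k) \<Longrightarrow> 0 \<le> M \<Longrightarrow>
        (\<And>i. i \<in> PiE {..<m} (\<lambda>k. {..<n k}) \<Longrightarrow> norm (\<alpha> i) \<le> M) \<Longrightarrow>
        lmean q (PiE {..<m} (\<lambda>k. PiE {..<n k} (\<lambda>_. D k))) (mform m n (\<lambda>i. \<alpha> i * b i))
        \<le> V * M * lmean q (PiE {..<m} (\<lambda>k. PiE {..<n k} (\<lambda>_. D k))) (mform m n b)"
    by (rule mform_unconditional[OF pqrs(1), where 'k = 'k and m = m]) blast
  show thesis
  proof (rule that[of "V * U ^ m / c ^ m"])
    fix n and L :: "'l set" and M C :: real and \<alpha> :: "(nat \<Rightarrow> nat) \<Rightarrow> 'k" and b :: "'l \<Rightarrow> (nat \<Rightarrow> nat) \<Rightarrow> 'k"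
    assume L: "finite L" and M: "0 \<le> M" and C: "0 \<le> C"
      and \<alpha>: "\<And>i. i \<in> PiE {..<m} (\<lambda>k. {..<n k}) \<Longrightarrow> norm (\<alpha> i) \<le> M"
      and T: "multiple_summing p m r C (\<lambda>y. lpn q L (\<lambda>l. mform m n (b l) y))"
    let ?\<Theta> = "PiE {..<m} (\<lambda>k. stable_vectors s (n k) :: (nat \<Rightarrow> 'k) set)"
    have "lpn q L (\<lambda>l. lmean q ?\<Theta> (mform m n (\<lambda>i. \<alpha> i * b l i)))
        \<le> V * M * lpn q L (\<lambda>l. lmean q ?\<Theta> (mform m n (b l)))"
      using V pqrs M \<alpha> unfolding stable_vectors_def
      by (intro lpn_scale_le) (auto intro!: V(2) stable_set_symmetric)
    also have "\<dots> \<le> V * M * (C * U ^ m)"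
      using V(1) M U C T pqrs s by (intro mult_left_mono lmean_stable_le_summing[of q p r s]) auto
    finally have "lpn q L (\<lambda>l. lmean q ?\<Theta> (mform m n (\<lambda>i. \<alpha> i * b l i))) / c ^ m
        \<le> V * U ^ m / c ^ m * M * C"
      using c by (simp add: divide_right_mono mult_ac)
    moreover have "multiple_summing p m r (lpn q L (\<lambda>l. lmean q ?\<Theta> (mform m n (\<lambda>i. \<alpha> i * b l i))) / c ^ m)
        (\<lambda>y. lpn q L (\<lambda>l. mform m n (\<lambda>i. \<alpha> i * b l i) y))"
      using pqrs s L c by (intro summing_le_lmean_stable)
    ultimately show "multiple_summing p m r (V * U ^ m / c ^ m * M * C)
        (\<lambda>y. lpn q L (\<lambda>l. mform m n (\<lambda>i. \<alpha> i * b l i) y))"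
      by (rule multiple_summing_mono[rotated])
  qed (use V U c in auto)
qed

text \<open>For \<open>p < q \<le> 2\<close> the space \<open>\<ell>\<^sub>q\<close> embeds into \<open>\<ell>\<^sub>p\<close> by \<open>stable_vectors_norm\<close>. The embedding acts on
  values only, so it commutes with the multiplication of the coefficients by \<open>\<alpha>\<close>, and the case of equal exponents
  applies.\<close>

theorem lq_unconditional:
  assumes pqrs: "0 < p" "0 < q" "conjugate r s" "s \<le> 2" "s = 2 \<or> p < s" "q \<le> p \<or> q \<le> 2"
  obtains K where "0 < K"
    "\<And>n L M C \<alpha> (b :: nat \<Rightarrow> (nat \<Rightarrow> nat) \<Rightarrow> 'k::real_or_complex).
        0 \<le> M \<Longrightarrow> 0 \<le> C \<Longrightarrow>
        (\<And>i. i \<in> PiE {..<m} (\<lambda>k. {..<n k}) \<Longrightarrow> norm (\<alpha> i) \<le> M) \<Longrightarrow>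
        multiple_summing p m r C (\<lambda>y. lpn q {..<L} (\<lambda>l. mform m n (b l) y)) \<Longrightarrow>
        multiple_summing p m r (K * M * C) (\<lambda>y. lpn q {..<L} (\<lambda>l. mform m n (\<lambda>i. \<alpha> i * b l i) y))"
proof (cases "q \<le> p")
  case True
  show thesis
    by (rule lq_unconditional_le[OF pqrs(2) True pqrs(3-5), where m = m and 'k = 'k and 'l = nat])
       (rule that, auto)
next
  case False
  then have q: "p < q" "q \<le> 2" using pqrs by auto
  obtain K where K: "0 < K"
    "\<And>n L M C \<alpha> (b :: (nat \<Rightarrow> 'k) \<Rightarrow> (nat \<Rightarrow> nat) \<Rightarrow> 'k).
        finite L \<Longrightarrow> 0 \<le> M \<Longrightarrow> 0 \<le> C \<Longrightarrow>
        (\<And>i. i \<in> PiE {..<m} (\<lambda>k. {..<n k}) \<Longrightarrow> norm (\<alpha> i) \<le> M) \<Longrightarrow>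
        multiple_summing p m r C (\<lambda>y. lpn p L (\<lambda>l. mform m n (b l) y)) \<Longrightarrow>
        multiple_summing p m r (K * M * C) (\<lambda>y. lpn p L (\<lambda>l. mform m n (\<lambda>i. \<alpha> i * b l i) y))"
    by (rule lq_unconditional_le[OF pqrs(1) order_refl pqrs(3-5), where m = m and 'k = 'k and 'l = "nat \<Rightarrow> 'k"]) blast
  obtain c U where cU: "0 < c" "0 < U"
    "\<And>n (a :: nat \<Rightarrow> 'k). c * lpn q {..<n} a \<le> lmean p (stable_vectors q n) (\<lambda>\<theta>. \<Sum>i<n. \<theta> i * a i)"
    "\<And>n (a :: nat \<Rightarrow> 'k). lmean p (stable_vectors q n) (\<lambda>\<theta>. \<Sum>i<n. \<theta> i * a i) \<le> U * lpn q {..<n} a"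
    by (rule stable_vectors_norm[OF pqrs(1,2) q(2), where 'k = 'k]) (use q in blast)+
  show thesis
  proof (rule that[of "K * U / c"])
    fix n L and M C :: real and \<alpha> :: "(nat \<Rightarrow> nat) \<Rightarrow> 'k" and b :: "nat \<Rightarrow> (nat \<Rightarrow> nat) \<Rightarrow> 'k"
    assume M: "0 \<le> M" and C: "0 \<le> C"
      and \<alpha>: "\<And>i. i \<in> PiE {..<m} (\<lambda>k. {..<n k}) \<Longrightarrow> norm (\<alpha> i) \<le> M"
      and T: "multiple_summing p m r C (\<lambda>y. lpn q {..<L} (\<lambda>l. mform m n (b l) y))"
    define H where "H = (stable_vectors q L :: (nat \<Rightarrow> 'k) set)"
    have H: "finite H" "H \<noteq> {}" using pqrs by (simp_all add: H_def stable_vectors_nonempty)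
    (* Normalizing factor between power sums and averages over H; it cancels at the end. *)
    define N where "N = real (card H) powr (1/p)"
    have N: "0 < N" using H by (simp add: N_def card_gt_0_iff)
    define b' where "b' \<eta> i = (\<Sum>l<L. \<eta> l * b l i)" for \<eta> i
    have lpn_H: "lpn p H (\<lambda>\<eta>. mform m n (\<lambda>i. \<Sum>l<L. \<eta> l * d l i) y) = lmean p H (\<lambda>\<eta>. \<Sum>l<L. \<eta> l * mform m n (d l) y) * N"
      for d y unfolding N_def mform_sum[symmetric] by (rule lpn_eq_lmean[OF H])
    have "multiple_summing p m r ((N * U) * C) (\<lambda>y. lpn p H (\<lambda>\<eta>. mform m n (b' \<eta>) y))"
    proof (rule multiple_summing_dominated[OF pqrs(1) _ _ T])
      fix y
      have "lpn p H (\<lambda>\<eta>. mform m n (b' \<eta>) y) = lmean p H (\<lambda>\<eta>. \<Sum>l<L. \<eta> l * mform m n (b l) y) * N"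
        unfolding b'_def by (rule lpn_H)
      also have "\<dots> \<le> (U * lpn q {..<L} (\<lambda>l. mform m n (b l) y)) * N"
        unfolding H_def using N by (intro mult_right_mono cU) auto
      finally show "norm (lpn p H (\<lambda>\<eta>. mform m n (b' \<eta>) y)) \<le> N * U * norm (lpn q {..<L} (\<lambda>l. mform m n (b l) y))"
        by (simp add: mult_ac)
    qed (use N cU in auto)
    then have "multiple_summing p m r (K * M * ((N * U) * C)) (\<lambda>y. lpn p H (\<lambda>\<eta>. mform m n (\<lambda>i. \<alpha> i * b' \<eta> i) y))"
      using H M C N cU \<alpha> by (intro K) auto
    then have "multiple_summing p m r (1 / (c * N) * (K * M * ((N * U) * C)))
        (\<lambda>y. lpn q {..<L} (\<lambda>l. mform m n (\<lambda>i. \<alpha> i * b l i) y))"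
    proof (rule multiple_summing_dominated[OF pqrs(1), rotated 2])
      fix y
      have "(\<lambda>i. \<alpha> i * b' \<eta> i) = (\<lambda>i. \<Sum>l<L. \<eta> l * (\<alpha> i * b l i))" for \<eta>
        by (simp add: b'_def sum_distrib_left mult_ac)
      then have e: "lpn p H (\<lambda>\<eta>. mform m n (\<lambda>i. \<alpha> i * b' \<eta> i) y)
         = lmean p H (\<lambda>\<eta>. \<Sum>l<L. \<eta> l * mform m n (\<lambda>i. \<alpha> i * b l i) y) * N"
        using lpn_H[of "\<lambda>l i. \<alpha> i * b l i" y] by simp
      have "c * lpn q {..<L} (\<lambda>l. mform m n (\<lambda>i. \<alpha> i * b l i) y)
          \<le> lmean p H (\<lambda>\<eta>. \<Sum>l<L. \<eta> l * mform m n (\<lambda>i. \<alpha> i * b l i) y)"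
        unfolding H_def by (rule cU)
      then show "norm (lpn q {..<L} (\<lambda>l. mform m n (\<lambda>i. \<alpha> i * b l i) y))
          \<le> 1 / (c * N) * norm (lpn p H (\<lambda>\<eta>. mform m n (\<lambda>i. \<alpha> i * b' \<eta> i) y))"
        unfolding e using N cU by (simp add: field_simps abs_mult)
    qed (use N cU in auto)
    then show "multiple_summing p m r (K * U / c * M * C) (\<lambda>y. lpn q {..<L} (\<lambda>l. mform m n (\<lambda>i. \<alpha> i * b l i) y))"
      using N by (simp add: mult_ac)
  qed (use K cU in auto)
qed

section \<open>Spaces that factor locally through sequence spaces\<close>

lemma multiple_summing_iff:
  fixes T :: "(nat \<Rightarrow> nat \<Rightarrow> 'k::real_or_complex) \<Rightarrow> 'x::real_normed_vector"
  assumes p: "0 < p" and C: "0 \<le> C"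
  shows "multiple_summing p m r C T \<longleftrightarrow>
    (\<forall>(J :: nat \<Rightarrow> nat) (x :: nat \<Rightarrow> nat \<Rightarrow> nat \<Rightarrow> 'k). (\<forall>k<m. \<forall>j<J k. x k j \<in> lspace r) \<longrightarrow>
       ennreal ((\<Sum>j\<in>PiE {..<m} (\<lambda>k. {..<J k}). norm (T (\<lambda>k\<in>{..<m}. x k (j k))) powr p) powr (1 / p))
       \<le> ennreal C * (\<Prod>k<m. weak_norm p seq_scale (lspace r) (lnorm r) (J k) (x k)))"
proof -
  have "ennreal C * (\<Prod>k<m. weak_norm p seq_scale (lspace r) (lnorm r) (J k) (x k))
      = ennreal (C * (\<Prod>k<m. enn2real (weak_lnorm p r (J k) (x k))))"
    if x: "\<forall>k<m. \<forall>j<J k. x k j \<in> lspace r" for J and x :: "nat \<Rightarrow> nat \<Rightarrow> nat \<Rightarrow> 'k"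
  proof -
    have "(\<Prod>k<m. weak_norm p seq_scale (lspace r) (lnorm r) (J k) (x k))
        = (\<Prod>k<m. ennreal (enn2real (weak_lnorm p r (J k) (x k))))"
      using weak_lnorm_finite[OF p, of "J k" "x k" r for k] x
      by (intro prod.cong refl) (simp add: weak_lnorm_def)
    also have "\<dots> = ennreal (\<Prod>k<m. enn2real (weak_lnorm p r (J k) (x k)))"
      by (simp add: prod_ennreal)
    finally show ?thesis using C by (simp add: ennreal_mult prod_nonneg)
  qed
  then show ?thesis
    using C unfolding multiple_summing_def lpn_def[symmetric]
    by (intro all_cong1 imp_cong refl) (simp add: ennreal_le_iff prod_nonneg)
qed

lemma multiple_summing_norm_eq:
  fixes T :: "(nat \<Rightarrow> nat \<Rightarrow> 'k::real_or_complex) \<Rightarrow> 'x::real_normed_vector"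
  assumes "0 < p"
  shows "multiple_summing_norm p m seq_scale (lspace r) (lnorm r) T
       = (INF C\<in>{C. 0 < C \<and> multiple_summing p m r C T}. ennreal C)"
  unfolding multiple_summing_norm_def
  using assms by (intro INF_cong) (auto simp: multiple_summing_iff)

lemma linear_on_sum:
  assumes f: "linear_on s V s' f" and V: "0 \<in> V" "\<And>u v. u \<in> V \<Longrightarrow> v \<in> V \<Longrightarrow> u + v \<in> V"
    "\<And>a v. v \<in> V \<Longrightarrow> s a v \<in> V" and v: "\<And>i. i \<in> I \<Longrightarrow> v i \<in> V"
  shows "f (\<Sum>i\<in>I. s (c i) (v i)) = (\<Sum>i\<in>I. s' (c i) (f (v i))) \<and> (\<Sum>i\<in>I. s (c i) (v i)) \<in> V"
  using v
proof (induction I rule: infinite_finite_induct)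
  case (insert i I)
  then show ?case using f V by (auto simp: linear_on_def)
next
  case empty
  have "f (0 + 0) = f 0 + f 0" using f V unfolding linear_on_def by blast
  then show ?case using V by simp
next
  case (infinite I)
  have "f (0 + 0) = f 0 + f 0" using f V unfolding linear_on_def by blast
  then show ?case using V infinite by simp
qed

lemma operator_norm_bound:
  assumes f: "linear_on s V s' f" and fin: "operator_norm V N N' f < top" and v: "v \<in> V"
    and V: "\<And>a u. u \<in> V \<Longrightarrow> s a u \<in> V"
    and N: "\<And>t. 0 \<le> t \<Longrightarrow> N (s (of_real t) v) = t * N v" "0 \<le> N v" "N v = 0 \<Longrightarrow> N' (f v) = 0"
    and N': "\<And>t. 0 \<le> t \<Longrightarrow> N' (s' (of_real t) (f v)) = t * N' (f v)"
  shows "N' (f v) \<le> enn2real (operator_norm V N N' f) * N v"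
proof (cases "N v = 0")
  case True
  then show ?thesis using N(3) by simp
next
  case False
  then have Nv: "0 < N v" using N(2) by simp
  define u where "u = s (of_real (1 / N v)) v"
  have "u \<in> V" "N u \<le> 1" using V v N(1)[of "1 / N v"] Nv by (auto simp: u_def)
  then have "ennreal (N' (f u)) \<le> operator_norm V N N' f"
    unfolding operator_norm_def by (intro SUP_upper) auto
  moreover have "f u = s' (of_real (1 / N v)) (f v)"
    using f v unfolding linear_on_def u_def by blast
  then have "N' (f u) = N' (f v) / N v" using N'[of "1 / N v"] Nv by simp
  ultimately have "ennreal (N' (f v) / N v) \<le> operator_norm V N N' f" by simp
  then have "N' (f v) / N v \<le> enn2real (operator_norm V N N' f)"
    using fin by (cases "0 \<le> N' (f v) / N v") (auto simp: le_ennreal_iff[symmetric]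
        dest: enn2real_mono intro: order_trans[OF _ enn2real_nonneg])
  then show ?thesis using Nv by (simp add: divide_le_eq)
qed

text \<open>On the span of the values \<open>x i\<close> the norm is, up to the factor \<open>lam + 1\<close>, squeezed between \<open>\<ell>\<^sub>q\<close> norms of the
  coordinates \<open>z i\<close>. Some \<open>x i\<close> must be nonzero: otherwise one operator norm can vanish while the other is infinite,
  and their product gives no bound.\<close>

lemma Lg_space_factorization:
  fixes sc :: "'k::real_or_complex \<Rightarrow> 'x::real_normed_vector \<Rightarrow> 'x"
  assumes sc: "normed_space_over sc" and lam: "Lg_space_const (ennreal q) lam sc" and q: "0 < q"
    and I: "finite I" and nz: "\<exists>i\<in>I. x i \<noteq> 0"
  obtains k A B and z :: "'i \<Rightarrow> nat \<Rightarrow> 'k" where "0 \<le> A" "0 \<le> B" "B * A \<le> lam + 1"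
    "\<And>c. lpn q {..<k} (\<lambda>l. \<Sum>i\<in>I. c i * z i l) \<le> A * norm (\<Sum>i\<in>I. sc (c i) (x i))"
    "\<And>c. norm (\<Sum>i\<in>I. sc (c i) (x i)) \<le> B * lpn q {..<k} (\<lambda>l. \<Sum>i\<in>I. c i * z i l)"
proof -
  interpret normed_space_over sc by (rule sc)
  define M where "M = module.span sc (x ` I)"
  have M: "module.subspace sc M" unfolding M_def by (rule subspace_span)
  have xM: "x i \<in> M" if "i \<in> I" for i using that by (auto simp: M_def intro: span_base)
  have Mclosed: "0 \<in> M" "\<And>u v. u \<in> M \<Longrightarrow> v \<in> M \<Longrightarrow> u + v \<in> M" "\<And>a v. v \<in> M \<Longrightarrow> sc a v \<in> M"
    using M by (auto simp: subspace_def)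
  have "\<exists>B. finite B \<and> M = module.span sc B"
    using I by (intro exI[of _ "x ` I"]) (simp add: M_def)
  then obtain k R S where R: "linear_on sc M seq_scale R" "R ` M \<subseteq> fin_seqs k"
    and S: "linear_on seq_scale (fin_seqs k) sc (S :: (nat \<Rightarrow> 'k) \<Rightarrow> 'x)" and SR: "\<And>v. v \<in> M \<Longrightarrow> S (R v) = v"
    and le: "operator_norm (fin_seqs k) (lnorm (ennreal q)) norm S * operator_norm M norm (lnorm (ennreal q)) R
           \<le> ennreal (lam + 1)"
    using lam M unfolding Lg_space_const_def by (metis zero_less_one)
  define OS OR where "OS = operator_norm (fin_seqs k) (lnorm (ennreal q)) norm S"
    and "OR = operator_norm M norm (lnorm (ennreal q)) R"
  have Fclosed: "(0 :: nat \<Rightarrow> 'k) \<in> fin_seqs k" "\<And>u v :: nat \<Rightarrow> 'k. u \<in> fin_seqs k \<Longrightarrow> v \<in> fin_seqs k \<Longrightarrow> u + v \<in> fin_seqs k"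
    "\<And>a (v :: nat \<Rightarrow> 'k). v \<in> fin_seqs k \<Longrightarrow> seq_scale a v \<in> fin_seqs k"
    by (auto simp: fin_seqs_def seq_scale_def)
  have RF: "R v \<in> fin_seqs k" if "v \<in> M" for v using R(2) that by blast
  have R0: "R 0 = 0" using linear_on_sum[OF R(1) Mclosed, of "{}"] by simp
  have S0: "S 0 = 0" using linear_on_sum[OF S Fclosed, of "{}"] by simp
  have ln: "lnorm (ennreal q) z = lpn q {..<k} z" if "z \<in> fin_seqs k" for z :: "nat \<Rightarrow> 'k"
    by (rule lnorm_fin_seqs[OF q that])
  have ln_scale: "lnorm (ennreal q) (seq_scale (of_real t) z) = t * lnorm (ennreal q) z"
    if "0 \<le> t" "z \<in> fin_seqs k" for t and z :: "nat \<Rightarrow> 'k"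
    using that q by (simp add: ln Fclosed) (intro lpn_scale, auto simp: seq_scale_def norm_mult)
  have ln0: "z = 0" if "z \<in> fin_seqs k" "lnorm (ennreal q) z = 0" for z :: "nat \<Rightarrow> 'k"
  proof
    fix l
    show "z l = 0 l"
      using that lpn_eq_0D[OF q, of "{..<k}" z l] by (cases "l < k") (auto simp: ln fin_seqs_def)
  qed
  have l0: "lnorm (ennreal q) (0 :: nat \<Rightarrow> 'k) = 0" unfolding ln[OF Fclosed(1)] by (simp add: lpn_def)
  have Rbd: "lnorm (ennreal q) (R v) \<le> enn2real OR * norm v" if "OR < top" "v \<in> M" for v
    unfolding OR_def
    by (rule operator_norm_bound[OF R(1)])
       (use that Mclosed R0 l0 in \<open>auto simp: OR_def norm_scale ln_scale RF\<close>)
  have Sbd: "norm (S z) \<le> enn2real OS * lnorm (ennreal q) z" if "OS < top" "z \<in> fin_seqs k" for z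
    unfolding OS_def
    by (rule operator_norm_bound[OF S])
       (use that Fclosed S0 S0[unfolded zero_fun_def] ln0[OF that(2)] ln[OF that(2)] in \<open>auto simp: OS_def norm_scale ln_scale\<close>)
  obtain i0 where i0: "i0 \<in> I" "x i0 \<noteq> 0" using nz by blast
  have nonzero: "OR \<noteq> 0" "OS \<noteq> 0"
  proof -
    show "OR \<noteq> 0"
    proof
      assume "OR = 0"
      then have "lnorm (ennreal q) (R (x i0)) = 0"
        using Rbd[of "x i0"] xM[OF i0(1)] by (simp add: ln RF antisym)
      then have "R (x i0) = 0" using ln0 RF xM[OF i0(1)] by blast
      then show False using SR[OF xM[OF i0(1)]] S0 i0 by simp
    qed
    show "OS \<noteq> 0"
    proof
      assume "OS = 0"
      then have "norm (S (R (x i0))) \<le> 0" using Sbd[of "R (x i0)"] RF xM[OF i0(1)] by simp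
      then show False using SR[OF xM[OF i0(1)]] i0 by simp
    qed
  qed
  have "OS * OR < top" using le by (simp add: OS_def OR_def le_less_trans)
  then have tops: "OS < top" "OR < top" using nonzero by (auto simp: ennreal_mult_less_top)
  show thesis
  proof (rule that[of "enn2real OR" "enn2real OS" k "\<lambda>i. R (x i)"])
    have "ennreal (enn2real OS * enn2real OR) = OS * OR"
      using tops by (simp add: ennreal_mult)
    then have "ennreal (enn2real OS * enn2real OR) \<le> ennreal (lam + 1)" using le by (simp add: OS_def OR_def)
    moreover have "0 < enn2real OS * enn2real OR"
      using tops nonzero by (simp add: enn2real_positive_iff zero_less_iff_neq_zero)
    ultimately show "enn2real OS * enn2real OR \<le> lam + 1"
      by (metis ennreal_le_iff ennreal_neg linorder_not_le order_less_imp_le ennreal_le_iff2)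
    fix c
    define v where "v = (\<Sum>i\<in>I. sc (c i) (x i))"
    have v: "R v = (\<Sum>i\<in>I. seq_scale (c i) (R (x i)))" "v \<in> M"
      unfolding v_def using linear_on_sum[OF R(1) Mclosed xM, where I = I and c = c] by auto
    have Rv: "lnorm (ennreal q) (R v) = lpn q {..<k} (\<lambda>l. \<Sum>i\<in>I. c i * R (x i) l)"
      unfolding ln[OF RF[OF v(2)]] by (rule lpn_cong) (simp_all add: v(1) sum_seq_apply seq_scale_def)
    show "lpn q {..<k} (\<lambda>l. \<Sum>i\<in>I. c i * R (x i) l) \<le> enn2real OR * norm (\<Sum>i\<in>I. sc (c i) (x i))"
      using Rbd[OF tops(2) v(2)] unfolding Rv by (simp add: v_def)
    show "norm (\<Sum>i\<in>I. sc (c i) (x i)) \<le> enn2real OS * lpn q {..<k} (\<lambda>l. \<Sum>i\<in>I. c i * R (x i) l)"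
      using Sbd[OF tops(1) RF[OF v(2)]] SR[OF v(2)] unfolding Rv by (simp add: v_def)
  qed auto
qed

theorem theorem1p6:
  fixes m :: nat and r r' :: ennreal and q p :: real
    and sc :: "'k::real_or_complex \<Rightarrow> 'x::real_normed_vector \<Rightarrow> 'x"
  assumes "1 \<le> m"
    and "1 \<le> r" and "1 / r + 1 / r' = 1"
    and "1 \<le> q" and "0 < p"
    and "normed_space_over sc" and "Lg_space (ennreal q) sc"
    and "(r = 2 \<and> p < 2 \<and> q < 2) \<or> (r = 2 \<and> q \<le> p) \<or> (ennreal p < r' \<and> r' < 2 \<and> q \<le> 2)"
  shows "\<exists>K>0. \<forall>(n :: nat \<Rightarrow> nat) (x :: (nat \<Rightarrow> nat) \<Rightarrow> 'x) (\<alpha> :: (nat \<Rightarrow> nat) \<Rightarrow> 'k).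
    (let I = PiE {..<m} (\<lambda>k. {..<n k});
         \<pi> = multiple_summing_norm p m seq_scale (lspace r :: (nat \<Rightarrow> 'k) set) (lnorm r)
     in \<pi> (\<lambda>y. \<Sum>i\<in>I. sc (\<alpha> i) (elementary_map sc m i (x i) y))
        \<le> ennreal (K * Max ((\<lambda>i. norm (\<alpha> i)) ` I))
           * \<pi> (\<lambda>y. \<Sum>i\<in>I. elementary_map sc m i (x i) y))"
proof -
  interpret normed_space_over sc by fact
  have p: "0 < p" and q: "0 < q" using assms by auto
  obtain s where s: "conjugate r s" "s \<le> 2" "s = 2 \<or> p < s" "q \<le> p \<or> q \<le> 2"
  proof (cases "r = 2")
    case True
    then have "q \<le> p \<or> q \<le> 2" using assms(8) by auto
    then show thesis using True conjugate_2 by (intro that[of 2]) auto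
  next
    case False
    then have c: "ennreal p < r'" "r' < 2" "q \<le> 2" using assms(8) by auto
    obtain s where "r' = ennreal s" "0 < s" "s < 2" "conjugate r s"
      by (rule conjugate_exponent[OF assms(2,3) c(2)])
    then show thesis using c p by (intro that[of s]) (auto simp: ennreal_less_iff)
  qed
  obtain lam where lam: "1 \<le> lam" "Lg_space_const (ennreal q) lam sc"
    using assms(7) by (auto simp: Lg_space_def)
  obtain K where K: "0 < K"
    "\<And>n L M C \<alpha> (b :: nat \<Rightarrow> (nat \<Rightarrow> nat) \<Rightarrow> 'k). 0 \<le> M \<Longrightarrow> 0 \<le> C \<Longrightarrow>
        (\<And>i. i \<in> PiE {..<m} (\<lambda>k. {..<n k}) \<Longrightarrow> norm (\<alpha> i) \<le> M) \<Longrightarrow>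
        multiple_summing p m r C (\<lambda>y. lpn q {..<L} (\<lambda>l. mform m n (b l) y)) \<Longrightarrow>
        multiple_summing p m r (K * M * C) (\<lambda>y. lpn q {..<L} (\<lambda>l. mform m n (\<lambda>i. \<alpha> i * b l i) y))"
    by (rule lq_unconditional[OF p q s, where m = m and 'k = 'k]) blast
  define \<pi> :: "((nat \<Rightarrow> nat \<Rightarrow> 'k) \<Rightarrow> 'x) \<Rightarrow> ennreal"
    where "\<pi> = multiple_summing_norm p m seq_scale (lspace r) (lnorm r)"
  have \<pi>: "\<pi> T = (INF C\<in>{C. 0 < C \<and> multiple_summing p m r C T}. ennreal C)" for T
    unfolding \<pi>_def by (rule multiple_summing_norm_eq[OF p])
  have \<pi>_le: "\<pi> T \<le> ennreal C" if "0 < C" "multiple_summing p m r C T" for C T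
    unfolding \<pi> using that by (intro INF_lower) auto
  define K' where "K' = K * (lam + 1)"
  have K': "0 < K'" using K lam by (simp add: K'_def)
  have "\<pi> (\<lambda>y. \<Sum>i\<in>I. sc (\<alpha> i) (elementary_map sc m i (x i) y))
      \<le> ennreal (K' * Max ((\<lambda>i. norm (\<alpha> i)) ` I)) * \<pi> (\<lambda>y. \<Sum>i\<in>I. elementary_map sc m i (x i) y)"
    (is "\<pi> ?T\<^sub>\<alpha> \<le> ennreal (K' * ?M) * \<pi> ?T")
    if I_def: "I = PiE {..<m} (\<lambda>k. {..<n k})" for n I and x :: "(nat \<Rightarrow> nat) \<Rightarrow> 'x" and \<alpha>
  proof (cases "\<exists>i\<in>I. \<alpha> i \<noteq> 0 \<and> x i \<noteq> 0")
    (* This case covers an empty index set, where Max is unspecified, and a product of 0 and infinity on the right. *)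
    case False
    then have zero: "?T\<^sub>\<alpha> = (\<lambda>_. 0)"
      by (intro ext sum.neutral) (auto simp: elementary_map_def)
    have "\<pi> ?T\<^sub>\<alpha> \<le> 0"
    proof (rule ennreal_le_epsilon)
      fix e :: real assume "0 < e"
      then show "\<pi> ?T\<^sub>\<alpha> \<le> 0 + ennreal e"
        unfolding zero by (simp add: \<pi>_le multiple_summing_zero)
    qed
    then show ?thesis by simp
  next
    case True
    then obtain i0 where i0: "i0 \<in> I" "\<alpha> i0 \<noteq> 0" "x i0 \<noteq> 0" by blast
    have fin: "finite I" unfolding I_def by (simp add: finite_PiE)
    have \<alpha>: "norm (\<alpha> i) \<le> ?M" if "i \<in> I" for i using fin that by (intro Max_ge) auto
    have M: "0 < ?M" using \<alpha>[OF i0(1)] i0(2) by (meson order_less_le_trans zero_less_norm_iff)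
    have "\<exists>i\<in>I. x i \<noteq> 0" using i0 by blast
    then obtain k A B and z :: "(nat \<Rightarrow> nat) \<Rightarrow> nat \<Rightarrow> 'k" where AB: "0 \<le> A" "0 \<le> B" "B * A \<le> lam + 1"
      and R: "\<And>c. lpn q {..<k} (\<lambda>l. \<Sum>i\<in>I. c i * z i l) \<le> A * norm (\<Sum>i\<in>I. sc (c i) (x i))"
      and S: "\<And>c. norm (\<Sum>i\<in>I. sc (c i) (x i)) \<le> B * lpn q {..<k} (\<lambda>l. \<Sum>i\<in>I. c i * z i l)"
      by (rule Lg_space_factorization[OF assms(6) lam(2) q fin]) blast
    have step: "\<pi> ?T\<^sub>\<alpha> \<le> ennreal (K' * ?M * C)" if C: "0 < C" "multiple_summing p m r C ?T" for C
    proof (rule \<pi>_le)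
      have "multiple_summing p m r (A * C) (\<lambda>y. lpn q {..<k} (\<lambda>l. mform m n (\<lambda>i. z i l) y))"
      proof (rule multiple_summing_dominated[OF p AB(1) _ C(2)])
        fix y :: "nat \<Rightarrow> nat \<Rightarrow> 'k"
        show "norm (lpn q {..<k} (\<lambda>l. mform m n (\<lambda>i. z i l) y)) \<le> A * norm (?T y)"
          using R[of "\<lambda>i. \<Prod>k<m. y k (i k)"] by (simp add: mform_def elementary_map_def I_def)
      qed
      then have "multiple_summing p m r (K * ?M * (A * C)) (\<lambda>y. lpn q {..<k} (\<lambda>l. mform m n (\<lambda>i. \<alpha> i * z i l) y))"
        using M AB C \<alpha> by (intro K(2)) (auto simp: I_def)
      then have "multiple_summing p m r (B * (K * ?M * (A * C))) ?T\<^sub>\<alpha>"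
      proof (rule multiple_summing_dominated[OF p AB(2), rotated])
        fix y :: "nat \<Rightarrow> nat \<Rightarrow> 'k"
        show "norm (?T\<^sub>\<alpha> y) \<le> B * norm (lpn q {..<k} (\<lambda>l. mform m n (\<lambda>i. \<alpha> i * z i l) y))"
          using S[of "\<lambda>i. \<alpha> i * (\<Prod>k<m. y k (i k))"]
          by (simp add: mform_def elementary_map_def I_def mult_ac)
      qed
      moreover have "B * (K * ?M * (A * C)) \<le> K' * ?M * C"
      proof -
        have "(B * A) * (K * ?M * C) \<le> (lam + 1) * (K * ?M * C)"
          using AB(3) K M C by (intro mult_right_mono) auto
        then show ?thesis by (simp add: K'_def mult_ac)
      qed
      ultimately show "multiple_summing p m r (K' * ?M * C) ?T\<^sub>\<alpha>"
        by (rule multiple_summing_mono)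
    qed (use K' M C in auto)
    (* Multiplication by 1 / c moves the constant out of the infimum. *)
    define c where "c = K' * ?M"
    have c: "0 < c" using K' M by (simp add: c_def)
    have "ennreal (1 / c) * \<pi> ?T\<^sub>\<alpha> \<le> \<pi> ?T"
      unfolding \<pi>[of ?T]
    proof (rule INF_greatest)
      fix C assume C: "C \<in> {C. 0 < C \<and> multiple_summing p m r C ?T}"
      then have "ennreal (1 / c) * \<pi> ?T\<^sub>\<alpha> \<le> ennreal (1 / c) * ennreal (c * C)"
        using step[of C] by (intro mult_left_mono) (auto simp: c_def)
      also have "\<dots> = ennreal C" using c C by (simp flip: ennreal_mult)
      finally show "ennreal (1 / c) * \<pi> ?T\<^sub>\<alpha> \<le> ennreal C" .
    qed
    then have "ennreal c * (ennreal (1 / c) * \<pi> ?T\<^sub>\<alpha>) \<le> ennreal c * \<pi> ?T"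
      by (intro mult_left_mono) auto
    moreover have "ennreal c * (ennreal (1 / c) * \<pi> ?T\<^sub>\<alpha>) = \<pi> ?T\<^sub>\<alpha>"
      using c by (simp add: mult.assoc[symmetric] flip: ennreal_mult)
    ultimately show ?thesis by (simp add: c_def)
  qed
  then show ?thesis using K' unfolding \<pi>_def by (auto simp: Let_def)
qed

end
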